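(* Let $\Delta \subset \mathbb{R}^n$ be a Delzant polytope with $d$ facets $F_1,\dots,F_d$, let $n_1,\dots,n_d \in \mathbb{Z}^n$ be the primitive outward lattice normal vectors to these facets, and let $\mu_1,\dots,\mu_d$ be positive real numbers such that $$\Delta = \bigcap_{i=1}^d \{x \in \mathbb{R}^n : \langle x, n_i\rangle \le \mu_i\}.$$ For $\lambda = (\lambda_1,\dots,\lambda_d)$ set $\Delta(\lambda_1,\dots,\lambda_d) = \bigcap_{i=1}^d \{x \in \mathbb{R}^n : \langle x, n_i\rangle \le \lambda_i\}$, so $\Delta(\mu_1,\dots,\mu_d)=\Delta$, and let $\mathrm{vol}(\partial\Delta(\lambda_1,\dots,\lambda_d))$ denote the sum over the facets of $\Delta(\lambda_1,\dots,\lambda_d)$ of the Euclidean $(n-1)$-dimensional volume of the facet divided by the Euclidean length $\|n_i\|$ of the corresponding primitive normal; this is a polynomial in $\lambda_1,\dots,\lambda_d$ (for $\lambda$ near $\mu$, extended as a polynomial). For a positive integer $k$ let $R_{\partial\Delta}(k) = \#\big((k\,\partial\Delta)\cap \mathbb{Z}^n\big)$. Then for every positive integer $k$, $$R_{\partial \Delta}(k) = \Big(\prod_{i=1}^d \hat{A}\big(\tfrac{\partial}{\partial \lambda_i}\big)\Big)\,\frac{1}{\hat{A}}\Big(\sum_{i=1}^d \tfrac{\partial}{\partial \lambda_i}\Big)\,\mathrm{vol}\big(\partial \Delta(\lambda_1,\dots,\lambda_d)\big)\Big|_{\lambda_i = k\mu_i,\ i=1,\dots,d}.$$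
   Context: A convex polytope $\Delta\subset\mathbb{R}^n$ is integral if its vertices lie in $\mathbb{Z}^n$; it is Delzant if it is integral and at each vertex the edge vectors can be chosen to form a basis of $\mathbb{Z}^n$. For real $x$, $\hat{A}(x) = \frac{x/2}{\sinh(x/2)}$, which is analytic near $0$ with power series $\hat{A}(x) = 1+\sum_{j\ge1} c_j x^{2j}$; likewise $\frac{1}{\hat{A}(x)} = \frac{\sinh(x/2)}{x/2} = 1+\sum_{j\ge 1} d_j x^{2j}$. The infinite-order differential operators are defined by substituting into these power series: $\hat{A}(\frac{\partial}{\partial\lambda_i}) = 1+\sum_{j\ge1} c_j (\frac{\partial}{\partial\lambda_i})^{2j}$ and $\frac{1}{\hat{A}}(\sum_i \frac{\partial}{\partial\lambda_i}) = 1+\sum_{j\ge1} d_j (\sum_{i=1}^d\frac{\partial}{\partial\lambda_i})^{2j}$. Since they are applied to a polynomial, only finitely many terms contribute. *)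

theory Defs
  imports "HOL-Analysis.Analysis"
begin

definition int_vec :: "real^'n \<Rightarrow> bool" where
  "int_vec z \<longleftrightarrow> (\<forall>i. z $ i \<in> \<int>)"

definition primitive_vec :: "real^'n \<Rightarrow> bool" where
  "primitive_vec v \<longleftrightarrow> int_vec v \<and> v \<noteq> 0 \<and>
     (\<forall>w (m::int). int_vec w \<and> m \<ge> 1 \<and> v = of_int m *\<^sub>R w \<longrightarrow> m = 1)"

definition lattice_basis :: "(real^'n) set \<Rightarrow> bool" where
  "lattice_basis B \<longleftrightarrow> finite B \<and> card B = CARD('n) \<and> (\<forall>b\<in>B. int_vec b) \<and>
     (\<forall>z. int_vec z \<longrightarrow> (\<exists>c::real^'n \<Rightarrow> int. z = (\<Sum>b\<in>B. of_int (c b) *\<^sub>R b)))"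

definition integral_polytope :: "(real^'n) set \<Rightarrow> bool" where
  "integral_polytope P \<longleftrightarrow> polytope P \<and> (\<forall>v. v extreme_point_of P \<longrightarrow> int_vec v)"

definition delzant :: "(real^'n) set \<Rightarrow> bool" where
  "delzant P \<longleftrightarrow> integral_polytope P \<and>
     (\<forall>v. v extreme_point_of P \<longrightarrow>
        (\<exists>u :: (real^'n) set \<Rightarrow> real^'n.
            inj_on u {e. e edge_of P \<and> v \<in> e} \<and>
            (\<forall>e. e edge_of P \<and> v \<in> e \<longrightarrow> u e \<noteq> 0 \<and> (\<exists>t>0. v + t *\<^sub>R u e \<in> e)) \<and>
            lattice_basis (u ` {e. e edge_of P \<and> v \<in> e})))"

(* Euclidean (n-1)-dimensional volume of a set S lying in a hyperplane with normal a:
   the n-dimensional Lebesgue volume of the orthogonal prism of height 1 over S *)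
definition hvol :: "(real^'n) set \<Rightarrow> real^'n \<Rightarrow> real" where
  "hvol S a = measure lebesgue {x + t *\<^sub>R (a /\<^sub>R norm a) | x t. x \<in> S \<and> t \<in> {0..1}}"

definition poly_of :: "nat \<Rightarrow> (nat \<Rightarrow> real^'n) \<Rightarrow> (nat \<Rightarrow> real) \<Rightarrow> (real^'n) set" where
  "poly_of d N lam = (\<Inter>i\<in>{..<d}. {x. x \<bullet> N i \<le> lam i})"

definition vol_boundary :: "nat \<Rightarrow> (nat \<Rightarrow> real^'n) \<Rightarrow> (nat \<Rightarrow> real) \<Rightarrow> real" where
  "vol_boundary d N lam =
     (\<Sum>i<d. hvol (poly_of d N lam \<inter> {x. x \<bullet> N i = lam i}) (N i) / norm (N i))"

definition partial :: "nat \<Rightarrow> ((nat \<Rightarrow> real) \<Rightarrow> real) \<Rightarrow> (nat \<Rightarrow> real) \<Rightarrow> real" where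
  "partial i f x = deriv (\<lambda>t. f (x(i := x i + t))) 0"

definition sum_partial :: "nat \<Rightarrow> ((nat \<Rightarrow> real) \<Rightarrow> real) \<Rightarrow> (nat \<Rightarrow> real) \<Rightarrow> real" where
  "sum_partial d f x = (\<Sum>i<d. partial i f x)"

definition Ahat :: "real \<Rightarrow> real" where
  "Ahat x = (if x = 0 then 1 else (x/2) / sinh (x/2))"

definition inv_Ahat :: "real \<Rightarrow> real" where
  "inv_Ahat x = (if x = 0 then 1 else sinh (x/2) / (x/2))"

definition taylor_coeff :: "(real \<Rightarrow> real) \<Rightarrow> nat \<Rightarrow> real" where
  "taylor_coeff f n = (deriv ^^ n) f 0 / fact n"

(* truncation at order N of
   (prod_{i<d} Ahat(d/d lambda_i)) (1/Ahat)(sum_i d/d lambda_i) f, evaluated at x: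
   sum over j_0..j_{d-1} <= N and m <= N of
   prod_i c_{j_i} * d_m * (d/d lambda_0)^{2 j_0} ... (d/d lambda_{d-1})^{2 j_{d-1}} (sum_i d/d lambda_i)^{2m} f *)
definition todd_op_trunc ::
  "nat \<Rightarrow> nat \<Rightarrow> ((nat \<Rightarrow> real) \<Rightarrow> real) \<Rightarrow> (nat \<Rightarrow> real) \<Rightarrow> real" where
  "todd_op_trunc d N f x =
     (\<Sum>j\<in>PiE {..<d} (\<lambda>_. {..N}). \<Sum>m\<le>N.
        (\<Prod>i<d. taylor_coeff Ahat (2 * j i)) * taylor_coeff inv_Ahat (2 * m) *
        foldr (\<lambda>i g. (partial i ^^ (2 * j i)) g) [0..<d] ((sum_partial d ^^ (2 * m)) f) x)"

end

theory Submission
  imports Defs "HOL-Analysis.FPS_Convergence"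
begin

text \<open>
  Fix a direction \<open>\<xi>\<close> that is orthogonal to no edge. The indicator function of a simple polytope
  is the sum over its vertices of signed indicators of half-open cones, obtained from the vertex
  cones by flipping the edges on which \<open>\<xi>\<close> increases (Lawrence and Varchenko). This sum does not change
  when \<open>\<xi>\<close> crosses a wall, because the contributions of the two end points of each edge orthogonal
  to the wall cancel; outside the polytope it vanishes, since \<open>\<xi>\<close> can be moved to a separating
  direction, and inside only the \<open>\<xi>\<close>-maximal vertex contributes.

  On the polarized cones \<open>exp (t * (\<xi> \<bullet> x))\<close> can be summed over lattice points and
  integrated over facets, and both operations factor into one-dimensional ones because the cones are unimodular.
  With edge vectors \<open>u\<^sub>j\<close> at the vertex \<open>v\<close>, \<open>y\<^sub>j = - \<xi> \<bullet> u\<^sub>j\<close> and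
  \<open>Y = \<Sum>\<^sub>j y\<^sub>j\<close>, the boundary volume becomes
  \<open>\<Sum>\<^sub>v (Y / \<Prod>\<^sub>j y\<^sub>j) * t ^ (1 - n) * exp (t * (\<xi> \<bullet> v))\<close>, and the lattice point sum over the boundary, as a
  difference between the closed polytope and its interior, acquires the additional factor
  \<open>(\<Prod>\<^sub>j Ahat (t * y\<^sub>j)) * inv_Ahat (t * Y)\<close> in each term. Since \<open>\<xi> \<bullet> v = \<Sum>\<^sub>j y\<^sub>j * \<lambda>\<^sub>j\<close>, this factor is what the
  differential operator produces, and the theorem is the comparison of the coefficients of \<open>t ^ 0\<close>.
\<close>

section \<open>Power series of the two operators\<close>

text \<open>A single vertex term may have a pole at t = 0, so neither the number of lattice points
  nor the volume can be read off vertex by vertex. Only the whole sum has a limit; since it is a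
  power series divided by \<open>t ^ (n - 1)\<close>, that limit is the coefficient of
  \<open>t ^ (n - 1)\<close> of the series. Without the two A-hat factors the same comparison writes
  the boundary volume as a sum over vertices of multiples of
  \<open>l ^ (n - 1) / fact (n - 1)\<close> with \<open>l\<close> linear in
  \<open>\<lambda>\<close>. On \<open>exp (t * l)\<close> the derivative in
  \<open>\<lambda>\<^sub>i\<close> is multiplication by \<open>t * y\<^sub>i\<close>, so the
  operator supplies exactly the missing factors, and its truncations are exact from order n - 1 on.

  The volume has this form only while the polytope keeps its combinatorial type. Hence the formulas
  are proved on an open set of nondegenerate \<open>\<lambda>\<close>, with vertices indexed by sets
  of facets instead of points, so that the index set does not move with \<open>\<lambda>\<close>.
  Derivatives at the point of evaluation see nothing else.\<close>

lemma has_fps_expansion_at_0: "f has_fps_expansion F \<Longrightarrow> f 0 = fps_nth F 0"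
  by (auto simp: has_fps_expansion_def eval_fps_at_0 dest: eventually_nhds_x_imp_x)

lemma taylor_coeff_eq_fps_nth:
  fixes f :: "real \<Rightarrow> real"
  assumes "f has_fps_expansion F"
  shows "taylor_coeff f n = fps_nth F n"
proof -
  have "(deriv ^^ n) f has_fps_expansion (fps_deriv ^^ n) F"
    using assms by (induction n) (auto intro: has_fps_expansion_deriv)
  then have "(deriv ^^ n) f 0 = fact n * fps_nth F n"
    by (simp add: has_fps_expansion_at_0 fps_0th_higher_deriv)
  then show ?thesis by (simp add: taylor_coeff_def)
qed

lemma has_fps_expansion_scale:
  fixes f :: "real \<Rightarrow> real"
  assumes "f has_fps_expansion F"
  shows "(\<lambda>x. f (c * x)) has_fps_expansion fps_compose F (fps_const c * fps_X)"
proof -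
  let ?G = "fps_compose F (fps_const c * fps_X)"
  have nth: "fps_nth ?G n = c ^ n * fps_nth F n" for n by simp
  have "fps_conv_radius ?G > 0"
  \<comment> \<open>The scaling rule for the radius divides by \<open>norm c\<close>, so the
    constant series is treated apart.\<close>
  proof (cases "c = 0")
    case True
    then have "fps_nth ?G = (\<lambda>n. if n = 0 then fps_nth F 0 else 0)" by (auto simp: nth)
    then have "?G = fps_const (fps_nth F 0)" by (simp add: fps_eq_iff)
    then show ?thesis by simp
  next
    case False
    have "fps_conv_radius ?G = conv_radius (\<lambda>n. c ^ n * fps_nth F n)"
      by (simp add: fps_conv_radius_def nth)
    also have "\<dots> = fps_conv_radius F / ereal (norm c)"
      using False by (subst conv_radius_mult_power) (auto simp: fps_conv_radius_def)
    also have "\<dots> > 0" using assms False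
      by (simp add: has_fps_expansion_def ereal_zero_less_0_iff divide_ereal_def)
    finally show ?thesis .
  qed
  moreover have "((\<lambda>x. c * x) \<longlongrightarrow> 0) (nhds 0)"
    using tendsto_mult_left[OF filterlim_ident, of c "0::real"] by simp
  then have "eventually (\<lambda>x. eval_fps F (c * x) = f (c * x)) (nhds 0)"
    using assms unfolding has_fps_expansion_def filterlim_iff by blast
  moreover have "eval_fps ?G x = eval_fps F (c * x)" for x
    unfolding eval_fps_def nth power_mult_distrib by (simp only: mult_ac)
  ultimately show ?thesis by (simp add: has_fps_expansion_def)
qed

lemma has_fps_expansion_imp_tendsto:
  fixes f :: "real \<Rightarrow> real"
  assumes "f has_fps_expansion F"
  shows "(f \<longlongrightarrow> fps_nth F 0) (at 0)"
  using has_fps_expansion_imp_continuous[OF assms, of UNIV] has_fps_expansion_at_0[OF assms]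
  by (simp add: continuous_within)

lemma has_fps_expansion_imp_tendsto_shift:
  fixes g :: "real \<Rightarrow> real"
  assumes "g has_fps_expansion G" "m \<le> subdegree G"
  shows "((\<lambda>t. g t / t ^ m) \<longlongrightarrow> fps_nth G m) (at 0)"
proof -
  have "((\<lambda>x. if x = 0 then fps_nth G m else g x / x ^ m) \<longlongrightarrow> fps_nth G m) (at 0)"
    using has_fps_expansion_imp_tendsto[OF has_fps_expansion_shift[OF assms refl]] by simp
  then show ?thesis
    by (rule Lim_transform_eventually) (simp add: eventually_at_filter)
qed

text \<open>The existence of the limit already rules out a subdegree s below \<open>m\<close>:
  otherwise \<open>g t / t ^ s\<close> would tend both to the nonzero leading coefficient and to 0.
  In this way the poles of the single vertex terms are seen to cancel in their sum.\<close>

lemma fps_nth_eq_limit: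
  fixes g :: "real \<Rightarrow> real"
  assumes g: "g has_fps_expansion G" and lim: "((\<lambda>t. g t / t ^ m) \<longlongrightarrow> L) (at 0)"
  shows "fps_nth G m = L"
proof (cases "G = 0")
  case True
  then have "eventually (\<lambda>t. g t = 0) (nhds 0)" using g
    by (auto simp: has_fps_expansion_def elim: eventually_mono)
  then have "eventually (\<lambda>t. g t / t ^ m = 0) (at 0)"
    unfolding eventually_at_filter by (rule eventually_mono) simp
  then have "((\<lambda>t. g t / t ^ m) \<longlongrightarrow> 0) (at 0)" by (rule tendsto_eventually)
  with lim have "L = 0" by (rule tendsto_unique[rotated]) simp
  then show ?thesis using True by simp
next
  case False
  define s where "s = subdegree G"
  have s: "((\<lambda>x. g x / x ^ s) \<longlongrightarrow> fps_nth G s) (at 0)" "fps_nth G s \<noteq> 0"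
    unfolding s_def using False by (simp_all add: has_fps_expansion_imp_tendsto_shift[OF g])
  show ?thesis
  proof (cases "m \<le> s")
    case True
    then show ?thesis
      using tendsto_unique[OF _ has_fps_expansion_imp_tendsto_shift[OF g] lim] by (simp add: s_def)
  next
    case m: False
    have "((\<lambda>x. g x / x ^ m * x ^ (m - s)) \<longlongrightarrow> L * 0 ^ (m - s)) (at 0)"
      by (intro tendsto_intros lim)
    moreover have "eventually (\<lambda>x. g x / x ^ m * x ^ (m - s) = g x / x ^ s) (at 0)"
      using m by (simp add: eventually_at_filter power_diff)
    ultimately have "((\<lambda>x. g x / x ^ s) \<longlongrightarrow> L * 0 ^ (m - s)) (at 0)"
      by (rule Lim_transform_eventually)
    then have "fps_nth G s = L * 0 ^ (m - s)" by (rule tendsto_unique[OF _ s(1), rotated]) simp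
    with s(2) m show ?thesis by simp
  qed
qed

text \<open>\<open>sinh (x/2) / (x/2)\<close> is \<open>(exp (x/2) - exp (-x/2)) / x\<close>, and
  the shift by 1 is the division by x.\<close>

definition fps_inv_Ahat :: "real fps" where
  "fps_inv_Ahat = fps_shift 1 (fps_exp (1/2) - fps_exp (-1/2))"

definition fps_Ahat :: "real fps" where "fps_Ahat = inverse fps_inv_Ahat"

lemma fps_inv_Ahat_nth:
  "fps_nth fps_inv_Ahat n = ((1/2) ^ Suc n - (-1/2) ^ Suc n) / fact (Suc n)"
  by (simp add: fps_inv_Ahat_def diff_divide_distrib del: fact_Suc power_Suc)

lemma inv_Ahat_expansion: "inv_Ahat has_fps_expansion fps_inv_Ahat"
proof -
  let ?F = "fps_exp (1/2) - fps_exp (-1/2) :: real fps"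
  have F: "(\<lambda>x. exp (1/2 * x) - exp (-1/2 * x)) has_fps_expansion ?F"
    by (intro fps_expansion_intros)
  have "fps_nth ?F 0 = 0" "fps_nth ?F 1 \<noteq> 0" by auto
  moreover from this(2) have "?F \<noteq> 0" by (metis fps_zero_nth)
  ultimately have "1 \<le> subdegree ?F" by (intro subdegree_geI) auto
  have "(\<lambda>x. if x = 0 then 1 else (exp (1/2 * x) - exp (-1/2 * x)) / x ^ 1) has_fps_expansion fps_inv_Ahat"
    unfolding fps_inv_Ahat_def by (rule has_fps_expansion_shift[OF F \<open>1 \<le> subdegree ?F\<close>]) simp
  moreover have "(\<lambda>x. if x = 0 then 1 else (exp (1/2 * x) - exp (-1/2 * x)) / x ^ 1) = inv_Ahat"
    by (auto simp: inv_Ahat_def sinh_def fun_eq_iff field_simps)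
  ultimately show ?thesis by simp
qed

lemma Ahat_eq_inverse: "Ahat x = inverse (inv_Ahat x)"
  by (auto simp: inv_Ahat_def Ahat_def)

lemma Ahat_expansion: "Ahat has_fps_expansion fps_Ahat"
  unfolding fps_Ahat_def Ahat_eq_inverse[abs_def]
  by (intro has_fps_expansion_inverse inv_Ahat_expansion) (simp add: fps_inv_Ahat_nth)

lemma fps_inv_Ahat_odd: "odd n \<Longrightarrow> fps_nth fps_inv_Ahat n = 0"
  by (simp add: fps_inv_Ahat_nth)

text \<open>Substituting \<open>- X\<close> commutes with inversion, so the inverse of an even
  series is even. The operators of the theorem list even exponents only; with both series even, this
  is the whole series.\<close>

lemma fps_Ahat_odd: assumes "odd n" shows "fps_nth fps_Ahat n = 0"
proof -
  have *: "fps_compose fps_inv_Ahat (fps_const (-1) * fps_X) = fps_inv_Ahat"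
    unfolding fps_eq_iff fps_nth_compose_linear
  proof
    show "(-1) ^ n * fps_nth fps_inv_Ahat n = fps_nth fps_inv_Ahat n" for n
      by (cases "even n") (simp_all add: fps_inv_Ahat_odd)
  qed
  have "fps_compose fps_Ahat (fps_const (-1) * fps_X) = fps_Ahat"
    unfolding fps_Ahat_def
    by (subst fps_inverse_compose) (use * in \<open>simp_all add: fps_inv_Ahat_nth\<close>)
  then have "fps_nth (fps_compose fps_Ahat (fps_const (-1) * fps_X)) n = fps_nth fps_Ahat n" by simp
  then show ?thesis using assms unfolding fps_nth_compose_linear by simp
qed

lemmas taylor_Ahat = taylor_coeff_eq_fps_nth[OF Ahat_expansion]
  and taylor_inv_Ahat = taylor_coeff_eq_fps_nth[OF inv_Ahat_expansion]

section \<open>Differential operators on sums of powers of linear forms\<close>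

text \<open>The \<open>r\<close>-th derivative of \<open>s ^ m / fact m\<close>.\<close>
definition dpow :: "nat \<Rightarrow> nat \<Rightarrow> real \<Rightarrow> real" where
  "dpow m r s = (if r \<le> m then s ^ (m - r) / fact (m - r) else 0)"

lemma dpow_deriv: "(dpow m r has_real_derivative dpow m (Suc r) s) (at s)"
proof (cases "r < m")
  case True
  then obtain k where k: "m - r = Suc k" by (metis Suc_diff_Suc)
  have "((\<lambda>s. s ^ Suc k / fact (Suc k)) has_real_derivative s ^ k / fact k) (at s)"
    by (rule DERIV_cdivide[OF DERIV_pow, THEN DERIV_cong]) (simp del: of_nat_Suc)
  moreover have "dpow m r = (\<lambda>s. s ^ Suc k / fact (Suc k))"
    using True k by (auto simp: dpow_def fun_eq_iff)
  moreover have "dpow m (Suc r) s = s ^ k / fact k"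
    using True k by (auto simp: dpow_def Suc_diff_Suc) (metis Suc_diff_Suc diff_Suc_1)+
  ultimately show ?thesis by simp
next
  case False
  then have "dpow m r = (\<lambda>s. if r = m then 1 else 0)" "dpow m (Suc r) s = 0"
    by (auto simp: dpow_def fun_eq_iff)
  then show ?thesis by simp
qed

definition lin_form :: "nat \<Rightarrow> (nat \<Rightarrow> real) \<Rightarrow> (nat \<Rightarrow> real) \<Rightarrow> real" where
  "lin_form d y x = (\<Sum>i<d. y i * x i)"

text \<open>Only the coordinates below \<open>d\<close> are restricted, since the functions at hand ignore the others.\<close>
definition nbox :: "nat \<Rightarrow> (nat \<Rightarrow> real) \<Rightarrow> real \<Rightarrow> (nat \<Rightarrow> real) set" where
  "nbox d x0 \<delta> = {x. \<forall>i<d. \<bar>x i - x0 i\<bar> < \<delta>}"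

lemma nbox_update: 
  assumes "x \<in> nbox d x0 \<delta>" "i < d"
  shows "eventually (\<lambda>t. x(i := x i + t) \<in> nbox d x0 \<delta>) (nhds 0)"
proof -
  have "((\<lambda>t. \<bar>x i + t - x0 i\<bar>) \<longlongrightarrow> \<bar>x i + 0 - x0 i\<bar>) (nhds 0)"
    by (intro tendsto_intros filterlim_ident)
  then have "eventually (\<lambda>t. \<bar>x i + t - x0 i\<bar> < \<delta>) (nhds 0)"
    using assms by (intro order_tendstoD) (auto simp: nbox_def)
  then show ?thesis by (rule eventually_mono) (use assms in \<open>auto simp: nbox_def\<close>)
qed

locale power_sum_rep =
  fixes d m :: nat and V :: "'b set" and y :: "'b \<Rightarrow> nat \<Rightarrow> real"
    and x0 :: "nat \<Rightarrow> real" and \<delta> :: real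
  assumes finV: "finite V"
begin

text \<open>Agreement is asked on a box only, because the boundary volume is such a power sum only
  near the point of evaluation. The box is open in the first \<open>d\<close> coordinates, so
  derivatives at its points see the power sum, and the property survives iterated
  differentiation.\<close>

definition rep :: "('b \<Rightarrow> real) \<Rightarrow> nat \<Rightarrow> ((nat \<Rightarrow> real) \<Rightarrow> real) \<Rightarrow> bool" where
  "rep c r f \<longleftrightarrow> (\<forall>x \<in> nbox d x0 \<delta>. f x = (\<Sum>b\<in>V. c b * dpow m r (lin_form d (y b) x)))"

lemma rep_partial:
  assumes f: "rep c r f" and i: "i < d"
  shows "rep (\<lambda>b. c b * y b i) (Suc r) (partial i f)"
  unfolding rep_def
proof
  fix x assume x: "x \<in> nbox d x0 \<delta>"
  have lin: "lin_form d (y b) (x(i := x i + t)) = lin_form d (y b) x + y b i * t" for b t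
  proof -
    have "lin_form d (y b) (x(i := x i + t)) = (\<Sum>j<d. y b j * x j + (if j = i then y b i * t else 0))"
      unfolding lin_form_def by (rule sum.cong) (auto simp: algebra_simps)
    then show ?thesis using i by (simp add: sum.distrib lin_form_def)
  qed
  have D: "((\<lambda>t. dpow m r (lin_form d (y b) x + y b i * t)) has_real_derivative
          dpow m (Suc r) (lin_form d (y b) x) * y b i) (at 0)" for b
    by (rule DERIV_chain'[where f = "\<lambda>t. lin_form d (y b) x + y b i * t", THEN DERIV_cong])
       (auto intro!: derivative_eq_intros dpow_deriv simp: mult.commute)
  have "((\<lambda>t. \<Sum>b\<in>V. c b * dpow m r (lin_form d (y b) x + y b i * t)) has_real_derivative
        (\<Sum>b\<in>V. c b * (dpow m (Suc r) (lin_form d (y b) x) * y b i))) (at 0)"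
    by (intro DERIV_sum DERIV_cmult D)
  moreover have "eventually (\<lambda>t. (\<Sum>b\<in>V. c b * dpow m r (lin_form d (y b) x + y b i * t))
        = f (x(i := x i + t))) (nhds 0)"
    using nbox_update[OF x i] by (rule eventually_mono) (use f in \<open>simp add: rep_def lin\<close>)
  ultimately have "((\<lambda>t. f (x(i := x i + t))) has_real_derivative
        (\<Sum>b\<in>V. c b * (dpow m (Suc r) (lin_form d (y b) x) * y b i))) (at 0)"
    by (subst DERIV_cong_ev[OF refl _ refl, symmetric])
  then show "partial i f x = (\<Sum>b\<in>V. c b * y b i * dpow m (Suc r) (lin_form d (y b) x))"
    unfolding partial_def by (simp add: DERIV_imp_deriv mult_ac)
qed

lemma rep_partial_pow:
  assumes f: "rep c r f" and i: "i < d"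
  shows "rep (\<lambda>b. c b * y b i ^ k) (r + k) ((partial i ^^ k) f)"
proof (induction k)
  case (Suc k)
  from rep_partial[OF Suc i] show ?case by (simp add: mult_ac)
qed (use f in simp)

lemma rep_sum_partial:
  assumes f: "rep c r f"
  shows "rep (\<lambda>b. c b * (\<Sum>i<d. y b i)) (Suc r) (sum_partial d f)"
  unfolding rep_def
proof
  fix x assume "x \<in> nbox d x0 \<delta>"
  then have "sum_partial d f x = (\<Sum>i<d. \<Sum>b\<in>V. c b * y b i * dpow m (Suc r) (lin_form d (y b) x))"
    unfolding sum_partial_def using rep_partial[OF f] by (intro sum.cong) (auto simp: rep_def)
  also have "\<dots> = (\<Sum>b\<in>V. c b * (\<Sum>i<d. y b i) * dpow m (Suc r) (lin_form d (y b) x))"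
    by (subst sum.swap) (simp add: sum_distrib_left sum_distrib_right)
  finally show "sum_partial d f x = \<dots>" .
qed

lemma rep_sum_partial_pow:
  assumes f: "rep c r f"
  shows "rep (\<lambda>b. c b * (\<Sum>i<d. y b i) ^ k) (r + k) ((sum_partial d ^^ k) f)"
proof (induction k)
  case (Suc k)
  from rep_sum_partial[OF Suc] show ?case by (simp add: mult_ac)
qed (use f in simp)

lemma rep_foldr:
  assumes f: "rep c r f" and "\<forall>i\<in>set xs. i < d"
  shows "rep (\<lambda>b. c b * (\<Prod>i\<leftarrow>xs. y b i ^ k i)) (r + (\<Sum>i\<leftarrow>xs. k i))
           (foldr (\<lambda>i g. (partial i ^^ k i) g) xs f)"
  using assms(2)
proof (induction xs)
  case (Cons i xs)
  then have "rep (\<lambda>b. c b * (\<Prod>i\<leftarrow>xs. y b i ^ k i)) (r + (\<Sum>i\<leftarrow>xs. k i))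
           (foldr (\<lambda>i g. (partial i ^^ k i) g) xs f)" by simp
  from rep_partial_pow[OF this, of i "k i"] Cons.prems show ?case by (simp add: mult_ac add_ac)
qed (use f in simp)

lemma todd_op_trunc_rep:
  assumes f: "rep A 0 f" and x: "x \<in> nbox d x0 \<delta>"
  shows "todd_op_trunc d M f x = (\<Sum>b\<in>V. A b * (\<Sum>j\<in>PiE {..<d} (\<lambda>_. {..M}). \<Sum>k\<le>M.
           (\<Prod>i<d. fps_nth fps_Ahat (2 * j i) * y b i ^ (2 * j i)) *
           (fps_nth fps_inv_Ahat (2 * k) * (\<Sum>i<d. y b i) ^ (2 * k)) *
           dpow m ((\<Sum>i<d. 2 * j i) + 2 * k) (lin_form d (y b) x)))"
proof -
  have "foldr (\<lambda>i g. (partial i ^^ (2 * j i)) g) [0..<d] ((sum_partial d ^^ (2 * k)) f) x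
     = (\<Sum>b\<in>V. A b * (\<Sum>i<d. y b i) ^ (2 * k) * (\<Prod>i<d. y b i ^ (2 * j i)) *
        dpow m (2 * k + (\<Sum>i<d. 2 * j i)) (lin_form d (y b) x))" for j k
    using rep_foldr[OF rep_sum_partial_pow[OF f], of "[0..<d]" "2 * k" "\<lambda>i. 2 * j i"] x
    by (simp add: rep_def prod.list_conv_set_nth interv_sum_list_conv_sum_set_nat
         prod.distinct_set_conv_list[symmetric] atLeast0LessThan)
  then have "todd_op_trunc d M f x = (\<Sum>j\<in>PiE {..<d} (\<lambda>_. {..M}). \<Sum>k\<le>M. \<Sum>b\<in>V.
        (\<Prod>i<d. taylor_coeff Ahat (2 * j i)) * taylor_coeff inv_Ahat (2 * k) *
         (A b * (\<Sum>i<d. y b i) ^ (2 * k) * (\<Prod>i<d. y b i ^ (2 * j i)) *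
        dpow m (2 * k + (\<Sum>i<d. 2 * j i)) (lin_form d (y b) x)))"
    by (simp add: todd_op_trunc_def sum_distrib_left)
  also have "\<dots> = (\<Sum>b\<in>V. \<Sum>j\<in>PiE {..<d} (\<lambda>_. {..M}). \<Sum>k\<le>M. 
        (\<Prod>i<d. taylor_coeff Ahat (2 * j i)) * taylor_coeff inv_Ahat (2 * k) *
         (A b * (\<Sum>i<d. y b i) ^ (2 * k) * (\<Prod>i<d. y b i ^ (2 * j i)) *
        dpow m (2 * k + (\<Sum>i<d. 2 * j i)) (lin_form d (y b) x)))"
    by (subst sum.swap[of _ V], subst sum.swap[of _ V]) (rule refl)
  also have "\<dots> = (\<Sum>b\<in>V. A b * (\<Sum>j\<in>PiE {..<d} (\<lambda>_. {..M}). \<Sum>k\<le>M.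
           (\<Prod>i<d. fps_nth fps_Ahat (2 * j i) * y b i ^ (2 * j i)) *
           (fps_nth fps_inv_Ahat (2 * k) * (\<Sum>i<d. y b i) ^ (2 * k)) *
           dpow m ((\<Sum>i<d. 2 * j i) + 2 * k) (lin_form d (y b) x)))"
    by (simp add: sum_distrib_left taylor_Ahat taylor_inv_Ahat prod.distrib mult_ac add_ac)
  finally show ?thesis .
qed

end

section \<open>Truncated series and extraction of a coefficient\<close>

lemma fps_nth_even_truncation:
  fixes F :: "real fps"
  assumes "\<And>n. odd n \<Longrightarrow> fps_nth F n = 0" "k \<le> M"
  shows "fps_nth (\<Sum>j\<le>M. fps_const (fps_nth F (2 * j) * c ^ (2 * j)) * fps_X ^ (2 * j)) k
     = fps_nth (fps_compose F (fps_const c * fps_X)) k"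
proof -
  have "fps_nth (\<Sum>j\<le>M. fps_const (fps_nth F (2 * j) * c ^ (2 * j)) * fps_X ^ (2 * j)) k
    = (\<Sum>j\<le>M. if j = k div 2 then (if even k then fps_nth F k * c ^ k else 0) else 0)"
    unfolding fps_sum_nth
    by (rule sum.cong) (auto simp: elim!: evenE)
  also have "\<dots> = (if even k then fps_nth F k * c ^ k else 0)"
    using assms(2) by (subst sum.delta) auto
  also have "\<dots> = c ^ k * fps_nth F k" using assms(1) by auto
  finally show ?thesis by simp
qed

lemma fps_mult_nth_cong:
  fixes F :: "'a :: comm_semiring_1 fps"
  assumes "\<And>i. i \<le> m \<Longrightarrow> fps_nth F i = fps_nth F' i" "\<And>i. i \<le> m \<Longrightarrow> fps_nth G i = fps_nth G' i"
    and "k \<le> m"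
  shows "fps_nth (F * G) k = fps_nth (F' * G') k"
  unfolding fps_mult_nth by (rule sum.cong) (use assms in auto)

lemma fps_prod_nth_cong:
  fixes F :: "'b \<Rightarrow> 'a :: comm_semiring_1 fps"
  assumes "\<And>x i. x \<in> S \<Longrightarrow> i \<le> m \<Longrightarrow> fps_nth (F x) i = fps_nth (G x) i" "k \<le> m"
  shows "fps_nth (\<Prod>x\<in>S. F x) k = fps_nth (\<Prod>x\<in>S. G x) k"
  using assms
proof (induction S arbitrary: k rule: infinite_finite_induct)
  case (insert x S)
  then show ?case by (simp, intro fps_mult_nth_cong[of m]) auto
qed auto

lemma fps_const_prod: "fps_const (\<Prod>x\<in>S. f x) = (\<Prod>x\<in>S. fps_const (f x :: 'a :: comm_ring_1))"
  by (induction S rule: infinite_finite_induct) (simp_all flip: fps_const_mult)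

text \<open>\<open>dpow m r l\<close> is the coefficient of \<open>X ^ m\<close> in
  \<open>fps_exp l * X ^ r\<close>, so a derivative of order r becomes a factor
  \<open>X ^ r\<close>, and the multiple sum becomes the expansion of a product of truncated series.
  The truncations reach degree 2 M and drop only vanishing odd coefficients below that, so
  coefficients up to \<open>M\<close>, in particular the m-th, are unaffected.\<close>

lemma todd_coefficient:
  fixes y :: "nat \<Rightarrow> real"
  assumes "m \<le> M"
  shows "(\<Sum>j\<in>PiE {..<d} (\<lambda>_. {..M}). \<Sum>k\<le>M.
           (\<Prod>i<d. fps_nth fps_Ahat (2 * j i) * y i ^ (2 * j i)) *
           (fps_nth fps_inv_Ahat (2 * k) * Y ^ (2 * k)) *
           dpow m ((\<Sum>i<d. 2 * j i) + 2 * k) l)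
     = fps_nth (fps_exp l * (\<Prod>i<d. fps_compose fps_Ahat (fps_const (y i) * fps_X)) *
          fps_compose fps_inv_Ahat (fps_const Y * fps_X)) m" (is "?L = ?R")
proof -
  let ?a = "\<lambda>i j. fps_const (fps_nth fps_Ahat (2 * j) * y i ^ (2 * j)) * fps_X ^ (2 * j)"
  let ?b = "\<lambda>k. fps_const (fps_nth fps_inv_Ahat (2 * k) * Y ^ (2 * k)) * fps_X ^ (2 * k)"
  have nth: "fps_nth (fps_exp l * (fps_const c * fps_X ^ r) * (fps_const c' * fps_X ^ r')) m
     = c * c' * dpow m (r + r') l" for c c' r r'
  proof -
    have *: "fps_exp l * (fps_const c * fps_X ^ r) * (fps_const c' * fps_X ^ r')
      = fps_const (c * c') * (fps_exp l * fps_X ^ (r + r'))"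
      by (simp only: power_add mult_ac fps_const_mult[symmetric])
    show ?thesis
      unfolding * fps_mult_left_const_nth fps_X_power_mult_right_nth
      by (simp add: dpow_def not_le)
  qed
  have prod: "(\<Prod>i<d. ?a i (j i)) = fps_const (\<Prod>i<d. fps_nth fps_Ahat (2 * j i) * y i ^ (2 * j i))
      * fps_X ^ (\<Sum>i<d. 2 * j i)" for j
    unfolding fps_const_prod power_sum prod.distrib[symmetric] ..
  have "?R = fps_nth (fps_exp l * (\<Prod>i<d. \<Sum>j\<le>M. ?a i j) * (\<Sum>k\<le>M. ?b k)) m"
    using assms
    by (intro fps_mult_nth_cong[of m] fps_prod_nth_cong[of _ m] refl
        fps_nth_even_truncation[symmetric] fps_Ahat_odd fps_inv_Ahat_odd) auto
  also have "fps_exp l * (\<Prod>i<d. \<Sum>j\<le>M. ?a i j) * (\<Sum>k\<le>M. ?b k)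
     = (\<Sum>j\<in>PiE {..<d} (\<lambda>_. {..M}). \<Sum>k\<le>M. fps_exp l * (\<Prod>i<d. ?a i (j i)) * ?b k)"
    by (subst prod_sum_PiE, simp, simp)
       (simp only: sum_distrib_left sum_distrib_right, rule sum.swap)
  also have "fps_nth \<dots> m = ?L"
    unfolding fps_sum_nth prod nth by (rule refl)
  finally show ?thesis by simp
qed

theorem (in power_sum_rep) todd_op_trunc_eq_fps_nth:
  assumes "rep A 0 f" "x \<in> nbox d x0 \<delta>" "m \<le> M"
  shows "todd_op_trunc d M f x = (\<Sum>b\<in>V. A b *
     fps_nth (fps_exp (lin_form d (y b) x) * (\<Prod>i<d. fps_compose fps_Ahat (fps_const (y b i) * fps_X)) *
          fps_compose fps_inv_Ahat (fps_const (\<Sum>i<d. y b i) * fps_X)) m)"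
  unfolding todd_op_trunc_rep[OF assms(1,2)] todd_coefficient[OF assms(3)] ..

section \<open>Polarized cones of simple polytopes\<close>

text \<open>Finitely many hyperplanes form a negligible set, which cannot contain a nonempty open
  set.\<close>

lemma exists_not_orthogonal:
  fixes S :: "'a :: euclidean_space set"
  assumes "open S" "S \<noteq> {}" "finite Z" "0 \<notin> Z"
  shows "\<exists>\<xi>\<in>S. \<forall>z\<in>Z. \<xi> \<bullet> z \<noteq> 0"
proof (rule ccontr)
  assume "\<not> ?thesis"
  then have "S \<subseteq> (\<Union>z\<in>Z. {x. z \<bullet> x = 0})" by (auto simp: inner_commute)
  moreover have "negligible (\<Union>z\<in>Z. {x. z \<bullet> x = 0})"
    using assms(3,4) by (intro negligible_Union) (auto intro!: negligible_hyperplane)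
  ultimately have "negligible S" by (rule negligible_subset[rotated])
  then show False using assms(1,2) open_not_negligible by blast
qed

text \<open>A vertex is encoded by the set \<open>I\<close> of facets through it.
  \<open>U I j\<close> spans the edge that leaves facet \<open>j\<close> and stays on the others;
  the value -1 reflects that normals point outward. \<open>exchange\<close> names the other end of
  that edge. The right-hand sides \<open>lam\<close> are absent, so one system serves all small
  parallel displacements of the facets.\<close>

locale simple_system =
  fixes d :: nat and N :: "nat \<Rightarrow> real^'n" and V :: "nat set set"
    and U :: "nat set \<Rightarrow> nat \<Rightarrow> real^'n"
  assumes V_subset: "I \<in> V \<Longrightarrow> I \<subseteq> {..<d}"
    and V_card: "I \<in> V \<Longrightarrow> card I = CARD('n)"
    and dual: "I \<in> V \<Longrightarrow> i \<in> I \<Longrightarrow> j \<in> I \<Longrightarrow> N i \<bullet> U I j = (if i = j then -1 else 0)"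
    and exchange: "I \<in> V \<Longrightarrow> j \<in> I \<Longrightarrow> \<exists>j'. j' \<notin> I \<and> insert j' (I - {j}) \<in> V"
begin

lemma finite_V: "finite V"
  by (rule finite_subset[of _ "Pow {..<d}"]) (use V_subset in auto)

lemma finite_I: "I \<in> V \<Longrightarrow> finite I"
  using V_subset finite_subset by blast

lemma inner_sum_U:
  assumes "I \<in> V" "i \<in> I"
  shows "N i \<bullet> (\<Sum>j\<in>I. c j *\<^sub>R U I j) = - c i"
proof -
  have "N i \<bullet> (\<Sum>j\<in>I. c j *\<^sub>R U I j) = (\<Sum>j\<in>I. if i = j then - c j else 0)"
    unfolding inner_sum_right by (rule sum.cong) (use assms in \<open>auto simp: dual\<close>)
  then show ?thesis using assms finite_I by simp
qed

text \<open>Duality with \<open>U I\<close> makes the normals in \<open>I\<close> independent, and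
  there are as many as the dimension, so they span.\<close>

lemma orthogonal_imp_zero:
  assumes I: "I \<in> V" and w: "\<And>i. i \<in> I \<Longrightarrow> N i \<bullet> w = 0"
  shows "w = 0"
proof -
  have inj: "inj_on N I"
    using dual[OF I] by (intro inj_onI) (metis zero_neq_neg_one)
  have "independent (N ` I)"
  proof (rule independent_if_scalars_zero)
    show "finite (N ` I)" using finite_I[OF I] by simp
    fix f x assume 0: "(\<Sum>x\<in>N ` I. f x *\<^sub>R x) = 0" and "x \<in> N ` I"
    then obtain i where i: "i \<in> I" "x = N i" by auto
    have "0 = (\<Sum>j\<in>I. f (N j) *\<^sub>R N j) \<bullet> U I i" using 0 by (simp add: sum.reindex inj)
    also have "\<dots> = (\<Sum>j\<in>I. if j = i then - f (N j) else 0)"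
      unfolding inner_sum_left by (rule sum.cong) (use I i in \<open>auto simp: dual\<close>)
    also have "\<dots> = - f x" using i finite_I[OF I] by simp
    finally show "f x = 0" by simp
  qed
  moreover have "card (N ` I) = DIM(real^'n)" using V_card[OF I] by (simp add: card_image inj)
  ultimately have "w \<in> span (N ` I)"
    using card_ge_dim_independent[of "N ` I" UNIV] by auto
  then have "orthogonal w w"
    by (rule orthogonal_to_span) (use w in \<open>auto simp: orthogonal_def inner_commute\<close>)
  then show ?thesis by (simp add: orthogonal_def)
qed

text \<open>The solution of \<open>N j \<bullet> x = lam j\<close> for all \<open>j\<close> in
  \<open>I\<close>. Its linearity in \<open>lam\<close> turns
  \<open>\<xi> \<bullet> vtx I lam\<close> into a linear form on which the operators can
  act.\<close>

definition vtx :: "nat set \<Rightarrow> (nat \<Rightarrow> real) \<Rightarrow> real^'n" where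
  "vtx I lam = (\<Sum>j\<in>I. (- lam j) *\<^sub>R U I j)"

lemma inner_vtx: "I \<in> V \<Longrightarrow> i \<in> I \<Longrightarrow> N i \<bullet> vtx I lam = lam i"
  unfolding vtx_def by (subst inner_sum_U) auto

text \<open>Both sides have the same inner products with the normals in \<open>I\<close>. The slacks
  thus serve as coordinates, and the cone at the vertex is given by their nonnegativity.\<close>

lemma expansion:
  assumes I: "I \<in> V"
  shows "x = vtx I lam + (\<Sum>j\<in>I. (lam j - N j \<bullet> x) *\<^sub>R U I j)"
proof -
  have "x - (vtx I lam + (\<Sum>j\<in>I. (lam j - N j \<bullet> x) *\<^sub>R U I j)) = 0"
    by (rule orthogonal_imp_zero[OF I]) (simp add: I inner_diff_right inner_add_right inner_vtx inner_sum_U)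
  then show ?thesis by simp
qed

lemma parallel:
  assumes "I \<in> V" "j \<in> I" "\<And>i. i \<in> I \<Longrightarrow> i \<noteq> j \<Longrightarrow> N i \<bullet> w = 0"
  shows "w = (- (N j \<bullet> w)) *\<^sub>R U I j"
proof -
  have "w - (- (N j \<bullet> w)) *\<^sub>R U I j = 0"
  proof (rule orthogonal_imp_zero[OF assms(1)])
    fix i assume "i \<in> I"
    then show "N i \<bullet> (w - (- (N j \<bullet> w)) *\<^sub>R U I j) = 0"
      using assms by (cases "i = j") (auto simp: inner_add_right dual)
  qed
  then show ?thesis by (simp only: right_minus_eq)
qed

lemma U_nonzero: "I \<in> V \<Longrightarrow> j \<in> I \<Longrightarrow> U I j \<noteq> 0"
  using dual[of I j j] by auto

text \<open>The parameters for which every \<open>vtx I lam\<close> is strictly inside all facets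
  outside \<open>I\<close>, so that no vertices merge. The condition is open in
  \<open>lam\<close>.\<close>

definition nondeg :: "(nat \<Rightarrow> real) \<Rightarrow> bool" where
  "nondeg lam \<longleftrightarrow> (\<forall>I\<in>V. \<forall>i<d. i \<notin> I \<longrightarrow> N i \<bullet> vtx I lam < lam i)"

lemma vtx_diff:
  assumes "I \<in> V" "I' \<in> V" "j \<in> I" "I - {j} \<subseteq> I'"
  shows "vtx I' lam = vtx I lam + (lam j - N j \<bullet> vtx I' lam) *\<^sub>R U I j"
proof -
  have "vtx I' lam - vtx I lam = (- (N j \<bullet> (vtx I' lam - vtx I lam))) *\<^sub>R U I j"
    by (rule parallel) (use assms in \<open>auto simp: inner_diff_right inner_vtx\<close>)
  then show ?thesis using assms by (simp add: inner_diff_right inner_vtx algebra_simps)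
qed

text \<open>Each end point is strictly inside the facet through the other one that it does not lie
  on. So each is reached from the other along its own edge vector with positive length, and the two
  vectors are opposite.\<close>

lemma partner_edge:
  assumes lam: "nondeg lam" and I: "I \<in> V" "j \<in> I" and j': "j' \<notin> I" "insert j' (I - {j}) \<in> V"
  shows "\<exists>c>0. U (insert j' (I - {j})) j' = (-c) *\<^sub>R U I j"
proof -
  let ?I' = "insert j' (I - {j})"
  define s where "s = lam j - N j \<bullet> vtx ?I' lam"
  define s' where "s' = lam j' - N j' \<bullet> vtx I lam"
  have "j < d" "j' < d" using V_subset I j' by auto
  moreover have "j \<notin> ?I'" using I j' by auto
  ultimately have pos: "s > 0" "s' > 0"
    using lam I j' by (auto simp: nondeg_def s_def s'_def)
  have 1: "vtx ?I' lam = vtx I lam + s *\<^sub>R U I j"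
    unfolding s_def by (rule vtx_diff) (use I j' in auto)
  have 2: "vtx I lam = vtx ?I' lam + s' *\<^sub>R U ?I' j'"
    unfolding s'_def by (rule vtx_diff) (use I j' in auto)
  from 1 2 have "s' *\<^sub>R U ?I' j' = - (s *\<^sub>R U I j)" by (simp add: eq_neg_iff_add_eq_0 add.commute)
  then have "inverse s' *\<^sub>R s' *\<^sub>R U ?I' j' = inverse s' *\<^sub>R (- (s *\<^sub>R U I j))" by simp
  then have "U ?I' j' = (- (s / s')) *\<^sub>R U I j" using pos by (simp add: divide_inverse mult.commute)
  then show ?thesis using pos by (intro exI[of _ "s / s'"]) auto
qed

text \<open>Two neighbours across the same edge lie on one ray. The nearer one, on hyperplane
  \<open>j'\<close>, would be a convex combination of \<open>vtx I lam\<close> and the farther one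
  with positive weight \<open>r\<close> on the latter, although both of these are strictly inside
  the half-space \<open>j'\<close>.\<close>

lemma partner_unique_aux:
  assumes lam: "nondeg lam" and I: "I \<in> V" "j \<in> I"
    and j': "j' \<notin> I" "insert j' (I - {j}) \<in> V" and j'': "j'' \<notin> I" "insert j'' (I - {j}) \<in> V"
    and le: "lam j - N j \<bullet> vtx (insert j' (I - {j})) lam \<le> lam j - N j \<bullet> vtx (insert j'' (I - {j})) lam"
  shows "j' = j''"
proof (rule ccontr)
  assume neq: "j' \<noteq> j''"
  let ?I' = "insert j' (I - {j})" and ?I'' = "insert j'' (I - {j})"
  define s where "s = lam j - N j \<bullet> vtx ?I' lam"
  define s' where "s' = lam j - N j \<bullet> vtx ?I'' lam"
  define r where "r = s / s'"
  have d: "j < d" "j' < d" "j'' < d" using V_subset I j' j'' by auto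
  moreover have "j \<notin> ?I'" "j \<notin> ?I''" using I j' j'' by auto
  ultimately have pos: "s > 0" "s' > 0"
    using lam I j' j'' by (auto simp: nondeg_def s_def s'_def)
  have 1: "vtx ?I' lam = vtx I lam + s *\<^sub>R U I j"
    unfolding s_def by (rule vtx_diff) (use I j' in auto)
  have 2: "vtx ?I'' lam = vtx I lam + s' *\<^sub>R U I j"
    unfolding s'_def by (rule vtx_diff) (use I j'' in auto)
  have r: "0 < r" "r \<le> 1" using pos le by (auto simp: r_def s_def s'_def)
  have "vtx ?I' lam = (1 - r) *\<^sub>R vtx I lam + r *\<^sub>R vtx ?I'' lam"
    unfolding 1 2 using pos by (simp add: r_def algebra_simps)
  then have "N j' \<bullet> vtx ?I' lam = (1 - r) * (N j' \<bullet> vtx I lam) + r * (N j' \<bullet> vtx ?I'' lam)"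
    by (simp add: inner_add_right)
  also have "N j' \<bullet> vtx ?I' lam = lam j'" using j' by (simp add: inner_vtx)
  finally have eq: "lam j' = (1 - r) * (N j' \<bullet> vtx I lam) + r * (N j' \<bullet> vtx ?I'' lam)" .
  have "N j' \<bullet> vtx I lam < lam j'" "N j' \<bullet> vtx ?I'' lam < lam j'"
    using lam I j' j'' neq d by (auto simp: nondeg_def)
  then have "(1 - r) * (N j' \<bullet> vtx I lam) \<le> (1 - r) * lam j'" "r * (N j' \<bullet> vtx ?I'' lam) < r * lam j'"
    using r by (auto intro!: mult_left_mono mult_strict_left_mono)
  with eq show False by (simp add: algebra_simps)
qed

lemma partner_unique:
  assumes "nondeg lam" "I \<in> V" "j \<in> I"
    and "j' \<notin> I" "insert j' (I - {j}) \<in> V" and "j'' \<notin> I" "insert j'' (I - {j}) \<in> V"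
  shows "j' = j''"
proof -
  consider "lam j - N j \<bullet> vtx (insert j' (I - {j})) lam \<le> lam j - N j \<bullet> vtx (insert j'' (I - {j})) lam"
    | "lam j - N j \<bullet> vtx (insert j'' (I - {j})) lam \<le> lam j - N j \<bullet> vtx (insert j' (I - {j})) lam"
    by linarith
  then show ?thesis
    using partner_unique_aux[OF assms] partner_unique_aux[OF assms(1-3,6,7,4,5)] by cases auto
qed

text \<open>
  \<open>h j\<close> says on which side of the \<open>j\<close>-th hyperplane a point lies, and \<open>e I j\<close> whether the
  edge \<open>j\<close> at the vertex \<open>I\<close> is flipped: a flipped factor \<open>h - 1\<close> is minus the indicator of the
  complementary open half-space.
\<close>
definition polar_sum :: "nat set \<Rightarrow> (nat set \<Rightarrow> nat \<Rightarrow> bool) \<Rightarrow> (nat \<Rightarrow> bool) \<Rightarrow> real" where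
  "polar_sum J e h = (\<Sum>I\<in>{I\<in>V. J \<subseteq> I}. \<Prod>j\<in>I - J. (of_bool (h j) - of_bool (e I j)))"

text \<open>
  The polarizations just before and just after a wall are those of \<open>\<xi> - \<epsilon> \<eta>\<close> and \<open>\<xi> + \<epsilon> \<eta>\<close>. Only the
  edges orthogonal to \<open>\<xi>\<close> change their state, and the two end points of such an edge cancel.
\<close>
lemma wall_crossing:
  assumes lam: "nondeg lam"
    and ncrit: "\<And>I j. I \<in> V \<Longrightarrow> j \<in> I \<Longrightarrow> \<xi> \<bullet> U I j = 0 \<Longrightarrow> \<eta> \<bullet> U I j \<noteq> 0"
    and one: "\<And>I i j. I \<in> V \<Longrightarrow> i \<in> I \<Longrightarrow> j \<in> I \<Longrightarrow> \<xi> \<bullet> U I i = 0 \<Longrightarrow> \<xi> \<bullet> U I j = 0 \<Longrightarrow> i = j"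
  shows "polar_sum J (\<lambda>I j. \<xi> \<bullet> U I j > 0 \<or> \<xi> \<bullet> U I j = 0 \<and> \<eta> \<bullet> U I j > 0) h
       = polar_sum J (\<lambda>I j. \<xi> \<bullet> U I j > 0 \<or> \<xi> \<bullet> U I j = 0 \<and> \<eta> \<bullet> U I j < 0) h"
proof -
  define R where "R I Q = (\<Prod>i\<in>Q. (of_bool (h i) - of_bool (\<xi> \<bullet> U I i > 0) :: real))" for I Q
  define g where "g = (\<lambda>(I, j). - sgn (\<eta> \<bullet> U I j) * R I (I - J - {j}))"
  define K where "K = (SIGMA I:{I\<in>V. J \<subseteq> I}. {j\<in>I - J. \<xi> \<bullet> U I j = 0})"
  let ?p = "\<lambda>I j. \<xi> \<bullet> U I j > 0 \<or> \<xi> \<bullet> U I j = 0 \<and> \<eta> \<bullet> U I j > 0"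
  let ?q = "\<lambda>I j. \<xi> \<bullet> U I j > 0 \<or> \<xi> \<bullet> U I j = 0 \<and> \<eta> \<bullet> U I j < 0"
  have finK: "finite K" unfolding K_def using finite_V finite_I by (intro finite_SigmaI) auto
  have diff: "(\<Prod>j\<in>I - J. (of_bool (h j) - of_bool (?p I j))) - (\<Prod>j\<in>I - J. (of_bool (h j) - of_bool (?q I j)))
      = (\<Sum>j\<in>{j\<in>I - J. \<xi> \<bullet> U I j = 0}. g (I, j))" (is "?A - ?B = _") if I: "I \<in> V" for I
  proof (cases "{j\<in>I - J. \<xi> \<bullet> U I j = 0} = {}")
    case True
    then have "?A = ?B" by (intro prod.cong) auto
    then show ?thesis unfolding True by simp
  next
    case False
    then obtain j where j: "j \<in> I - J" "\<xi> \<bullet> U I j = 0" by auto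
    \<comment> \<open>By \<open>one\<close> a vertex has at most one edge on the wall, so exactly
      one factor of its product jumps.\<close>
    then have eq: "{j\<in>I - J. \<xi> \<bullet> U I j = 0} = {j}" using one[OF I] by auto
    have R: "(\<Prod>i\<in>I - J - {j}. (of_bool (h i) - of_bool (?p I i))) = R I (I - J - {j})"
            "(\<Prod>i\<in>I - J - {j}. (of_bool (h i) - of_bool (?q I i))) = R I (I - J - {j})"
    proof -
      have "\<xi> \<bullet> U I i \<noteq> 0" if "i \<in> I - J - {j}" for i
        using one[OF I, of i j] j that by auto
      then show "(\<Prod>i\<in>I - J - {j}. (of_bool (h i) - of_bool (?p I i))) = R I (I - J - {j})"
            "(\<Prod>i\<in>I - J - {j}. (of_bool (h i) - of_bool (?q I i))) = R I (I - J - {j})"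
        unfolding R_def by (auto intro!: prod.cong)
    qed
    have "finite (I - J)" using finite_I[OF I] by simp
    note split = prod.remove[OF this j(1)]
    have "?A - ?B = (of_bool (?q I j) - of_bool (?p I j)) * R I (I - J - {j})"
      unfolding split[of "\<lambda>j. of_bool (h j) - of_bool (?p I j)"]
        split[of "\<lambda>j. of_bool (h j) - of_bool (?q I j)"] R by (simp add: algebra_simps)
    also have "of_bool (?q I j) - of_bool (?p I j) = - sgn (\<eta> \<bullet> U I j)"
      using j ncrit[OF I, of j] by (cases "\<eta> \<bullet> U I j" "0::real" rule: linorder_cases) auto
    finally show ?thesis unfolding eq by (simp add: g_def)
  qed
  have sumK: "polar_sum J ?p h - polar_sum J ?q h = sum g K"
    unfolding polar_sum_def sum_subtractf[symmetric] K_def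
  proof -
    have "(\<Sum>I\<in>{I\<in>V. J \<subseteq> I}. \<Sum>j\<in>{j\<in>I - J. \<xi> \<bullet> U I j = 0}. g (I, j))
      = sum g (SIGMA I:{I\<in>V. J \<subseteq> I}. {j\<in>I - J. \<xi> \<bullet> U I j = 0})"
      using finite_V finite_I by (subst sum.Sigma) auto
    then show "(\<Sum>I\<in>{I\<in>V. J \<subseteq> I}. (\<Prod>j\<in>I - J. (of_bool (h j) - of_bool (?p I j))) -
        (\<Prod>j\<in>I - J. (of_bool (h j) - of_bool (?q I j))))
      = sum g (SIGMA I:{I\<in>V. J \<subseteq> I}. {j\<in>I - J. \<xi> \<bullet> U I j = 0})"
      by (subst sum.cong[OF refl diff]) auto
  qed
  define partner where "partner I j = (THE j'. j' \<notin> I \<and> insert j' (I - {j}) \<in> V)" for I j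
  have partner: "partner I j \<notin> I" "insert (partner I j) (I - {j}) \<in> V"
    if "I \<in> V" "j \<in> I" for I j
  proof -
    have "\<exists>!j'. j' \<notin> I \<and> insert j' (I - {j}) \<in> V"
      using exchange[OF that] partner_unique[OF lam that] by blast
    from theI'[OF this] show "partner I j \<notin> I" "insert (partner I j) (I - {j}) \<in> V"
      by (simp_all add: partner_def)
  qed
  \<comment> \<open>The involution passes to the same edge seen from its other end, where the edge
    vector points the opposite way; this flips the sign of \<open>g\<close>.\<close>
  define \<sigma> where "\<sigma> = (\<lambda>(I, j). (insert (partner I j) (I - {j}), partner I j))"
  have \<sigma>: "\<sigma> (I, j) \<in> K \<and> \<sigma> (\<sigma> (I, j)) = (I, j) \<and> g (\<sigma> (I, j)) = - g (I, j)" if "(I, j) \<in> K" for I j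
  proof -
    from that have I: "I \<in> V" "j \<in> I" "J \<subseteq> I" "j \<notin> J" "\<xi> \<bullet> U I j = 0" by (auto simp: K_def)
    define j' where "j' = partner I j"
    define I' where "I' = insert j' (I - {j})"
    have j': "j' \<notin> I" "I' \<in> V" unfolding j'_def I'_def using partner[OF I(1,2)] by auto
    have \<sigma>eq: "\<sigma> (I, j) = (I', j')" by (simp add: \<sigma>_def j'_def I'_def)
    obtain c where c: "c > 0" "U I' j' = (-c) *\<^sub>R U I j"
      using partner_edge[OF lam I(1,2) j'(1)] j'(2) unfolding I'_def by blast
    have inK: "(I', j') \<in> K" using j' I c by (auto simp: K_def I'_def)
    have "j \<notin> I'" "insert j (I' - {j'}) = I" using I j' by (auto simp: I'_def)
    have "j' \<in> I'" by (simp add: I'_def)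
    have "partner I' j' = j"
      using \<open>j \<notin> I'\<close> \<open>insert j (I' - {j'}) = I\<close> I(1)
      by (intro partner_unique[OF lam j'(2) \<open>j' \<in> I'\<close>] partner[OF j'(2) \<open>j' \<in> I'\<close>]) simp_all
    then have inv: "\<sigma> (I', j') = (I, j)"
      using \<open>insert j (I' - {j'}) = I\<close> by (simp add: \<sigma>_def)
    \<comment> \<open>The remaining edge vectors at the two ends differ by multiples of
      \<open>U I j\<close>, which \<open>\<xi>\<close> annihilates.\<close>
    have same: "\<xi> \<bullet> U I' i = \<xi> \<bullet> U I i" if "i \<in> I - {j}" for i
    proof -
      have "U I' i - U I i = (- (N j \<bullet> (U I' i - U I i))) *\<^sub>R U I j"
        by (rule parallel) (use I j' that in \<open>auto simp: inner_diff_right dual I'_def\<close>)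
      then have "\<xi> \<bullet> (U I' i - U I i) = (- (N j \<bullet> (U I' i - U I i))) * (\<xi> \<bullet> U I j)"
        by (metis inner_scaleR_right)
      then show ?thesis using I by (simp add: inner_diff_right)
    qed
    have "I' - J - {j'} = I - J - {j}" using I j' by (auto simp: I'_def)
    moreover have "R I' (I - J - {j}) = R I (I - J - {j})"
      unfolding R_def using same by (intro prod.cong) auto
    ultimately have "g (I', j') = - g (I, j)"
      using c by (simp add: g_def sgn_mult)
    with inK inv show ?thesis by (simp add: \<sigma>eq)
  qed
  have "sum g K = sum (g \<circ> \<sigma>) K"
    by (rule sum.reindex_bij_witness[of _ \<sigma> \<sigma>]) (use \<sigma> in auto)
  also have "\<dots> = - sum g K"
    unfolding sum_negf[symmetric] by (rule sum.cong) (use \<sigma> in auto)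
  finally have "sum g K = 0" by simp
  with sumK show ?thesis by simp
qed

section \<open>Independence of the polarizing direction\<close>

definition generic :: "real^'n \<Rightarrow> bool" where
  "generic \<xi> \<longleftrightarrow> (\<forall>I\<in>V. \<forall>j\<in>I. \<xi> \<bullet> U I j \<noteq> 0)"

abbreviation "pos \<xi> \<equiv> (\<lambda>I j. \<xi> \<bullet> U I j > 0)"

lemma polar_sum_cong:
  assumes "\<And>I j. I \<in> V \<Longrightarrow> j \<in> I \<Longrightarrow> e I j = e' I j"
  shows "polar_sum J e h = polar_sum J e' h"
  unfolding polar_sum_def using assms by (auto intro!: sum.cong prod.cong)

text \<open>Move along the segment from \<open>\<xi>0\<close> to \<open>\<xi>1\<close>. If two edges
  at one vertex became orthogonal to the moving direction at once, that direction and
  \<open>\<xi>0\<close> would both be orthogonal to the combination in \<open>good\<close>, and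
  hence so would \<open>\<xi>1\<close>. So each vertex meets its walls one edge at a time, the sum
  is locally constant, and bisection makes it constant on [0, 1].\<close>

lemma polar_sum_generic_independent:
  assumes lam: "nondeg lam" and g0: "generic \<xi>0" and g1: "generic \<xi>1"
    and good: "\<And>I i j. I \<in> V \<Longrightarrow> i \<in> I \<Longrightarrow> j \<in> I \<Longrightarrow> i \<noteq> j \<Longrightarrow>
      \<xi>1 \<bullet> ((\<xi>0 \<bullet> U I j) *\<^sub>R U I i - (\<xi>0 \<bullet> U I i) *\<^sub>R U I j) \<noteq> 0"
  shows "polar_sum J (pos \<xi>0) h = polar_sum J (pos \<xi>1) h"
proof -
  define \<eta> where "\<eta> = \<xi>1 - \<xi>0"
  define x where "x s = \<xi>0 + s *\<^sub>R \<eta>" for s :: real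
  have x_shift: "x s \<bullet> u = x t \<bullet> u + (s - t) * (\<eta> \<bullet> u)" for s t u
    by (simp add: x_def inner_add_left algebra_simps)
  \<comment> \<open>On a wall \<open>e\<close> takes the state just after it. Thus nothing changes
    on a short interval to the right of any point, and only the approach from the left calls for
    \<open>wall_crossing\<close>.\<close>
  define e where "e s I j \<longleftrightarrow> x s \<bullet> U I j > 0 \<or> x s \<bullet> U I j = 0 \<and> \<eta> \<bullet> U I j > 0" for s I j
  have ncrit: "\<eta> \<bullet> U I j \<noteq> 0" if "I \<in> V" "j \<in> I" "x s \<bullet> U I j = 0" for s I j
  proof
    assume "\<eta> \<bullet> U I j = 0"
    then have "\<xi>0 \<bullet> U I j = 0" using that by (simp add: x_def inner_add_left)
    then show False using g0 that by (auto simp: generic_def)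
  qed
  have one: "i = j" if I: "I \<in> V" "i \<in> I" "j \<in> I" and 0: "x s \<bullet> U I i = 0" "x s \<bullet> U I j = 0" for s I i j
  proof (rule ccontr)
    assume "i \<noteq> j"
    let ?z = "(\<xi>0 \<bullet> U I j) *\<^sub>R U I i - (\<xi>0 \<bullet> U I i) *\<^sub>R U I j"
    have "x s \<bullet> ?z = 0" using 0 by (simp add: inner_diff_right)
    moreover have "\<xi>0 \<bullet> ?z = 0" by (simp add: inner_diff_right)
    ultimately have "s * (\<xi>1 \<bullet> ?z) = 0" by (simp add: x_def \<eta>_def inner_add_left inner_diff_left)
    then have "s = 0" using good[OF I \<open>i \<noteq> j\<close>] by simp
    then show False using 0 g0 I by (auto simp: x_def generic_def)
  qed
  have "polar_sum J (e 0) h = polar_sum J (e 1) h"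
  proof (rule Bolzano[of 0 1 "\<lambda>a b. polar_sum J (e a) h = polar_sum J (e b) h"])
    fix t :: real
    have "eventually (\<lambda>s. \<forall>(I, j)\<in>Sigma V (\<lambda>I. I). x t \<bullet> U I j \<noteq> 0 \<longrightarrow> sgn (x s \<bullet> U I j) = sgn (x t \<bullet> U I j)) (nhds t)"
    proof (rule eventually_ball_finite)
      show "finite (Sigma V (\<lambda>I. I))" using finite_V finite_I by auto
      show "\<forall>p\<in>Sigma V (\<lambda>I. I). eventually (\<lambda>s. case p of (I, j) \<Rightarrow> x t \<bullet> U I j \<noteq> 0 \<longrightarrow> sgn (x s \<bullet> U I j) = sgn (x t \<bullet> U I j)) (nhds t)"
      proof safe
        fix I j
        have lim: "((\<lambda>s. x s \<bullet> U I j) \<longlongrightarrow> x t \<bullet> U I j) (nhds t)"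
          unfolding x_def by (intro tendsto_intros filterlim_ident)
        show "eventually (\<lambda>s. x t \<bullet> U I j \<noteq> 0 \<longrightarrow> sgn (x s \<bullet> U I j) = sgn (x t \<bullet> U I j)) (nhds t)"
        proof (cases "x t \<bullet> U I j" "0::real" rule: linorder_cases)
          case less
          from order_tendstoD(2)[OF lim this] show ?thesis by (rule eventually_mono) (use less in auto)
        next
          case greater
          from order_tendstoD(1)[OF lim this] show ?thesis by (rule eventually_mono) (use greater in auto)
        qed auto
      qed
    qed
    then obtain \<delta> where \<delta>: "\<delta> > 0" and sg: "\<And>s I j. \<bar>s - t\<bar> < \<delta> \<Longrightarrow> I \<in> V \<Longrightarrow> j \<in> I \<Longrightarrow>
        x t \<bullet> U I j \<noteq> 0 \<Longrightarrow> sgn (x s \<bullet> U I j) = sgn (x t \<bullet> U I j)"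
      unfolding eventually_nhds_metric dist_real_def by (auto simp: Ball_def)
    have pos_eq: "(x s \<bullet> U I j > 0) = (x t \<bullet> U I j > 0)" "x s \<bullet> U I j \<noteq> 0"
      if "\<bar>s - t\<bar> < \<delta>" "I \<in> V" "j \<in> I" "x t \<bullet> U I j \<noteq> 0" for s I j
      using sg[OF that] that(4) by (auto simp: sgn_if split: if_splits)
    have after: "polar_sum J (e s) h = polar_sum J (e t) h" if "t \<le> s" "s - t < \<delta>" for s
    proof (rule polar_sum_cong)
      fix I j assume I: "I \<in> V" "j \<in> I"
      show "e s I j = e t I j"
      proof (cases "x t \<bullet> U I j = 0")
        case True
        then have "x s \<bullet> U I j = (s - t) * (\<eta> \<bullet> U I j)" using x_shift[of s "U I j" t] by simp
        then show ?thesis using True that ncrit[OF I True] by (cases "s = t") (auto simp: e_def zero_less_mult_iff)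
      next
        case False
        then show ?thesis using pos_eq[of s I j] that I by (auto simp: e_def)
      qed
    qed
    have before: "polar_sum J (e s) h = polar_sum J (e t) h" if "s < t" "t - s < \<delta>" for s
    proof -
      have "polar_sum J (e s) h = polar_sum J (\<lambda>I j. x t \<bullet> U I j > 0 \<or> x t \<bullet> U I j = 0 \<and> \<eta> \<bullet> U I j < 0) h"
      proof (rule polar_sum_cong)
        fix I j assume I: "I \<in> V" "j \<in> I"
        show "e s I j \<longleftrightarrow> x t \<bullet> U I j > 0 \<or> x t \<bullet> U I j = 0 \<and> \<eta> \<bullet> U I j < 0"
        proof (cases "x t \<bullet> U I j = 0")
          case True
          then have "x s \<bullet> U I j = (s - t) * (\<eta> \<bullet> U I j)" using x_shift[of s "U I j" t] by simp
          then show ?thesis using True that ncrit[OF I True] by (auto simp: e_def zero_less_mult_iff)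
        next
          case False
          then show ?thesis using pos_eq[of s I j] that I by (auto simp: e_def)
        qed
      qed
      also have "\<dots> = polar_sum J (e t) h"
        unfolding e_def[abs_def] by (rule wall_crossing[OF lam ncrit one, symmetric])
      finally show ?thesis .
    qed
    have "polar_sum J (e a) h = polar_sum J (e b) h" if "a \<le> t" "t \<le> b" "b - a < \<delta>" for a b
      using after[of b] before[of a] that by (cases "a = t") auto
    with \<delta> show "\<exists>\<delta>>0. \<forall>a b. a \<le> t \<and> t \<le> b \<and> b - a < \<delta> \<longrightarrow> polar_sum J (e a) h = polar_sum J (e b) h"
      by blast
  qed auto
  moreover have "polar_sum J (e 0) h = polar_sum J (pos \<xi>0) h"
    by (rule polar_sum_cong) (use g0 in \<open>auto simp: e_def x_def generic_def\<close>)
  moreover have "polar_sum J (e 1) h = polar_sum J (pos \<xi>1) h"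
    by (rule polar_sum_cong) (use g1 in \<open>auto simp: e_def x_def \<eta>_def generic_def\<close>)
  ultimately show ?thesis by simp
qed

text \<open>All vectors to be avoided are nonzero: pairing the combination for \<open>i\<close> and
  \<open>j\<close> with \<open>N i\<close> leaves \<open>- (\<xi>0 \<bullet> U I j)\<close>, which
  genericity of \<open>\<xi>0\<close> keeps away from 0.\<close>

lemma exists_good_direction:
  assumes "open S" "S \<noteq> {}" "generic \<xi>0"
  obtains \<xi>1 where "\<xi>1 \<in> S" "generic \<xi>1"
    "\<And>I i j. I \<in> V \<Longrightarrow> i \<in> I \<Longrightarrow> j \<in> I \<Longrightarrow> i \<noteq> j \<Longrightarrow>
      \<xi>1 \<bullet> ((\<xi>0 \<bullet> U I j) *\<^sub>R U I i - (\<xi>0 \<bullet> U I i) *\<^sub>R U I j) \<noteq> 0"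
proof -
  let ?z = "\<lambda>I i j. (\<xi>0 \<bullet> U I j) *\<^sub>R U I i - (\<xi>0 \<bullet> U I i) *\<^sub>R U I j"
  define Z where "Z = (\<Union>I\<in>V. U I ` I \<union> (\<Union>i\<in>I. (\<lambda>j. ?z I i j) ` (I - {i})))"
  have finZ: "finite Z" unfolding Z_def using finite_V finite_I by auto
  have Z0: "0 \<notin> Z"
  proof
    assume "0 \<in> Z"
    then obtain I i j where I: "I \<in> V" "i \<in> I" "j \<in> I" "i \<noteq> j" "?z I i j = 0"
      using U_nonzero unfolding Z_def by (force simp: eq_commute[of 0])
    have "N i \<bullet> ?z I i j = - (\<xi>0 \<bullet> U I j)" using I(1-4) by (simp add: inner_diff_right dual)
    then have "\<xi>0 \<bullet> U I j = 0" unfolding I(5) by simp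
    with I assms(3) show False by (auto simp: generic_def)
  qed
  from exists_not_orthogonal[OF assms(1,2) finZ Z0]
  obtain \<xi> where "\<xi> \<in> S" "\<And>z. z \<in> Z \<Longrightarrow> \<xi> \<bullet> z \<noteq> 0" by auto
  moreover have "U I j \<in> Z" if "I \<in> V" "j \<in> I" for I j
    using that by (auto simp: Z_def)
  moreover have "?z I i j \<in> Z" if "I \<in> V" "i \<in> I" "j \<in> I" "i \<noteq> j" for I i j
    using that unfolding Z_def by blast
  ultimately show ?thesis by (intro that[of \<xi>]) (auto simp: generic_def)
qed

lemma exists_generic: "\<exists>\<xi>. generic \<xi>"
proof -
  have fin: "finite (\<Union>I\<in>V. U I ` I)" using finite_V finite_I by auto
  have "0 \<notin> (\<Union>I\<in>V. U I ` I)"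
  proof
    assume "0 \<in> (\<Union>I\<in>V. U I ` I)"
    then obtain I j where "I \<in> V" "j \<in> I" "0 = U I j" by auto
    then show False using U_nonzero[of I j] by simp
  qed
  from exists_not_orthogonal[OF open_UNIV UNIV_not_empty fin this]
  obtain \<xi> where "\<And>z. z \<in> (\<Union>I\<in>V. U I ` I) \<Longrightarrow> \<xi> \<bullet> z \<noteq> 0" by auto
  then show ?thesis by (auto simp: generic_def)
qed

lemma vtx_in_poly:
  assumes "nondeg lam" "I \<in> V"
  shows "vtx I lam \<in> poly_of d N lam"
proof -
  have "N i \<bullet> vtx I lam \<le> lam i" if "i < d" for i
    using assms that inner_vtx[of I i lam] by (cases "i \<in> I") (auto simp: nondeg_def less_imp_le)
  then show ?thesis by (auto simp: poly_of_def inner_commute)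
qed

lemma inner_expansion:
  assumes I: "I \<in> V" and J: "J \<subseteq> I" and x: "\<And>j. j \<in> J \<Longrightarrow> N j \<bullet> x = lam j"
  shows "\<xi> \<bullet> x = \<xi> \<bullet> vtx I lam + (\<Sum>j\<in>I - J. (lam j - N j \<bullet> x) * (\<xi> \<bullet> U I j))"
proof -
  have "\<xi> \<bullet> x = \<xi> \<bullet> vtx I lam + (\<Sum>j\<in>I. (lam j - N j \<bullet> x) * (\<xi> \<bullet> U I j))"
    by (subst expansion[OF I, of x lam]) (simp add: inner_add_right inner_sum_right)
  also have "(\<Sum>j\<in>I. (lam j - N j \<bullet> x) * (\<xi> \<bullet> U I j)) = (\<Sum>j\<in>I - J. (lam j - N j \<bullet> x) * (\<xi> \<bullet> U I j))"
    using x J finite_I[OF I] by (intro sum.mono_neutral_right) auto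
  finally show ?thesis .
qed

text \<open>\<open>J\<close> selects a face: the empty set gives the polytope itself, for the
  lattice points, and a singleton gives a facet, for its volume. A point on the hyperplanes of
  \<open>J\<close> has zero slack there, so only the edges inside the face enter.\<close>

theorem polar_decomposition:
  assumes lam: "nondeg lam" and gen: "generic \<xi>" and J: "\<exists>I\<in>V. J \<subseteq> I"
    and x: "\<And>j. j \<in> J \<Longrightarrow> N j \<bullet> x = lam j"
  shows "(\<Sum>I\<in>{I\<in>V. J \<subseteq> I}. \<Prod>j\<in>I - J. (of_bool (0 \<le> lam j - N j \<bullet> x) - of_bool (\<xi> \<bullet> U I j > 0)))
       = (of_bool (x \<in> poly_of d N lam) :: real)"
proof -
  define VJ where "VJ = {I\<in>V. J \<subseteq> I}"
  have VJ: "finite VJ" "VJ \<noteq> {}" using finite_V J by (auto simp: VJ_def)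
  define h where "h j \<longleftrightarrow> 0 \<le> lam j - N j \<bullet> x" for j
  have "polar_sum J (pos \<xi>) h = of_bool (x \<in> poly_of d N lam)"
  proof (cases "x \<in> poly_of d N lam")
    case True
    then have h: "h j" if "j < d" for j using that by (auto simp: h_def poly_of_def inner_commute)
    have "Max ((\<lambda>I. \<xi> \<bullet> vtx I lam) ` VJ) \<in> (\<lambda>I. \<xi> \<bullet> vtx I lam) ` VJ" using VJ by (intro Max_in) auto
    then obtain M where "M \<in> VJ" "\<xi> \<bullet> vtx M lam = Max ((\<lambda>I. \<xi> \<bullet> vtx I lam) ` VJ)" by auto
    then have M: "M \<in> VJ" "\<And>I. I \<in> VJ \<Longrightarrow> \<xi> \<bullet> vtx I lam \<le> \<xi> \<bullet> vtx M lam"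
      using VJ by auto
    have neg: "\<xi> \<bullet> U M j < 0" if j: "j \<in> M - J" for j
    proof -
      from M have MV: "M \<in> V" "J \<subseteq> M" by (auto simp: VJ_def)
      obtain j' where j': "j' \<notin> M" "insert j' (M - {j}) \<in> V" using exchange MV j by blast
      let ?I = "insert j' (M - {j})"
      have "?I \<in> VJ" using j' MV j by (auto simp: VJ_def)
      define s where "s = lam j - N j \<bullet> vtx ?I lam"
      have "j \<notin> ?I" "j < d" using j j' V_subset MV by auto
      then have "s > 0" using lam j' by (auto simp: nondeg_def s_def)
      moreover have "vtx ?I lam = vtx M lam + s *\<^sub>R U M j"
        unfolding s_def by (rule vtx_diff) (use MV j j' in auto)
      then have "s * (\<xi> \<bullet> U M j) \<le> 0" using M(2)[OF \<open>?I \<in> VJ\<close>] by (simp add: inner_add_right)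
      ultimately have "\<xi> \<bullet> U M j \<le> 0" by (simp add: mult_le_0_iff)
      moreover have "\<xi> \<bullet> U M j \<noteq> 0" using gen MV j by (auto simp: generic_def)
      ultimately show ?thesis by simp
    qed
    \<comment> \<open>If every edge of the face at \<open>I\<close> decreased \<open>\<xi>\<close>,
      the positive slack of \<open>M\<close> for some \<open>j\<close> in \<open>I\<close> would put
      \<open>M\<close> strictly below \<open>I\<close>. So \<open>I\<close> has a flipped edge,
      whose factor 1 - 1 vanishes.\<close>
    have other: "\<exists>j\<in>I - J. \<xi> \<bullet> U I j > 0" if I: "I \<in> VJ" "I \<noteq> M" for I
    proof (rule ccontr)
      assume no: "\<not> ?thesis"
      from I M have IV: "I \<in> V" "J \<subseteq> I" and MV: "M \<in> V" "J \<subseteq> M" by (auto simp: VJ_def)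
      have slack: "0 \<le> lam j - N j \<bullet> vtx M lam" if "j \<in> I" for j
        using vtx_in_poly[OF lam MV(1)] V_subset[OF IV(1)] that by (auto simp: poly_of_def inner_commute)
      have "\<not> I \<subseteq> M" using I card_subset_eq[OF finite_I[OF MV(1)]] V_card IV MV by metis
      then obtain j where j: "j \<in> I" "j \<notin> M" by auto
      then have "j < d" using V_subset IV by auto
      then have j_slack: "0 < lam j - N j \<bullet> vtx M lam" using lam MV j by (auto simp: nondeg_def)
      have Uneg: "\<xi> \<bullet> U I i < 0" if "i \<in> I - J" for i
        using no gen IV that unfolding generic_def by (metis DiffD1 linorder_neqE_linordered_idom)
      have "\<xi> \<bullet> vtx M lam = \<xi> \<bullet> vtx I lam + (\<Sum>j\<in>I - J. (lam j - N j \<bullet> vtx M lam) * (\<xi> \<bullet> U I j))"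
        by (rule inner_expansion) (use IV MV in \<open>auto simp: inner_vtx\<close>)
      moreover have "(\<Sum>j\<in>I - J. (lam j - N j \<bullet> vtx M lam) * (\<xi> \<bullet> U I j)) < 0"
      proof -
        have "j \<in> I - J" using j MV by auto
        then have "(\<Sum>j\<in>I - J. (lam j - N j \<bullet> vtx M lam) * (\<xi> \<bullet> U I j)) < (\<Sum>j\<in>I - J. 0)"
          using finite_I[OF IV(1)] slack Uneg j_slack
          by (intro sum_strict_mono_ex1) (force intro: mult_nonneg_nonpos mult_pos_neg less_imp_le)+
        then show ?thesis by simp
      qed
      ultimately show False using M(2)[OF I(1)] by simp
    qed
    have "polar_sum J (pos \<xi>) h = (\<Sum>I\<in>VJ. if I = M then 1 else 0)"
      unfolding polar_sum_def VJ_def[symmetric]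
    proof (rule sum.cong)
      fix I assume I: "I \<in> VJ"
      then have IV: "I \<in> V" by (simp add: VJ_def)
      then have hI: "h j" if "j \<in> I" for j using h V_subset that by auto
      show "(\<Prod>j\<in>I - J. (of_bool (h j) - of_bool (\<xi> \<bullet> U I j > 0))) = (if I = M then 1 else 0 :: real)"
      proof (cases "I = M")
        case True
        then show ?thesis using neg hI by (auto intro!: prod.neutral) (meson not_less_iff_gr_or_eq)+
      next
        case False
        from other[OF I this] show ?thesis using False hI finite_I[OF IV] by (auto intro!: prod_zero)
      qed
    qed simp
    then show ?thesis using True M(1) VJ by simp
  next
    case False
    then obtain i where i: "i < d" "lam i < N i \<bullet> x" by (auto simp: poly_of_def inner_commute not_le)
    \<comment> \<open>The directions in which \<open>x\<close> lies beyond all vertices of the face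
      form an open set. It contains the normal of the violated inequality, so a generic member
      exists.\<close>
    define S where "S = (\<Inter>I\<in>VJ. {\<zeta>. \<zeta> \<bullet> (vtx I lam - x) < 0})"
    have "open S" unfolding S_def using VJ
      by (intro open_INT) (auto simp: inner_commute[of _ "_ - _"] intro: open_halfspace_lt)
    moreover have "N i \<in> S"
      using vtx_in_poly[OF lam] i by (force simp: S_def VJ_def poly_of_def inner_diff_right inner_commute)
    ultimately obtain \<xi>1 where \<xi>1: "\<xi>1 \<in> S" "generic \<xi>1"
      and good: "\<And>I i j. I \<in> V \<Longrightarrow> i \<in> I \<Longrightarrow> j \<in> I \<Longrightarrow> i \<noteq> j \<Longrightarrow>
      \<xi>1 \<bullet> ((\<xi> \<bullet> U I j) *\<^sub>R U I i - (\<xi> \<bullet> U I i) *\<^sub>R U I j) \<noteq> 0"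
      using exists_good_direction[of S, OF _ _ gen] by blast
    have "polar_sum J (pos \<xi>) h = polar_sum J (pos \<xi>1) h"
      by (rule polar_sum_generic_independent[OF lam gen \<xi>1(2) good])
    also have "\<dots> = 0"
      unfolding polar_sum_def VJ_def[symmetric]
    proof (rule sum.neutral, safe)
      fix I assume I: "I \<in> VJ"
      show "(\<Prod>j\<in>I - J. (of_bool (h j) - of_bool (\<xi>1 \<bullet> U I j > 0))) = (0 :: real)"
      proof (rule ccontr)
        assume "(\<Prod>j\<in>I - J. (of_bool (h j) - of_bool (\<xi>1 \<bullet> U I j > 0))) \<noteq> (0 :: real)"
        moreover have IV: "I \<in> V" "J \<subseteq> I" using I by (auto simp: VJ_def)
        ultimately have nz: "\<forall>j\<in>I - J. of_bool (h j) - of_bool (\<xi>1 \<bullet> U I j > 0) \<noteq> (0 :: real)"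
          using finite_I by (simp add: prod_zero_iff)
        \<comment> \<open>A nonzero factor pairs a nonnegative slack with a nonincreasing edge and a
          negative slack with an increasing one, so every summand of
          \<open>\<xi>1 \<bullet> x - \<xi>1 \<bullet> vtx I lam\<close> is at most 0.\<close>
        have *: "h j \<noteq> (\<xi>1 \<bullet> U I j > 0)" if "j \<in> I - J" for j
          using bspec[OF nz that] by (cases "h j"; cases "\<xi>1 \<bullet> U I j > 0") simp_all
        have "(lam j - N j \<bullet> x) * (\<xi>1 \<bullet> U I j) \<le> 0" if "j \<in> I - J" for j
          using *[OF that] by (auto simp: h_def mult_le_0_iff)
        then have "(\<Sum>j\<in>I - J. (lam j - N j \<bullet> x) * (\<xi>1 \<bullet> U I j)) \<le> 0" by (rule sum_nonpos)
        moreover have "\<xi>1 \<bullet> x = \<xi>1 \<bullet> vtx I lam + (\<Sum>j\<in>I - J. (lam j - N j \<bullet> x) * (\<xi>1 \<bullet> U I j))"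
          by (rule inner_expansion) (use IV x in auto)
        ultimately have "\<xi>1 \<bullet> x \<le> \<xi>1 \<bullet> vtx I lam" by simp
        moreover have "\<xi>1 \<bullet> vtx I lam < \<xi>1 \<bullet> x" using \<xi>1(1) I by (auto simp: S_def inner_diff_right)
        ultimately show False by simp
      qed
    qed
    finally show ?thesis using False by simp
  qed
  then show ?thesis by (simp add: polar_sum_def h_def)
qed

end

section \<open>Linear changes of variables\<close>

lemma vimage_eq_image_inverse:
  assumes "\<And>x. f (g x) = x" "\<And>x. g (f x) = x"
  shows "g -` S = f ` S"
  using assms by (auto simp: image_iff) metis

lemma borel_measurable_linear:
  fixes f :: "'a :: euclidean_space \<Rightarrow> 'b :: euclidean_space"
  assumes "linear f" shows "f \<in> borel_measurable borel"
  using assms linear_continuous_on[of f UNIV]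
  by (intro borel_measurable_continuous_onI) (simp add: linear_conv_bounded_linear)

lemma det_matrix_shear:
  fixes m n :: "'n :: finite"
  assumes "m \<noteq> n"
  shows "det (matrix (\<lambda>x::real^'n. \<chi> i. if i = m then x $ m + x $ n else x $ i)) = 1"
proof -
  have "matrix (\<lambda>x::real^'n. \<chi> i. if i = m then x $ m + x $ n else x $ i)
     = (\<chi> k. if k = m then row m (mat 1) + 1 *s row n (mat 1) else row k (mat 1))"
    by (auto simp: matrix_def vec_eq_iff row_def mat_def axis_def)
  then show ?thesis using det_row_operation[OF assms, of "mat 1" 1] by simp
qed

lemma det_matrix_swap:
  fixes m n :: "'n :: finite"
  shows "\<bar>det (matrix (\<lambda>x::real^'n. \<chi> i. x $ Transposition.transpose m n i))\<bar> = 1"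
proof -
  have "matrix (\<lambda>x::real^'n. \<chi> i. x $ Transposition.transpose m n i)
     = (\<chi> i. mat 1 $ Transposition.transpose m n i)"
    by (auto simp: matrix_def vec_eq_iff mat_def axis_def)
  then show ?thesis
    using det_permute_rows[OF permutes_swap_id[of m UNIV n], of "mat 1 :: real^'n^'n"]
    by (simp add: sign_swap_id)
qed

lemma emeasure_lborel_box_cart:
  "emeasure lborel (box (l :: real^'n) u) = (if \<forall>i. l $ i \<le> u $ i then \<Prod>i\<in>UNIV. ennreal (u $ i - l $ i) else 0)"
proof -
  have B: "(Basis :: (real^'n) set) = range (\<lambda>i. axis i 1)" by (auto simp: Basis_vec_def)
  have inj: "inj (\<lambda>i. axis i 1 :: real^'n)" by (auto intro!: injI simp: axis_eq_axis)
  show ?thesis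
    unfolding emeasure_lborel_box_eq B
    by (simp add: prod.reindex[OF inj] inner_axis prod_ennreal del: Basis_real_def)
qed

lemma distr_lborel_swap:
  fixes m n :: "'n :: finite"
  shows "distr lborel borel (\<lambda>x::real^'n. \<chi> i. x $ Transposition.transpose m n i) = lborel" (is "distr _ _ ?f = _")
proof (rule lborel_eqI[symmetric])
  have f[measurable]: "?f \<in> borel_measurable borel"
    by (intro borel_measurable_continuous_onI continuous_intros)
  fix l u :: "real^'n" assume le: "\<And>b. b \<in> Basis \<Longrightarrow> l \<bullet> b \<le> u \<bullet> b"
  have "?f -` box l u = box (?f l) (?f u)"
    by (auto simp: mem_box_cart) (metis transpose_involutory)+
  then have "emeasure (distr lborel borel ?f) (box l u) = emeasure lborel (box (?f l) (?f u))"
    by (simp add: emeasure_distr)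
  also have "\<dots> = emeasure lborel (box l u)"
  proof -
    have "(\<Prod>i\<in>UNIV. ennreal (u $ Transposition.transpose m n i - l $ Transposition.transpose m n i))
       = (\<Prod>i\<in>UNIV. ennreal (u $ i - l $ i))"
      using prod.permute[OF permutes_swap_id[of m UNIV n], of "\<lambda>i. ennreal (u $ i - l $ i)"] by (simp add: o_def)
    moreover have "(\<forall>i. l $ Transposition.transpose m n i \<le> u $ Transposition.transpose m n i) \<longleftrightarrow> (\<forall>i. l $ i \<le> u $ i)"
      by (metis transpose_involutory)
    ultimately show ?thesis by (simp add: emeasure_lborel_box_cart)
  qed
  also have "\<dots> = (\<Prod>b\<in>Basis. (u - l) \<bullet> b)" using le by (simp add: emeasure_lborel_box)
  finally show "emeasure (distr lborel borel ?f) (box l u) = (\<Prod>b\<in>Basis. (u - l) \<bullet> b)" .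
qed simp

text \<open>The inverse shear comes first: preimages of boxes under it are sheared boxes, whose
  measure is known. The claim for the shear itself follows by composition.\<close>

lemma distr_lborel_shear:
  fixes m n :: "'n :: finite"
  assumes "m \<noteq> n"
  shows "distr lborel borel (\<lambda>x::real^'n. \<chi> i. if i = m then x $ m + x $ n else x $ i) = lborel" (is "distr _ _ ?f = _")
proof -
  let ?g = "\<lambda>x::real^'n. \<chi> i. if i = m then x $ m - x $ n else x $ i"
  have f[measurable]: "?f \<in> borel_measurable borel"
    by (rule borel_measurable_linear, rule linearI) (auto simp: vec_eq_iff algebra_simps)
  have g[measurable]: "?g \<in> borel_measurable borel"
    by (rule borel_measurable_linear, rule linearI) (auto simp: vec_eq_iff algebra_simps)
  have fg: "?f (?g x) = x" "?g (?f x) = x" for x using assms by (auto simp: vec_eq_iff)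
  have "distr lborel borel ?g = lborel"
  proof (rule lborel_eqI[symmetric])
    fix l u :: "real^'n" assume le: "\<And>b. b \<in> Basis \<Longrightarrow> l \<bullet> b \<le> u \<bullet> b"
    have lin: "linear ?f" by (rule linearI) (auto simp: vec_eq_iff algebra_simps)
    have le': "l $ i \<le> u $ i" for i using le[of "axis i 1"] by (simp add: inner_axis)
    have pre: "?g -` box l u = ?f ` box l u" by (rule vimage_eq_image_inverse) (rule fg)+
    \<comment> \<open>The measure of a sheared interval is taken at lower corner 0 and then
      translated; passing from the closed to the open box changes it by a negligible set.\<close>
    have "cbox 0 (u - l) \<noteq> {}" using le' by (simp add: interval_ne_empty_cart)
    from measurable_shear_interval[OF assms this] measure_shear_interval[OF assms this]
    have 0: "?f ` cbox 0 (u - l) \<in> lmeasurable"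
      "measure lebesgue (?f ` cbox 0 (u - l)) = measure lebesgue (cbox 0 (u - l))" by simp_all
    have cl: "cbox l u = (+) l ` cbox 0 (u - l)"
      using cbox_translation[of l 0 "u - l"] by simp
    have tr: "?f ` cbox l u = (+) (?f l) ` ?f ` cbox 0 (u - l)"
      unfolding cl image_image linear_add[OF lin] ..
    have 1: "?f ` cbox l u \<in> lmeasurable" "measure lebesgue (?f ` cbox l u) = measure lebesgue (cbox l u)"
      unfolding tr measure_translation 0(2) using 0(1)
      by (rule measurable_translation) (simp only: cl measure_translation)
    have "?f ` cbox l u - ?f ` box l u \<subseteq> ?f ` (cbox l u - box l u)" by auto
    then have neg: "negligible (?f ` cbox l u - ?f ` box l u \<union> (?f ` box l u - ?f ` cbox l u))"
    proof -
      have "negligible (?f ` (cbox l u - box l u))"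
        by (rule negligible_differentiable_image_negligible[OF order_refl negligible_frontier_interval
            linear_imp_differentiable_on[OF lin]])
      moreover have "?f ` box l u - ?f ` cbox l u = {}" using box_subset_cbox by blast
      ultimately show ?thesis using \<open>?f ` cbox l u - ?f ` box l u \<subseteq> _\<close> negligible_subset by auto
    qed
    have "emeasure (distr lborel borel ?g) (box l u) = emeasure lebesgue (?f ` box l u)"
    proof -
      have "?g -` box l u \<inter> space borel \<in> sets borel" using g by (rule measurable_sets) simp
      then show ?thesis by (simp add: emeasure_distr pre)
    qed
    also have "\<dots> = ennreal (measure lebesgue (?f ` box l u))"
      by (rule emeasure_eq_measure2[OF lmeasurable_negligible_symdiff[OF 1(1) neg]])
    also have "measure lebesgue (?f ` box l u) = (\<Prod>b\<in>Basis. (u - l) \<bullet> b)"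
      using measure_negligible_symdiff[OF 1(1) neg] 1(2) le by (simp add: inner_diff_left)
    finally show "emeasure (distr lborel borel ?g) (box l u) = (\<Prod>b\<in>Basis. (u - l) \<bullet> b)" .
  qed simp
  then have "distr lborel borel ?f = distr (distr lborel borel ?g) borel ?f" by simp
  also have "\<dots> = distr lborel borel (?f \<circ> ?g)" by (rule distr_distr) measurable
  also have "?f \<circ> ?g = (\<lambda>x. x)" using fg by auto
  also have "distr lborel borel (\<lambda>x. x) = (lborel :: (real^'n) measure)" by (simp add: distr_id2)
  finally show ?thesis .
qed

text \<open>Every linear map is composed of swaps, shears, coordinate scalings and maps into a
  coordinate hyperplane. Swaps and shears preserve the measure, scalings multiply it by the product
  of the factors, maps of the last kind are singular, and determinants are multiplicative.\<close>

lemma lborel_linear_image: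
  fixes f :: "real^'n \<Rightarrow> real^'n"
  assumes "linear f" 
    and "det (matrix f) \<noteq> 0" "h \<in> borel_measurable borel"
  shows "(\<integral>\<^sup>+x. h x \<partial>lborel) = ennreal \<bar>det (matrix f)\<bar> * (\<integral>\<^sup>+x. h (f x) \<partial>lborel)"
proof -
  define Q :: "(real^'n \<Rightarrow> real^'n) \<Rightarrow> bool" where
    "Q f \<longleftrightarrow> (det (matrix f) \<noteq> 0 \<longrightarrow> (\<forall>h\<in>borel_measurable borel. (\<integral>\<^sup>+x. h x \<partial>lborel) =
      ennreal \<bar>det (matrix f)\<bar> * (\<integral>\<^sup>+x. h (f x) \<partial>lborel)))" for f
  have "Q f"
    using assms(1)
  proof (rule induct_linear_elementary)
    fix f g :: "real^'n \<Rightarrow> real^'n"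
    assume 2: "linear f" "linear g" "Q f" "Q g"
    have [measurable]: "f \<in> borel_measurable borel" "g \<in> borel_measurable borel"
      using 2(1,2) by (auto intro: borel_measurable_linear)
    show "Q (f \<circ> g)" unfolding Q_def
    proof (intro impI ballI)
      fix h :: "real^'n \<Rightarrow> ennreal" assume hm[measurable]: "h \<in> borel_measurable borel" and "det (matrix (f \<circ> g)) \<noteq> 0"
      then have ne: "det (matrix f) \<noteq> 0" "det (matrix g) \<noteq> 0"
        by (auto simp: matrix_compose[OF 2(2,1)] det_mul)
      have "(\<integral>\<^sup>+x. h x \<partial>lborel) = ennreal \<bar>det (matrix f)\<bar> * (\<integral>\<^sup>+x. h (f x) \<partial>lborel)"
        using 2(3)[unfolded Q_def, rule_format, OF ne(1) hm] .
      also have "(\<integral>\<^sup>+x. h (f x) \<partial>lborel) = ennreal \<bar>det (matrix g)\<bar> * (\<integral>\<^sup>+x. h (f (g x)) \<partial>lborel)"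
        using 2(4)[unfolded Q_def, rule_format, OF ne(2), of "\<lambda>x. h (f x)"] by measurable
      finally show "(\<integral>\<^sup>+x. h x \<partial>lborel) = ennreal \<bar>det (matrix (f \<circ> g))\<bar> * (\<integral>\<^sup>+x. h ((f \<circ> g) x) \<partial>lborel)"
        unfolding matrix_compose[OF 2(2,1)] det_mul abs_mult by (simp add: ennreal_mult mult.assoc)
    qed
  next
    fix f :: "real^'n \<Rightarrow> real^'n" and i
    assume 3: "linear f" "\<And>x. f x $ i = 0"
    then have "\<not> inj f"
      by (metis (full_types) linear_injective_imp_surjective one_neq_zero surjE vec_component)
    then have "det (matrix f) = 0" using det_nz_iff_inj[OF 3(1)] by blast
    then show "Q f" by (simp add: Q_def)
  next
    fix c :: "'n \<Rightarrow> real"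
    have m: "det (matrix (\<lambda>x::real^'n. \<chi> i. c i * x $ i)) = (\<Prod>i\<in>UNIV. c i)"
      by (subst det_diagonal) (auto simp: matrix_def axis_def)
    show "Q (\<lambda>x. \<chi> i. c i * x $ i)" unfolding Q_def
    proof (intro impI ballI)
      fix h :: "real^'n \<Rightarrow> ennreal" assume [measurable]: "h \<in> borel_measurable borel"
        and ne: "det (matrix (\<lambda>x::real^'n. \<chi> i. c i * x $ i)) \<noteq> 0"
      then have c: "c i \<noteq> 0" for i by (auto simp: m)
      define C where "C b = c (THE i. b = axis i 1)" for b :: "real^'n"
      have C: "C (axis i 1) = c i" for i by (simp add: C_def axis_eq_axis)
      have B: "(Basis :: (real^'n) set) = range (\<lambda>i. axis i 1)" by (auto simp: Basis_vec_def)
      have inj: "inj (\<lambda>i. axis i 1 :: real^'n)" by (auto intro!: injI simp: axis_eq_axis)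
      have T: "0 + (\<Sum>j\<in>Basis. (C j * (x \<bullet> j)) *\<^sub>R j) = (\<chi> i. c i * x $ i)" for x :: "real^'n"
      proof -
        have "(\<Sum>j\<in>Basis. (C j * (x \<bullet> j)) *\<^sub>R j) = (\<Sum>i\<in>UNIV. (c i * x $ i) *\<^sub>R axis i 1)"
          unfolding B by (subst sum.reindex[OF inj]) (simp add: o_def C inner_axis)
        then show ?thesis by (simp add: vec_eq_iff axis_def[of _ "1::real"] if_distrib cong: if_cong)
      qed
      have "(\<integral>\<^sup>+x. h x \<partial>lborel) = (\<integral>\<^sup>+x. h x \<partial>density (distr lborel borel (\<lambda>x. \<chi> i. c i * x $ i)) (\<lambda>_. (\<Prod>j\<in>Basis. \<bar>C j\<bar>)))"
      proof -
        have "C j \<noteq> 0" if "j \<in> Basis" for j using that c C unfolding B by auto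
        from lborel_affine_euclidean[of C 0, OF this] show ?thesis unfolding T by simp
      qed
      also have "\<dots> = ennreal \<bar>\<Prod>i\<in>UNIV. c i\<bar> * (\<integral>\<^sup>+x. h (\<chi> i. c i * x $ i) \<partial>lborel)"
      proof -
        have [measurable]: "(\<lambda>x::real^'n. \<chi> i. c i * x $ i) \<in> borel_measurable borel"
          by (intro borel_measurable_continuous_onI continuous_intros)
        have "(\<Prod>j\<in>Basis. \<bar>C j\<bar>) = \<bar>\<Prod>i\<in>UNIV. c i\<bar>"
          unfolding B by (simp add: prod.reindex[OF inj] C abs_prod)
        then show ?thesis by (simp add: nn_integral_density nn_integral_cmult nn_integral_distr)
      qed
      finally show "(\<integral>\<^sup>+x. h x \<partial>lborel) = ennreal \<bar>det (matrix (\<lambda>x::real^'n. \<chi> i. c i * x $ i))\<bar> * (\<integral>\<^sup>+x. h (\<chi> i. c i * x $ i) \<partial>lborel)"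
        unfolding m .
    qed
  next
    fix m n :: 'n
    let ?f = "\<lambda>x::real^'n. \<chi> i. x $ Transposition.transpose m n i"
    have [measurable]: "?f \<in> borel_measurable borel"
      by (intro borel_measurable_continuous_onI continuous_intros)
    have "(\<integral>\<^sup>+x. h x \<partial>lborel) = (\<integral>\<^sup>+x. h (?f x) \<partial>lborel)" if [measurable]: "h \<in> borel_measurable borel" for h
      by (subst distr_lborel_swap[of m n, symmetric]) (simp add: nn_integral_distr)
    then show "Q ?f" unfolding Q_def det_matrix_swap ennreal_1 mult_1 by blast
  next
    fix m n :: 'n assume 6: "m \<noteq> n"
    let ?f = "\<lambda>x::real^'n. \<chi> i. if i = m then x $ m + x $ n else x $ i"
    have [measurable]: "?f \<in> borel_measurable borel"
      by (rule borel_measurable_linear, rule linearI) (auto simp: vec_eq_iff algebra_simps)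
    have "(\<integral>\<^sup>+x. h x \<partial>lborel) = (\<integral>\<^sup>+x. h (?f x) \<partial>lborel)" if [measurable]: "h \<in> borel_measurable borel" for h
      by (subst distr_lborel_shear[OF 6, symmetric]) (simp add: nn_integral_distr)
    then show "Q ?f" unfolding Q_def det_matrix_shear[OF 6] abs_one ennreal_1 mult_1 by blast
  qed
  then show ?thesis using assms by (simp add: Q_def)
qed

lemma
  fixes g :: "real^'n \<Rightarrow> real^'n" and F :: "real^'n \<Rightarrow> real"
  assumes g: "linear g" "det (matrix g) \<noteq> 0" and [measurable]: "F \<in> borel_measurable borel"
  shows lborel_integrable_affine: "integrable lborel F \<longleftrightarrow> integrable lborel (\<lambda>y. F (v + g y))"
    and lborel_integral_affine: "(\<integral>x. F x \<partial>lborel) = \<bar>det (matrix g)\<bar> * (\<integral>y. F (v + g y) \<partial>lborel)"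
proof -
  have [measurable]: "g \<in> borel_measurable borel"
    using g(1) by (rule borel_measurable_linear)
  let ?D = "density (distr lborel borel g) (\<lambda>_. ennreal \<bar>det (matrix g)\<bar>)"
  \<comment> \<open>Applied to indicators, the substitution rule is an identity of measures, and
    this carries it over to integrands of either sign.\<close>
  have eq: "?D = lborel"
  proof (rule measure_eqI)
    fix A assume "A \<in> sets ?D"
    then have [measurable]: "A \<in> sets borel" by simp
    have "emeasure ?D A = ennreal \<bar>det (matrix g)\<bar> * (\<integral>\<^sup>+x. indicator A (g x) \<partial>lborel)"
      by (simp add: emeasure_density nn_integral_cmult nn_integral_distr del: nn_integral_indicator)
    also have "\<dots> = (\<integral>\<^sup>+x. indicator A x \<partial>lborel)"
      by (rule lborel_linear_image[OF g, symmetric]) simp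
    finally show "emeasure ?D A = emeasure lborel A" by simp
  qed simp
  have tr: "distr lborel borel ((+) v) = lborel" by (rule lborel_distr_plus)
  have "integrable lborel F \<longleftrightarrow> integrable (distr lborel borel ((+) v)) F" by (simp add: tr)
  also have "\<dots> \<longleftrightarrow> integrable lborel (\<lambda>x. F (v + x))" by (subst integrable_distr_eq) auto
  also have "\<dots> \<longleftrightarrow> integrable ?D (\<lambda>x. F (v + x))" by (simp only: eq)
  also have "\<dots> \<longleftrightarrow> integrable lborel (\<lambda>y. F (v + g y))"
    using g(2) by (subst integrable_density) (auto simp: integrable_distr_eq)
  finally show "integrable lborel F \<longleftrightarrow> integrable lborel (\<lambda>y. F (v + g y))" .
  have "(\<integral>x. F x \<partial>lborel) = (\<integral>x. F x \<partial>distr lborel borel ((+) v))" by (simp add: tr)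
  also have "\<dots> = (\<integral>x. F (v + x) \<partial>lborel)" by (subst integral_distr) auto
  also have "\<dots> = (\<integral>x. F (v + x) \<partial>?D)" by (simp only: eq)
  also have "\<dots> = \<bar>det (matrix g)\<bar> * (\<integral>y. F (v + g y) \<partial>lborel)"
    by (subst integral_density) (auto simp: integral_distr)
  finally show "(\<integral>x. F x \<partial>lborel) = \<bar>det (matrix g)\<bar> * (\<integral>y. F (v + g y) \<partial>lborel)" .
qed

section \<open>Product integrals, polarized half-lines and unimodular determinants\<close>

lemma
  fixes \<phi> :: "'n::finite \<Rightarrow> real \<Rightarrow> real"
  assumes \<phi>: "\<And>k. integrable lborel (\<phi> k)"
  shows lborel_integrable_prod_cart: "integrable lborel (\<lambda>x::real^'n. \<Prod>k\<in>UNIV. \<phi> k (x $ k))"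
    and lborel_integral_prod_cart: "integral\<^sup>L lborel (\<lambda>x::real^'n. \<Prod>k\<in>UNIV. \<phi> k (x $ k)) = (\<Prod>k\<in>UNIV. \<integral>s. \<phi> k s \<partial>lborel)"
proof -
  have [measurable]: "\<phi> k \<in> borel_measurable borel" for k using \<phi>[of k] by simp
  interpret product_sigma_finite "\<lambda>_::real^'n. lborel :: real measure" by standard
  have B: "(Basis :: (real^'n) set) = range (\<lambda>i. axis i 1)" by (auto simp: Basis_vec_def)
  have inj: "inj (\<lambda>i. axis i 1 :: real^'n)" by (auto intro!: injI simp: axis_eq_axis)
  define \<psi> where "\<psi> b = \<phi> (THE i. b = axis i 1)" for b :: "real^'n"
  have \<psi>: "\<psi> (axis i 1) = \<phi> i" for i by (simp add: \<psi>_def axis_eq_axis)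
  let ?h = "\<lambda>f. \<Sum>b\<in>Basis. f b *\<^sub>R b :: real^'n"
  have nth: "?h f $ k = f (axis k 1)" for f k
  proof -
    have "?h f = (\<Sum>i\<in>UNIV. f (axis i 1) *\<^sub>R axis i 1)"
      unfolding B by (subst sum.reindex[OF inj]) (simp add: o_def)
    then show ?thesis by (simp add: axis_def[of _ "1::real"] if_distrib cong: if_cong)
  qed
  have prod: "(\<Prod>k\<in>UNIV. \<phi> k (?h f $ k)) = (\<Prod>b\<in>Basis. \<psi> b (f b))" for f
    unfolding nth unfolding B by (simp add: prod.reindex[OF inj] \<psi>)
  have int: "integrable lborel (\<psi> b)" if "b \<in> Basis" for b using that \<psi> \<phi> unfolding B by auto
  have h[measurable]: "?h \<in> measurable (Pi\<^sub>M Basis (\<lambda>_. lborel)) borel" by measurable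
  have m[measurable]: "(\<lambda>x::real^'n. \<Prod>k\<in>UNIV. \<phi> k (x $ k)) \<in> borel_measurable borel"
    by measurable
  show "integrable lborel (\<lambda>x::real^'n. \<Prod>k\<in>UNIV. \<phi> k (x $ k))"
    unfolding lborel_eq[where 'a = "real^'n"]
    by (subst integrable_distr_eq[OF h m], unfold prod) (intro product_integrable_prod int finite_Basis)
  have "integral\<^sup>L lborel (\<lambda>x::real^'n. \<Prod>k\<in>UNIV. \<phi> k (x $ k)) = (\<Prod>b\<in>Basis. \<integral>s. \<psi> b s \<partial>lborel)"
    unfolding lborel_eq[where 'a = "real^'n"]
    by (subst integral_distr[OF h m], unfold prod) (intro product_integral_prod int finite_Basis)
  also have "\<dots> = (\<Prod>k\<in>UNIV. \<integral>s. \<phi> k s \<partial>lborel)"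
    unfolding B by (simp add: prod.reindex[OF inj] \<psi>)
  finally show "integral\<^sup>L lborel (\<lambda>x::real^'n. \<Prod>k\<in>UNIV. \<phi> k (x $ k)) = (\<Prod>k\<in>UNIV. \<integral>s. \<phi> k s \<partial>lborel)" .
qed

text \<open>For negative \<open>w\<close> this is the integral over the half-line. For positive
  \<open>w\<close> that integral diverges and is replaced by minus the one over the complementary
  half-line. The value is the same rational expression, so vertex terms do not depend on how the
  cone was polarized.\<close>

lemma has_bochner_integral_polar_exp:
  assumes "w \<noteq> (0::real)"
  shows "has_bochner_integral lborel (\<lambda>b. (of_bool (0 \<le> b) - of_bool (w > 0)) * exp (w * b)) (- 1 / w)"
proof -
  have neg: "has_bochner_integral lborel (\<lambda>b. of_bool (0 \<le> b) * exp (w * b)) (- 1 / w)" if w: "w < 0" for w :: real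
  proof -
    have "has_bochner_integral lborel (\<lambda>b. exp (w * b) * indicator {0..} b) (0 - exp (w * 0) / w)"
    proof (rule has_bochner_integral_nn_integral)
      have D: "((\<lambda>x. exp (w * x) / w) has_real_derivative exp (w * x)) (at x)" for x
        using w by (intro DERIV_cong[OF DERIV_cdivide[OF DERIV_fun_exp[OF DERIV_cmult_Id]]]) simp
      have "((\<lambda>x. exp (w * x) / w) \<longlongrightarrow> 0 / w) at_top"
        by (intro tendsto_divide tendsto_const filterlim_compose[OF exp_at_bot]
            filterlim_tendsto_neg_mult_at_bot[OF tendsto_const w filterlim_ident] less_imp_neq[OF w])
      then have "(\<integral>\<^sup>+x. ennreal (exp (w * x)) * indicator {0..} x \<partial>lborel) = ennreal (0 - exp (w * 0) / w)"
        by (intro nn_integral_FTC_atLeast D) simp_all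
      then show "(\<integral>\<^sup>+x. ennreal (exp (w * x) * indicator {0..} x) \<partial>lborel) = ennreal (0 - exp (w * 0) / w)"
        by (simp add: ennreal_mult ennreal_indicator)
    qed (use w in auto)
    moreover have "(\<lambda>b. exp (w * b) * indicator {0..} b) = (\<lambda>b. of_bool (0 \<le> b) * exp (w * b))"
      by (auto simp: indicator_def)
    ultimately show ?thesis by simp
  qed
  show ?thesis
  proof (cases "w < 0")
    case True
    then show ?thesis using neg[OF True] by simp
  next
    case False
    with assms have w: "w > 0" by simp
    have "has_bochner_integral lborel (\<lambda>b. of_bool (0 \<le> 0 + (-1) * b) * exp (- w * (0 + (-1) * b))) ((- 1 / - w) /\<^sub>R \<bar>-1\<bar>)"
    proof (rule lborel_has_bochner_integral_real_affine_iff[of "-1" "\<lambda>b. of_bool (0 \<le> b) * exp (- w * b)" _ 0, THEN iffD1])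
      show "has_bochner_integral lborel (\<lambda>b. of_bool (0 \<le> b) * exp (- w * b)) (- 1 / - w)"
        using w by (intro neg) simp
    qed simp
    then have "has_bochner_integral lborel (\<lambda>b. - (of_bool (b \<le> 0) * exp (w * b))) (- (1 / w))"
      by (intro has_bochner_integral_minus) simp
    moreover have "AE b in lborel. - (of_bool (b \<le> 0) * exp (w * b)) = (of_bool (0 \<le> b) - of_bool (w > 0)) * exp (w * b)"
      using AE_lborel_singleton[of 0] by eventually_elim (use w in auto)
    ultimately show ?thesis
      by (subst (asm) has_bochner_integral_cong_AE) auto
  qed
qed

text \<open>Both determinants are integers and their product is 1 up to sign. For edge vectors and
  normals this is the unimodularity of the vertex cones.\<close>

lemma abs_det_int_dual:
  fixes A B :: "real^'n^'n"
  assumes A: "\<And>k. int_vec (A $ k)" and B: "\<And>k. int_vec (B $ k)"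
    and dual: "\<And>k l. A $ k \<bullet> B $ l = (if k = l then - 1 else 0)"
  shows "\<bar>det A\<bar> = 1"
proof -
  have int: "det M \<in> \<int>" if "\<And>k. int_vec (M $ k)" for M :: "real^'n^'n"
    using that unfolding det_def int_vec_def by (intro Ints_sum Ints_mult Ints_prod) auto
  have "A ** transpose B = (\<chi> k. (-1) *s row k (mat 1))"
    using dual by (auto simp: vec_eq_iff matrix_matrix_mult_def transpose_def row_def mat_def inner_vec_def)
  then have "\<bar>det (A ** transpose B)\<bar> = 1"
    using det_rows_mul[of "\<lambda>_. -1" "\<lambda>k. row k (mat 1 :: real^'n^'n)"]
    by (simp add: row_def abs_prod power_abs)
  then have "\<bar>det A\<bar> * \<bar>det B\<bar> = 1" by (simp add: det_mul abs_mult)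
  moreover obtain a b where ab: "det A = of_int a" "det B = of_int b"
    using int[OF A] int[OF B] by (auto elim!: Ints_cases)
  ultimately have "real_of_int (\<bar>a\<bar> * \<bar>b\<bar>) = 1" by simp
  then have "\<bar>a\<bar> * \<bar>b\<bar> = 1" by linarith
  then have "\<bar>a\<bar> = 1" by (auto simp: zmult_eq_1_iff)
  then show ?thesis using ab by simp
qed

text \<open>Cramer's rule: multiples of the other rows do not change the determinant.\<close>

lemma abs_det_replace_row:
  fixes A :: "real^'n^'n"
  assumes "p = (\<Sum>k\<in>UNIV. c k *s A $ k)"
  shows "\<bar>det (\<chi> k. if k = k0 then p else A $ k)\<bar> = \<bar>c k0\<bar> * \<bar>det A\<bar>"
proof -
  let ?A = "(\<chi> k. if k = k0 then c k0 *s A $ k else A $ k) :: real^'n^'n"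
  let ?x = "\<Sum>k\<in>UNIV - {k0}. c k *s A $ k"
  have "?x \<in> vec.span {row j ?A |j. j \<noteq> k0}"
    by (intro vec.span_sum vec.span_scale vec.span_base) (auto simp: row_def vec_eq_iff)
  from det_row_span[OF this]
  have "det (\<chi> k. if k = k0 then row k0 ?A + ?x else row k ?A) = det ?A" .
  moreover have "(\<chi> k. if k = k0 then row k0 ?A + ?x else row k ?A) = (\<chi> k. if k = k0 then p else A $ k)"
    unfolding assms sum.remove[OF finite UNIV_I, of _ k0]
    by (auto simp: vec_eq_iff row_def)
  moreover have "det ?A = c k0 * det A"
    using det_row_mul[of k0 "c k0" "\<lambda>k. A $ k" "\<lambda>k. A $ k"] by simp
  ultimately show ?thesis by (simp add: abs_mult)
qed

section \<open>Lattice points on the boundary\<close>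

text \<open>For real series \<open>has_sum\<close> entails absolute summability, so a finite product
  of series may be expanded.\<close>

lemma has_sum_prod_PiE_real:
  fixes f :: "'a \<Rightarrow> 'b :: countable \<Rightarrow> real"
  assumes "finite A" and f: "\<And>x. x \<in> A \<Longrightarrow> (f x has_sum s x) (B x)"
  shows "((\<lambda>g. \<Prod>x\<in>A. f x (g x)) has_sum (\<Prod>x\<in>A. s x)) (PiE A B)"
proof -
  have abs: "Infinite_Sum.abs_summable_on (f x) (B x)" if "x \<in> A" for x
    using f[OF that] summable_on_iff_abs_summable_on_real[of "f x"] by (auto simp: summable_on_def)
  have "Infinite_Sum.abs_summable_on (\<lambda>g. \<Prod>x\<in>A. f x (g x)) (PiE A B)"
    unfolding abs_summable_equivalent
    using abs[unfolded abs_summable_equivalent]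
    by (intro abs_summable_on_prod_PiE[where f = f and B = B, OF assms(1) countableI_type])
  then have "(\<lambda>g. \<Prod>x\<in>A. f x (g x)) summable_on PiE A B"
    by (rule summable_on_iff_abs_summable_on_real[THEN iffD2])
  moreover have "infsum (\<lambda>g. \<Prod>x\<in>A. f x (g x)) (PiE A B) = (\<Prod>x\<in>A. infsum (f x) (B x))"
    by (rule infsum_prod_PiE_abs[OF assms(1) abs])
  moreover have "\<dots> = (\<Prod>x\<in>A. s x)" using f by (intro prod.cong) (auto intro: infsumI)
  ultimately show ?thesis using has_sum_infsum by metis
qed

lemma has_sum_finite_sum:
  fixes f :: "'i \<Rightarrow> 'a \<Rightarrow> real"
  assumes "\<And>i. i \<in> A \<Longrightarrow> (f i has_sum s i) X"
  shows "((\<lambda>x. \<Sum>i\<in>A. f i x) has_sum (\<Sum>i\<in>A. s i)) X"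
  using assms by (induction A rule: infinite_finite_induct) (auto intro: has_sum_add)

lemma has_sum_geometric_exp:
  assumes "w < (0::real)"
  shows "((\<lambda>n. exp (of_nat n * w)) has_sum (1 / (1 - exp w))) UNIV"
proof -
  have "(\<lambda>n. exp w ^ n) sums (1 / (1 - exp w))"
    using assms by (intro geometric_sums) simp
  then have "(\<lambda>n. exp (of_nat n * w)) sums (1 / (1 - exp w))"
    by (simp add: exp_of_nat_mult)
  then show ?thesis by (rule sums_nonneg_imp_has_sum) simp
qed

text \<open>The discrete counterpart of the half-line integral. The geometric series runs upward
  from \<open>\<theta>\<close> or, with a minus sign, downward from \<open>\<theta> - 1\<close>, and
  both have the same value as a rational function of \<open>exp w\<close>.\<close>

lemma has_sum_polar_exp:
  fixes \<theta> :: int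
  assumes "w \<noteq> (0::real)"
  shows "((\<lambda>a. (of_bool (\<theta> \<le> a) - of_bool (w > 0)) * exp (of_int a * w))
     has_sum (exp (of_int \<theta> * w) / (1 - exp w))) UNIV"
proof (cases "w < 0")
  case True
  have "((\<lambda>n. exp (of_int \<theta> * w) * exp (of_nat n * w)) has_sum (exp (of_int \<theta> * w) * (1 / (1 - exp w)))) UNIV"
    by (intro has_sum_cmult_right has_sum_geometric_exp True)
  then have "((\<lambda>n. exp (of_int (\<theta> + int n) * w)) has_sum (exp (of_int \<theta> * w) / (1 - exp w))) UNIV"
    by (simp add: exp_add algebra_simps)
  moreover have "bij_betw (\<lambda>n. \<theta> + int n) UNIV {\<theta>..}"
    by (rule bij_betwI[of _ _ _ "\<lambda>a. nat (a - \<theta>)"]) auto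
  ultimately have "((\<lambda>a. exp (of_int a * w)) has_sum (exp (of_int \<theta> * w) / (1 - exp w))) {\<theta>..}"
    using has_sum_reindex_bij_betw[of "\<lambda>n. \<theta> + int n" UNIV "{\<theta>..}" "\<lambda>a. exp (of_int a * w)"] by simp
  then show ?thesis
    by (rule has_sum_cong_neutral[THEN iffD1, rotated -1]) (use True in auto)
next
  case False
  with assms have w: "- w < 0" by simp
  have "((\<lambda>n. - exp (of_int (\<theta> - 1) * w) * exp (of_nat n * (- w))) has_sum
       (- exp (of_int (\<theta> - 1) * w) * (1 / (1 - exp (- w))))) UNIV"
    by (intro has_sum_cmult_right has_sum_geometric_exp w)
  moreover have "- exp (of_int (\<theta> - 1) * w) * exp (of_nat n * (- w)) = - exp (of_int (\<theta> - 1 - int n) * w)" for n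
    by (simp add: exp_add[symmetric] algebra_simps)
  moreover have "- exp (of_int (\<theta> - 1) * w) * (1 / (1 - exp (- w))) = exp (of_int \<theta> * w) / (1 - exp w)"
  proof -
    have "exp w \<noteq> 1" using assms by simp
    have "- exp (of_int (\<theta> - 1) * w) * (1 / (1 - exp (- w))) = - (exp (of_int \<theta> * w) / exp w) * (1 / (1 - 1 / exp w))"
      by (simp add: exp_diff exp_minus left_diff_distrib inverse_eq_divide)
    also have "\<dots> = exp (of_int \<theta> * w) / (1 - exp w)"
      using \<open>exp w \<noteq> 1\<close> by (simp add: divide_simps) (simp add: algebra_simps)
    finally show ?thesis .
  qed
  ultimately have "((\<lambda>n. - exp (of_int (\<theta> - 1 - int n) * w)) has_sum (exp (of_int \<theta> * w) / (1 - exp w))) UNIV"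
    by simp
  moreover have "bij_betw (\<lambda>n. \<theta> - 1 - int n) UNIV {..<\<theta>}"
    by (rule bij_betwI[of _ _ _ "\<lambda>a. nat (\<theta> - 1 - a)"]) auto
  ultimately have "((\<lambda>a. - exp (of_int a * w)) has_sum (exp (of_int \<theta> * w) / (1 - exp w))) {..<\<theta>}"
    using has_sum_reindex_bij_betw[of "\<lambda>n. \<theta> - 1 - int n" UNIV "{..<\<theta>}" "\<lambda>a. - exp (of_int a * w)"] by simp
  then show ?thesis
    by (rule has_sum_cong_neutral[THEN iffD1, rotated -1]) (use w in auto)
qed

lemma int_vec_inner: "int_vec a \<Longrightarrow> int_vec b \<Longrightarrow> a \<bullet> b \<in> \<int>"
  by (simp add: int_vec_def inner_vec_def Ints_sum)

lemma int_vec_sum_scale: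
  assumes "\<And>j. j \<in> I \<Longrightarrow> c j \<in> \<int>" "\<And>j. j \<in> I \<Longrightarrow> int_vec (u j)"
  shows "int_vec (\<Sum>j\<in>I. c j *\<^sub>R u j)"
  using assms by (auto simp: int_vec_def intro!: Ints_sum)

lemma int_vec_add: "int_vec a \<Longrightarrow> int_vec b \<Longrightarrow> int_vec (a + b)"
  by (simp add: int_vec_def)

lemma one_minus_exp_eq_inv_Ahat: "1 - exp (- y) = exp (- y / 2) * (y * inv_Ahat y)"
proof (cases "y = 0")
  case False
  have "exp (- y / 2) * exp (y / 2) = 1" "exp (- y / 2) * exp (- y / 2) = exp (- y)"
    by (simp_all flip: exp_add)
  then show ?thesis using False by (simp add: inv_Ahat_def sinh_def field_simps)
qed simp

text \<open>Integrality of both dual families says that the edge vectors at each vertex form a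
  lattice basis.\<close>

locale delzant_system = simple_system d N V U
  for d :: nat and N :: "nat \<Rightarrow> real^'n" and V :: "nat set set"
    and U :: "nat set \<Rightarrow> nat \<Rightarrow> real^'n" +
  assumes N_int: "i < d \<Longrightarrow> int_vec (N i)"
    and U_int: "I \<in> V \<Longrightarrow> j \<in> I \<Longrightarrow> int_vec (U I j)"
    and V_nonempty: "V \<noteq> {}"
    and facet_vertex: "i < d \<Longrightarrow> \<exists>I\<in>V. i \<in> I"
begin

text \<open>The inverse reads off the slacks, which are integers at lattice points because
  \<open>lam\<close> and the normals are integral.\<close>

lemma lattice_points_bij:
  assumes I: "I \<in> V" and lam: "\<And>i. i < d \<Longrightarrow> lam i \<in> \<int>"
  shows "bij_betw (\<lambda>a. vtx I lam + (\<Sum>j\<in>I. of_int (a j) *\<^sub>R U I j)) (PiE I (\<lambda>_. UNIV)) {z. int_vec z}"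
proof (rule bij_betwI[where g = "\<lambda>z. restrict (\<lambda>j. \<lfloor>lam j - N j \<bullet> z\<rfloor>) I"])
  have sub: "j < d" if "j \<in> I" for j using V_subset[OF I] that by auto
  show "(\<lambda>a. vtx I lam + (\<Sum>j\<in>I. of_int (a j) *\<^sub>R U I j)) \<in> PiE I (\<lambda>_. UNIV) \<rightarrow> {z. int_vec z}"
  proof -
    have "int_vec (vtx I lam)"
      unfolding vtx_def by (rule int_vec_sum_scale) (use sub lam I U_int in auto)
    then show ?thesis using I by (auto intro!: int_vec_add int_vec_sum_scale U_int)
  qed
  show "(\<lambda>z. restrict (\<lambda>j. \<lfloor>lam j - N j \<bullet> z\<rfloor>) I) \<in> {z. int_vec z} \<rightarrow> PiE I (\<lambda>_. UNIV)" by auto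
  fix a assume a: "a \<in> PiE I (\<lambda>_. UNIV :: int set)"
  show "restrict (\<lambda>j. \<lfloor>lam j - N j \<bullet> (vtx I lam + (\<Sum>j\<in>I. of_int (a j) *\<^sub>R U I j))\<rfloor>) I = a"
  proof
    fix j show "restrict (\<lambda>j. \<lfloor>lam j - N j \<bullet> (vtx I lam + (\<Sum>j\<in>I. of_int (a j) *\<^sub>R U I j))\<rfloor>) I j = a j"
      using a I by (cases "j \<in> I") (auto simp: inner_add_right inner_vtx inner_sum_U PiE_arb[OF a])
  qed
next
  fix z :: "real^'n" assume "z \<in> {z. int_vec z}"
  then have "lam j - N j \<bullet> z \<in> \<int>" if "j \<in> I" for j
    using that V_subset[OF I] lam by (auto intro!: Ints_diff int_vec_inner N_int)
  then have "of_int \<lfloor>lam j - N j \<bullet> z\<rfloor> = lam j - N j \<bullet> z" if "j \<in> I" for j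
    using that by (metis Ints_cases floor_of_int)
  then have "(\<Sum>j\<in>I. of_int (restrict (\<lambda>j. \<lfloor>lam j - N j \<bullet> z\<rfloor>) I j) *\<^sub>R U I j)
     = (\<Sum>j\<in>I. (lam j - N j \<bullet> z) *\<^sub>R U I j)" by (intro sum.cong) auto
  then show "vtx I lam + (\<Sum>j\<in>I. of_int (restrict (\<lambda>j. \<lfloor>lam j - N j \<bullet> z\<rfloor>) I j) *\<^sub>R U I j) = z"
    using expansion[OF I, of z lam] by simp
qed

lemma has_sum_polar_cone:
  assumes I: "I \<in> V" and gen: "generic \<xi>" and lam: "\<And>i. i < d \<Longrightarrow> lam i \<in> \<int>"
  shows "((\<lambda>z. (\<Prod>j\<in>I. (of_bool (of_int \<theta> \<le> lam j - N j \<bullet> z) - of_bool (\<xi> \<bullet> U I j > 0))) * exp (\<xi> \<bullet> z))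
    has_sum (exp (\<xi> \<bullet> vtx I lam) * (\<Prod>j\<in>I. exp (of_int \<theta> * (\<xi> \<bullet> U I j)) / (1 - exp (\<xi> \<bullet> U I j))))) {z. int_vec z}"
proof -
  let ?g = "\<lambda>a. vtx I lam + (\<Sum>j\<in>I. of_int (a j) *\<^sub>R U I j)"
  let ?f = "\<lambda>z. (\<Prod>j\<in>I. (of_bool (of_int \<theta> \<le> lam j - N j \<bullet> z) - of_bool (\<xi> \<bullet> U I j > 0))) * exp (\<xi> \<bullet> z)"
  have "((\<lambda>a. exp (\<xi> \<bullet> vtx I lam) * (\<Prod>j\<in>I. (of_bool (\<theta> \<le> a j) - of_bool (\<xi> \<bullet> U I j > 0)) * exp (of_int (a j) * (\<xi> \<bullet> U I j))))
     has_sum (exp (\<xi> \<bullet> vtx I lam) * (\<Prod>j\<in>I. exp (of_int \<theta> * (\<xi> \<bullet> U I j)) / (1 - exp (\<xi> \<bullet> U I j))))) (PiE I (\<lambda>_. UNIV))"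
    using gen I by (intro has_sum_cmult_right has_sum_prod_PiE_real has_sum_polar_exp finite_I) (auto simp: generic_def)
  moreover have "exp (\<xi> \<bullet> vtx I lam) * (\<Prod>j\<in>I. (of_bool (\<theta> \<le> a j) - of_bool (\<xi> \<bullet> U I j > 0)) * exp (of_int (a j) * (\<xi> \<bullet> U I j))) = ?f (?g a)" for a
  proof -
    have 1: "\<xi> \<bullet> ?g a = \<xi> \<bullet> vtx I lam + (\<Sum>j\<in>I. of_int (a j) * (\<xi> \<bullet> U I j))"
      by (simp add: inner_add_right inner_sum_right)
    have 2: "lam j - N j \<bullet> ?g a = of_int (a j)" if "j \<in> I" for j
      using that I by (simp add: inner_add_right inner_vtx inner_sum_U)
    show ?thesis
      unfolding 1 exp_add exp_sum[OF finite_I[OF I]] prod.distrib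
      by (simp add: 2 cong: prod.cong_simp)
  qed
  ultimately have "((\<lambda>a. ?f (?g a)) has_sum (exp (\<xi> \<bullet> vtx I lam) * (\<Prod>j\<in>I. exp (of_int \<theta> * (\<xi> \<bullet> U I j)) / (1 - exp (\<xi> \<bullet> U I j))))) (PiE I (\<lambda>_. UNIV))"
    by simp
  then show ?thesis
    using has_sum_reindex_bij_betw[where f = ?f, OF lattice_points_bij[OF I lam]] by simp
qed

text \<open>
  With \<open>lam\<close> integral, \<open>lam' = lam\<close> gives the threshold \<open>\<theta> = 0\<close> and all lattice points of the polytope,
  while \<open>lam' = lam - \<delta>\<close> with \<open>0 < \<delta> < 1\<close> gives \<open>\<theta> = 1\<close> and those in the interior.
\<close>
lemma has_sum_exp_poly:
  assumes gen: "generic \<xi>" and lam: "\<And>i. i < d \<Longrightarrow> lam i \<in> \<int>" and lam': "nondeg lam'"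
    and thr: "\<And>i (a :: int). i < d \<Longrightarrow> 0 \<le> of_int a + (lam' i - lam i) \<longleftrightarrow> \<theta> \<le> a"
  shows "((\<lambda>z. of_bool (z \<in> poly_of d N lam') * exp (\<xi> \<bullet> z))
    has_sum (\<Sum>I\<in>V. exp (\<xi> \<bullet> vtx I lam) * (\<Prod>j\<in>I. exp (of_int \<theta> * (\<xi> \<bullet> U I j)) / (1 - exp (\<xi> \<bullet> U I j))))) {z. int_vec z}"
proof -
  let ?t = "\<lambda>I z. (\<Prod>j\<in>I. (of_bool (of_int \<theta> \<le> lam j - N j \<bullet> z) - of_bool (\<xi> \<bullet> U I j > 0))) * exp (\<xi> \<bullet> z)"
  have "((\<lambda>z. \<Sum>I\<in>V. ?t I z) has_sum (\<Sum>I\<in>V. exp (\<xi> \<bullet> vtx I lam) * (\<Prod>j\<in>I. exp (of_int \<theta> * (\<xi> \<bullet> U I j)) / (1 - exp (\<xi> \<bullet> U I j))))) {z. int_vec z}"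
    by (rule has_sum_finite_sum) (auto intro: has_sum_polar_cone gen lam)
  moreover have "(\<Sum>I\<in>V. ?t I z) = of_bool (z \<in> poly_of d N lam') * exp (\<xi> \<bullet> z)" if z: "int_vec z" for z
  proof -
    \<comment> \<open>Slacks of lattice points with respect to \<open>lam\<close> are integers, and
      \<open>thr\<close> translates the thresholds exactly for these.\<close>
    have "(of_int \<theta> \<le> lam j - N j \<bullet> z) = (0 \<le> lam' j - N j \<bullet> z)" if "j < d" for j
    proof -
      have "lam j - N j \<bullet> z \<in> \<int>" using that z lam N_int int_vec_inner by (intro Ints_diff) auto
      then obtain a where a: "lam j - N j \<bullet> z = of_int a" by (rule Ints_cases)
      then show ?thesis using thr[OF that, of a] by auto
    qed
    then have "(\<Prod>j\<in>I. (of_bool (of_int \<theta> \<le> lam j - N j \<bullet> z) - of_bool (\<xi> \<bullet> U I j > 0)))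
       = (\<Prod>j\<in>I - {}. (of_bool (0 \<le> lam' j - N j \<bullet> z) - of_bool (\<xi> \<bullet> U I j > 0)) :: real)" if "I \<in> V" for I
      using V_subset[OF that] by (intro prod.cong) auto
    then have "(\<Sum>I\<in>V. ?t I z) = (\<Sum>I\<in>{I\<in>V. {} \<subseteq> I}. \<Prod>j\<in>I - {}. (of_bool (0 \<le> lam' j - N j \<bullet> z) - of_bool (\<xi> \<bullet> U I j > 0))) * exp (\<xi> \<bullet> z)"
      by (simp add: sum_distrib_right)
    also have "(\<Sum>I\<in>{I\<in>V. {} \<subseteq> I}. \<Prod>j\<in>I - {}. (of_bool (0 \<le> lam' j - N j \<bullet> z) - of_bool (\<xi> \<bullet> U I j > 0)))
       = (of_bool (z \<in> poly_of d N lam') :: real)"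
      by (rule polar_decomposition[OF lam' gen]) (use V_nonempty in auto)
    finally show ?thesis .
  qed
  ultimately show ?thesis by (subst has_sum_cong) auto
qed

text \<open>The coefficients of \<open>\<xi> \<bullet> vtx I lam\<close> as a linear form in all
  \<open>d\<close> variables. Facets off the vertex get 0, and their factors in products over
  \<open>i < d\<close> are \<open>Ahat 0 = 1\<close>.\<close>

definition weight :: "real^'n \<Rightarrow> nat set \<Rightarrow> nat \<Rightarrow> real" where
  "weight \<xi> I i = (if i \<in> I then - (\<xi> \<bullet> U I i) else 0)"

lemma sum_weight:
  assumes I: "I \<in> V" shows "(\<Sum>i<d. weight \<xi> I i) = (\<Sum>i\<in>I. - (\<xi> \<bullet> U I i))"
  by (rule sum.mono_neutral_cong_right) (use V_subset[OF I] in \<open>auto simp: weight_def\<close>)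

lemma lin_form_weight:
  assumes I: "I \<in> V" shows "lin_form d (weight \<xi> I) lam = \<xi> \<bullet> vtx I lam"
proof -
  have "lin_form d (weight \<xi> I) lam = (\<Sum>i\<in>I. - (\<xi> \<bullet> U I i) * lam i)"
    unfolding lin_form_def
    by (rule sum.mono_neutral_cong_right) (use V_subset[OF I] in \<open>auto simp: weight_def\<close>)
  then show ?thesis by (simp add: vtx_def inner_sum_right mult.commute)
qed

text \<open>The rational factor of a vertex in the boundary volume. It is homogeneous of degree 1 -
  n in \<open>\<xi>\<close>, which fixes the coefficient to be extracted.\<close>

definition amplitude :: "real^'n \<Rightarrow> nat set \<Rightarrow> real" where
  "amplitude \<xi> I = (\<Sum>i<d. weight \<xi> I i) / (\<Prod>i\<in>I. weight \<xi> I i)"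

lemma weight_scale: "weight (t *\<^sub>R \<xi>) I i = t * weight \<xi> I i"
  by (simp add: weight_def)

lemma amplitude_scale:
  assumes "I \<in> V" "t \<noteq> 0"
  shows "amplitude (t *\<^sub>R \<xi>) I = amplitude \<xi> I / t ^ (CARD('n) - 1)"
proof -
  have "amplitude (t *\<^sub>R \<xi>) I = t * (\<Sum>i<d. weight \<xi> I i) / (t ^ CARD('n) * (\<Prod>i\<in>I. weight \<xi> I i))"
    using assms by (simp add: amplitude_def weight_scale prod.distrib V_card sum_distrib_left)
  moreover have "t ^ CARD('n) = t * t ^ (CARD('n) - 1)" by (simp flip: power_Suc)
  ultimately show ?thesis using assms by (simp add: amplitude_def)
qed

text \<open>The products for the polytope and for its interior share their denominator, and the
  numerators differ by \<open>1 - exp (- Y)\<close>, where Y is the sum of the weights. When every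
  \<open>1 - exp (- y)\<close> is written as \<open>exp (- y / 2) * (y * inv_Ahat y)\<close>, the
  half exponentials of the denominator multiply to that of the numerator and cancel. This is why
  even functions appear rather than one-sided Todd functions.\<close>

lemma vertex_contribution:
  assumes I: "I \<in> V" and gen: "generic \<xi>"
  shows "(\<Prod>j\<in>I. 1 / (1 - exp (\<xi> \<bullet> U I j))) - (\<Prod>j\<in>I. exp (\<xi> \<bullet> U I j) / (1 - exp (\<xi> \<bullet> U I j)))
    = amplitude \<xi> I * (\<Prod>i<d. Ahat (weight \<xi> I i)) * inv_Ahat (\<Sum>i<d. weight \<xi> I i)"
proof -
  let ?y = "weight \<xi> I"
  have y: "\<xi> \<bullet> U I j = - ?y j" if "j \<in> I" for j using that by (simp add: weight_def)
  have Y: "(\<Sum>i<d. ?y i) = (\<Sum>i\<in>I. ?y i)" unfolding sum_weight[OF I] by (simp add: weight_def)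
  have fin: "finite I" by (rule finite_I[OF I])
  have "(\<Prod>j\<in>I. 1 / (1 - exp (\<xi> \<bullet> U I j))) - (\<Prod>j\<in>I. exp (\<xi> \<bullet> U I j) / (1 - exp (\<xi> \<bullet> U I j)))
     = (\<Prod>j\<in>I. 1 / (1 - exp (- ?y j))) - (\<Prod>j\<in>I. exp (- ?y j) / (1 - exp (- ?y j)))"
    by (simp add: y cong: prod.cong_simp)
  also have "\<dots> = (1 - exp (- (\<Sum>i\<in>I. ?y i))) / (\<Prod>j\<in>I. 1 - exp (- ?y j))"
    by (simp add: prod_dividef exp_sum[OF fin] diff_divide_distrib flip: sum_negf)
  also have "\<dots> = exp (- (\<Sum>i\<in>I. ?y i) / 2) * ((\<Sum>i\<in>I. ?y i) * inv_Ahat (\<Sum>i\<in>I. ?y i))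
      / (exp (- (\<Sum>i\<in>I. ?y i) / 2) * ((\<Prod>i\<in>I. ?y i) * (\<Prod>i\<in>I. inv_Ahat (?y i))))"
  proof -
    have "(\<Prod>j\<in>I. exp (- ?y j / 2)) = exp (- (\<Sum>i\<in>I. ?y i) / 2)"
      unfolding exp_sum[OF fin, symmetric] by (simp add: sum_divide_distrib sum_negf)
    then show ?thesis unfolding one_minus_exp_eq_inv_Ahat by (simp only: prod.distrib)
  qed
  also have "\<dots> = (\<Sum>i\<in>I. ?y i) / (\<Prod>i\<in>I. ?y i) * (\<Prod>i\<in>I. Ahat (?y i)) * inv_Ahat (\<Sum>i\<in>I. ?y i)"
    unfolding Ahat_eq_inverse prod_inversef[of "\<lambda>i. inv_Ahat (?y i)", unfolded o_def]
    by (simp add: divide_simps)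
  also have "(\<Prod>i\<in>I. Ahat (?y i)) = (\<Prod>i<d. Ahat (?y i))"
    by (rule prod.mono_neutral_left) (use V_subset[OF I] in \<open>auto simp: weight_def Ahat_def\<close>)
  finally show ?thesis by (simp add: amplitude_def Y)
qed

lemma boundary_exp_sum:
  assumes gen: "generic \<xi>" and lam: "\<And>i. i < d \<Longrightarrow> lam i \<in> \<int>" "nondeg lam"
    and \<delta>: "0 < \<delta>" "\<delta> < 1" "nondeg (\<lambda>i. lam i - \<delta>)"
    and B: "B = {z. int_vec z \<and> z \<in> poly_of d N lam \<and> z \<notin> poly_of d N (\<lambda>i. lam i - \<delta>)}" "finite B"
  shows "(\<Sum>z\<in>B. exp (\<xi> \<bullet> z)) = (\<Sum>I\<in>V. amplitude \<xi> I * exp (lin_form d (weight \<xi> I) lam) *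
     (\<Prod>i<d. Ahat (weight \<xi> I i)) * inv_Ahat (\<Sum>i<d. weight \<xi> I i))"
proof -
  have 1: "((\<lambda>z. of_bool (z \<in> poly_of d N lam) * exp (\<xi> \<bullet> z))
    has_sum (\<Sum>I\<in>V. exp (\<xi> \<bullet> vtx I lam) * (\<Prod>j\<in>I. exp (of_int 0 * (\<xi> \<bullet> U I j)) / (1 - exp (\<xi> \<bullet> U I j))))) {z. int_vec z}"
    by (rule has_sum_exp_poly[OF gen lam]) auto
  have 2: "((\<lambda>z. of_bool (z \<in> poly_of d N (\<lambda>i. lam i - \<delta>)) * exp (\<xi> \<bullet> z))
    has_sum (\<Sum>I\<in>V. exp (\<xi> \<bullet> vtx I lam) * (\<Prod>j\<in>I. exp (of_int 1 * (\<xi> \<bullet> U I j)) / (1 - exp (\<xi> \<bullet> U I j))))) {z. int_vec z}"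
  proof (rule has_sum_exp_poly[OF gen lam(1) \<delta>(3)])
    fix a :: int
    show "0 \<le> real_of_int a + (lam i - \<delta> - lam i) \<longleftrightarrow> 1 \<le> a" for i
    proof (cases "1 \<le> a")
      case True
      then have "1 \<le> real_of_int a" by simp
      then show ?thesis using True \<delta> by simp
    next
      case False
      then have "real_of_int a \<le> 0" by simp
      then show ?thesis using False \<delta> by simp
    qed
  qed
  have "poly_of d N (\<lambda>i. lam i - \<delta>) \<subseteq> poly_of d N lam" using \<delta>(1) by (force simp: poly_of_def)
  then have ind: "of_bool (z \<in> poly_of d N lam) * exp (\<xi> \<bullet> z) - of_bool (z \<in> poly_of d N (\<lambda>i. lam i - \<delta>)) * exp (\<xi> \<bullet> z)
     = (if z \<in> B then exp (\<xi> \<bullet> z) else 0)" if "int_vec z" for z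
    using that unfolding B(1) by auto
  let ?S = "(\<Sum>I\<in>V. exp (\<xi> \<bullet> vtx I lam) * (\<Prod>j\<in>I. exp (of_int 0 * (\<xi> \<bullet> U I j)) / (1 - exp (\<xi> \<bullet> U I j))))
     - (\<Sum>I\<in>V. exp (\<xi> \<bullet> vtx I lam) * (\<Prod>j\<in>I. exp (of_int 1 * (\<xi> \<bullet> U I j)) / (1 - exp (\<xi> \<bullet> U I j))))"
  have "((\<lambda>z. if z \<in> B then exp (\<xi> \<bullet> z) else 0) has_sum ?S) {z. int_vec z}"
    using has_sum_add[OF 1 has_sum_uminusI[OF 2]]
    by (subst has_sum_cong[OF ind[symmetric]]) auto
  then have "((\<lambda>z. exp (\<xi> \<bullet> z)) has_sum ?S) B"
    by (rule has_sum_cong_neutral[THEN iffD1, rotated -1]) (auto simp: B(1))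
  then have "(\<Sum>z\<in>B. exp (\<xi> \<bullet> z)) = ?S"
    by (rule has_sum_unique[OF has_sum_finite[OF B(2)]])
  also have "\<dots> = (\<Sum>I\<in>V. exp (\<xi> \<bullet> vtx I lam) * ((\<Prod>j\<in>I. 1 / (1 - exp (\<xi> \<bullet> U I j))) - (\<Prod>j\<in>I. exp (\<xi> \<bullet> U I j) / (1 - exp (\<xi> \<bullet> U I j)))))"
    by (simp add: sum_subtractf right_diff_distrib)
  also have "\<dots> = (\<Sum>I\<in>V. amplitude \<xi> I * exp (lin_form d (weight \<xi> I) lam) *
     (\<Prod>i<d. Ahat (weight \<xi> I i)) * inv_Ahat (\<Sum>i<d. weight \<xi> I i))"
    by (rule sum.cong) (simp_all add: vertex_contribution[OF _ gen] lin_form_weight mult_ac)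
  finally show ?thesis .
qed

lemma generic_scale: "generic \<xi> \<Longrightarrow> t \<noteq> 0 \<Longrightarrow> generic (t *\<^sub>R \<xi>)"
  by (simp add: generic_def)

text \<open>Replace \<open>\<xi>\<close> by \<open>t *\<^sub>R \<xi>\<close> and let t tend to 0.
  The exponential sum over the finite set \<open>B\<close> tends to its cardinality, while
  homogeneity of \<open>amplitude\<close> turns the vertex sum into an analytic function divided by
  \<open>t ^ (n - 1)\<close>.\<close>

theorem boundary_lattice_points:
  assumes gen: "generic \<xi>" and lam: "\<And>i. i < d \<Longrightarrow> lam i \<in> \<int>" "nondeg lam"
    and \<delta>: "0 < \<delta>" "\<delta> < 1" "nondeg (\<lambda>i. lam i - \<delta>)"
    and B: "B = {z. int_vec z \<and> z \<in> poly_of d N lam \<and> z \<notin> poly_of d N (\<lambda>i. lam i - \<delta>)}" "finite B"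
  shows "real (card B) = (\<Sum>I\<in>V. amplitude \<xi> I *
     fps_nth (fps_exp (lin_form d (weight \<xi> I) lam) *
       (\<Prod>i<d. fps_compose fps_Ahat (fps_const (weight \<xi> I i) * fps_X)) *
       fps_compose fps_inv_Ahat (fps_const (\<Sum>i<d. weight \<xi> I i) * fps_X)) (CARD('n) - 1))"
proof -
  let ?n = "CARD('n) - 1"
  define G where "G I = fps_exp (lin_form d (weight \<xi> I) lam) *
       (\<Prod>i<d. fps_compose fps_Ahat (fps_const (weight \<xi> I i) * fps_X)) *
       fps_compose fps_inv_Ahat (fps_const (\<Sum>i<d. weight \<xi> I i) * fps_X)" for I
  define g where "g I t = exp (lin_form d (weight \<xi> I) lam * t) *
       (\<Prod>i<d. Ahat (weight \<xi> I i * t)) * inv_Ahat ((\<Sum>i<d. weight \<xi> I i) * t)" for I t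
  have "g I has_fps_expansion G I" for I
    unfolding g_def[abs_def] G_def
    by (intro has_fps_expansion_mult has_fps_expansion_prod has_fps_expansion_scale
        has_fps_expansion_exp Ahat_expansion inv_Ahat_expansion)
  then have "(\<lambda>t. \<Sum>I\<in>V. amplitude \<xi> I * g I t) has_fps_expansion (\<Sum>I\<in>V. fps_const (amplitude \<xi> I) * G I)"
    by (intro has_fps_expansion_sum has_fps_expansion_cmult_left)
  moreover have "((\<lambda>t. (\<Sum>I\<in>V. amplitude \<xi> I * g I t) / t ^ ?n) \<longlongrightarrow> real (card B)) (at 0)"
  proof (rule Lim_transform_eventually)
    have "((\<lambda>t. \<Sum>z\<in>B. exp (t * (\<xi> \<bullet> z))) \<longlongrightarrow> (\<Sum>z\<in>B. exp (0 * (\<xi> \<bullet> z)))) (at 0)"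
      by (intro tendsto_intros)
    then show "((\<lambda>t. \<Sum>z\<in>B. exp (t * (\<xi> \<bullet> z))) \<longlongrightarrow> real (card B)) (at 0)" by simp
    have "(\<Sum>z\<in>B. exp (t * (\<xi> \<bullet> z))) = (\<Sum>I\<in>V. amplitude \<xi> I * g I t) / t ^ ?n" if t: "t \<noteq> 0" for t
    proof -
      have "(\<Sum>z\<in>B. exp (t * (\<xi> \<bullet> z))) = (\<Sum>z\<in>B. exp ((t *\<^sub>R \<xi>) \<bullet> z))" by simp
      also have "\<dots> = (\<Sum>I\<in>V. amplitude (t *\<^sub>R \<xi>) I * exp (lin_form d (weight (t *\<^sub>R \<xi>) I) lam) *
         (\<Prod>i<d. Ahat (weight (t *\<^sub>R \<xi>) I i)) * inv_Ahat (\<Sum>i<d. weight (t *\<^sub>R \<xi>) I i))"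
        by (rule boundary_exp_sum[OF generic_scale[OF gen t] lam \<delta> B])
      also have "\<dots> = (\<Sum>I\<in>V. amplitude \<xi> I * g I t / t ^ ?n)"
      proof (rule sum.cong)
        fix I assume I: "I \<in> V"
        have "lin_form d (weight (t *\<^sub>R \<xi>) I) lam = lin_form d (weight \<xi> I) lam * t"
          by (simp add: lin_form_weight[OF I])
        moreover have "(\<Sum>i<d. weight (t *\<^sub>R \<xi>) I i) = (\<Sum>i<d. weight \<xi> I i) * t"
          by (simp add: weight_scale sum_distrib_left sum_distrib_right mult.commute)
        ultimately show "amplitude (t *\<^sub>R \<xi>) I * exp (lin_form d (weight (t *\<^sub>R \<xi>) I) lam) *
         (\<Prod>i<d. Ahat (weight (t *\<^sub>R \<xi>) I i)) * inv_Ahat (\<Sum>i<d. weight (t *\<^sub>R \<xi>) I i) = amplitude \<xi> I * g I t / t ^ ?n"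
          by (simp add: amplitude_scale[OF I t] g_def weight_scale mult.commute[of t])
      qed simp
      finally show ?thesis by (simp add: sum_divide_distrib)
    qed
    then show "\<forall>\<^sub>F t in at 0. (\<Sum>z\<in>B. exp (t * (\<xi> \<bullet> z))) = (\<Sum>I\<in>V. amplitude \<xi> I * g I t) / t ^ ?n"
      by (simp add: eventually_at_filter)
  qed
  ultimately have "fps_nth (\<Sum>I\<in>V. fps_const (amplitude \<xi> I) * G I) ?n = real (card B)"
    by (rule fps_nth_eq_limit)
  then show ?thesis by (simp add: fps_sum_nth G_def)
qed

end

section \<open>Volume of the boundary\<close>

context delzant_system
begin

lemma N_nonzero: "i < d \<Longrightarrow> N i \<noteq> 0"
  using facet_vertex dual by fastforce

text \<open>The signed distance from the i-th facet hyperplane. With the orthogonal projection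
  \<open>foot\<close> it describes the unit prism over the facet, whose Lebesgue measure is
  \<open>hvol\<close>.\<close>

definition height :: "nat \<Rightarrow> (nat \<Rightarrow> real) \<Rightarrow> real^'n \<Rightarrow> real" where
  "height i lam x = (N i \<bullet> x - lam i) / norm (N i)"

definition foot :: "nat \<Rightarrow> (nat \<Rightarrow> real) \<Rightarrow> real^'n \<Rightarrow> real^'n" where
  "foot i lam x = x - height i lam x *\<^sub>R (N i /\<^sub>R norm (N i))"

lemma inner_unit_normal: "i < d \<Longrightarrow> N i \<bullet> (N i /\<^sub>R norm (N i)) = norm (N i)"
  using N_nonzero by (simp add: dot_square_norm power2_eq_square)

lemma inner_foot:
  assumes "i < d" shows "N i \<bullet> foot i lam x = lam i"
  unfolding foot_def height_def inner_diff_right inner_scaleR_right[of _ "_ / _"] inner_unit_normal[OF assms]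
  using N_nonzero[OF assms] by simp

definition prism :: "nat \<Rightarrow> (nat \<Rightarrow> real) \<Rightarrow> (real^'n) set" where
  "prism i lam = {x. 0 \<le> height i lam x \<and> height i lam x \<le> 1 \<and> foot i lam x \<in> poly_of d N lam}"

lemma hvol_facet:
  assumes i: "i < d"
  shows "hvol (poly_of d N lam \<inter> {x. x \<bullet> N i = lam i}) (N i) = measure lebesgue (prism i lam)"
proof -
  have "{x + t *\<^sub>R (N i /\<^sub>R norm (N i)) |x t. x \<in> poly_of d N lam \<inter> {x. x \<bullet> N i = lam i} \<and> t \<in> {0..1}} = prism i lam"
  proof safe
    fix x and t :: real assume x: "x \<in> poly_of d N lam" "x \<bullet> N i = lam i" and t: "t \<in> {0..1}"
    have "height i lam (x + t *\<^sub>R (N i /\<^sub>R norm (N i))) = t"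
      unfolding height_def inner_add_right inner_scaleR_right[of _ t] inner_unit_normal[OF i]
      using x N_nonzero[OF i] by (simp add: inner_commute)
    then show "x + t *\<^sub>R (N i /\<^sub>R norm (N i)) \<in> prism i lam"
      using x t by (simp add: prism_def foot_def)
  next
    fix x assume x: "x \<in> prism i lam"
    show "\<exists>y t. x = y + t *\<^sub>R (N i /\<^sub>R norm (N i)) \<and> y \<in> poly_of d N lam \<inter> {x. x \<bullet> N i = lam i} \<and> t \<in> {0..1}"
    proof (intro exI conjI)
      show "x = foot i lam x + height i lam x *\<^sub>R (N i /\<^sub>R norm (N i))" by (simp add: foot_def)
      show "foot i lam x \<in> poly_of d N lam \<inter> {x. x \<bullet> N i = lam i}"
        using x inner_foot[OF i] by (simp add: prism_def inner_commute)
    qed (use x in \<open>simp add: prism_def\<close>)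
  qed
  then show ?thesis by (simp add: hvol_def)
qed

lemma continuous_height: "continuous_on UNIV (height i lam)"
  unfolding height_def[abs_def] divide_inverse by (intro continuous_intros)

lemma continuous_foot: "continuous_on UNIV (foot i lam)"
  unfolding foot_def[abs_def] by (intro continuous_intros continuous_height)

lemma borel_measurable_height [measurable]: "height i lam \<in> borel_measurable borel"
  by (rule borel_measurable_continuous_onI[OF continuous_height])

lemma borel_measurable_foot [measurable]: "foot i lam \<in> borel_measurable borel"
  by (rule borel_measurable_continuous_onI[OF continuous_foot])

lemma poly_of_borel [measurable]: "poly_of d N lam \<in> sets borel"
proof -
  have "closed (poly_of d N lam)"
    unfolding poly_of_def using closed_halfspace_le[of "N _"] by (intro closed_INT) (simp add: inner_commute)
  then show ?thesis by simp
qed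

lemma prism_borel [measurable]: "prism i lam \<in> sets borel"
  unfolding prism_def by measurable

text \<open>The exponent sees only \<open>foot\<close>, so the height contributes just the length 1
  of its interval, and an integral over the prism is an integral over the facet.\<close>

definition prism_term :: "real^'n \<Rightarrow> nat \<Rightarrow> (nat \<Rightarrow> real) \<Rightarrow> nat set \<Rightarrow> real^'n \<Rightarrow> real" where
  "prism_term \<xi> i lam I x = of_bool (0 \<le> height i lam x \<and> height i lam x \<le> 1) *
     (\<Prod>j\<in>I - {i}. of_bool (0 \<le> lam j - N j \<bullet> foot i lam x) - of_bool (\<xi> \<bullet> U I j > 0)) *
     exp (\<xi> \<bullet> foot i lam x)"

lemma prism_term_borel [measurable]: "prism_term \<xi> i lam I \<in> borel_measurable borel"
  unfolding prism_term_def[abs_def] of_bool_def by measurable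

lemma prism_term_sum:
  assumes gen: "generic \<xi>" and lam: "nondeg lam" and i: "i < d"
  shows "(\<Sum>I\<in>{I\<in>V. i \<in> I}. prism_term \<xi> i lam I x) = indicator (prism i lam) x * exp (\<xi> \<bullet> foot i lam x)"
proof -
  have "(\<Sum>I\<in>{I\<in>V. {i} \<subseteq> I}. \<Prod>j\<in>I - {i}. (of_bool (0 \<le> lam j - N j \<bullet> foot i lam x) - of_bool (\<xi> \<bullet> U I j > 0)))
       = (of_bool (foot i lam x \<in> poly_of d N lam) :: real)"
    by (rule polar_decomposition[OF lam gen]) (use facet_vertex[OF i] inner_foot[OF i] in auto)
  then show ?thesis
    unfolding prism_term_def sum_distrib_left[symmetric] sum_distrib_right[symmetric]
    by (simp add: prism_def indicator_def)
qed

text \<open>Coordinates adapted to the prism: the edge vectors at \<open>I\<close>, with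
  \<open>U I i\<close> replaced by the unit normal of facet \<open>i\<close>. Edge vectors have
  determinant of modulus 1, so by Cramer's rule the Jacobian is, up to sign, the
  \<open>U I i\<close>-component of the unit normal, that is \<open>norm (N i)\<close>. It cancels
  against the division by this length in \<open>vol_boundary\<close>.\<close>

lemma prism_term_integral:
  assumes gen: "generic \<xi>" and I: "I \<in> V" and i: "i \<in> I"
  shows "integrable lborel (prism_term \<xi> i lam I)"
    and "integral\<^sup>L lborel (prism_term \<xi> i lam I) =
      norm (N i) * (exp (\<xi> \<bullet> vtx I lam) * (\<Prod>j\<in>I - {i}. 1 / weight \<xi> I j))"
proof -
  have fin: "finite I" by (rule finite_I[OF I])
  have id: "i < d" using V_subset I i by auto
  define e where "e = N i /\<^sub>R norm (N i)"
  \<comment> \<open>\<open>\<sigma>\<close> labels the facets at the vertex by coordinates, so that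
    the edge vectors become the rows of a square matrix.\<close>
  obtain \<sigma> :: "'n \<Rightarrow> nat" where \<sigma>: "bij_betw \<sigma> UNIV I"
    using finite_same_card_bij[OF finite_class.finite_UNIV fin] V_card[OF I] by auto
  then have \<sigma>I: "\<sigma> k \<in> I" for k by (auto simp: bij_betw_def)
  have \<sigma>_inj: "\<sigma> k = \<sigma> l \<longleftrightarrow> k = l" for k l using \<sigma> by (auto simp: bij_betw_def inj_def)
  obtain k0 where k0: "\<sigma> k0 = i" using \<sigma> i by (auto simp: bij_betw_def)
  have \<sigma>': "bij_betw \<sigma> (UNIV - {k0}) (I - {i})"
    using \<sigma> k0 i by (intro bij_betw_DiffI) auto
  define A where "A = (\<chi> k. U I (\<sigma> k))"
  define R where "R = (\<chi> k. if k = k0 then e else A $ k)"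
  define g where "g y = (\<Sum>k\<in>UNIV. y $ k *\<^sub>R R $ k)" for y
  have lin: "linear g" unfolding g_def
    by (rule linearI) (simp_all add: scaleR_add_left sum.distrib scaleR_sum_right)
  have "matrix g = transpose R"
  proof -
    have "g (axis k 1) = R $ k" for k
    proof -
      have "g (axis k 1) = (\<Sum>l\<in>UNIV. if l = k then R $ l else 0)"
        unfolding g_def by (rule sum.cong) (auto simp: axis_def)
      then show ?thesis by simp
    qed
    then show ?thesis by (simp add: vec_eq_iff matrix_def transpose_def)
  qed
  moreover have "\<bar>det R\<bar> = norm (N i)"
  proof -
    define c where "c k = - (N (\<sigma> k) \<bullet> e)" for k
    have "e = (\<Sum>j\<in>I. (- (N j \<bullet> e)) *\<^sub>R U I j)"
      using expansion[OF I, of e "\<lambda>_. 0"] by (simp add: vtx_def)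
    also have "\<dots> = (\<Sum>k\<in>UNIV. c k *s A $ k)"
      unfolding sum.reindex_bij_betw[OF \<sigma>, symmetric] by (simp add: A_def c_def scalar_mult_eq_scaleR)
    finally have "\<bar>det R\<bar> = \<bar>c k0\<bar> * \<bar>det A\<bar>"
      unfolding R_def by (rule abs_det_replace_row)
    moreover have "\<bar>det A\<bar> = 1"
    proof (rule abs_det_int_dual[where B = "\<chi> k. N (\<sigma> k)"])
      show "int_vec (A $ k)" for k using U_int[OF I \<sigma>I] by (simp add: A_def)
      show "int_vec ((\<chi> k. N (\<sigma> k)) $ k)" for k using N_int V_subset[OF I] \<sigma>I by auto
      show "A $ k \<bullet> (\<chi> k. N (\<sigma> k)) $ l = (if k = l then - 1 else 0)" for k l
        using dual[OF I \<sigma>I \<sigma>I, of l k] by (auto simp: A_def \<sigma>_inj inner_commute)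
    qed
    moreover have "\<bar>c k0\<bar> = norm (N i)" unfolding c_def k0 e_def inner_unit_normal[OF id] by simp
    ultimately show ?thesis by simp
  qed
  ultimately have det: "\<bar>det (matrix g)\<bar> = norm (N i)" by (simp add: det_transpose)
  then have det0: "det (matrix g) \<noteq> 0" using N_nonzero[OF id] by auto
  define \<phi> where "\<phi> k s = (if k = k0 then indicator {0..1} s
      else (of_bool (0 \<le> s) - of_bool (\<xi> \<bullet> U I (\<sigma> k) > 0)) * exp ((\<xi> \<bullet> U I (\<sigma> k)) * s))" for k and s :: real
  have \<phi>: "has_bochner_integral lborel (\<phi> k) (if k = k0 then 1 else 1 / weight \<xi> I (\<sigma> k))" for k
  proof (cases "k = k0")
    case True
    have "has_bochner_integral lborel (indicator {0..1::real} :: real \<Rightarrow> real) (measure lborel {0..1::real})"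
      by (rule has_bochner_integral_real_indicator) auto
    then show ?thesis using True by (simp add: \<phi>_def[abs_def])
  next
    case False
    have "\<xi> \<bullet> U I (\<sigma> k) \<noteq> 0" using gen I \<sigma>I by (auto simp: generic_def)
    from has_bochner_integral_polar_exp[OF this] show ?thesis
      using False \<sigma>I by (simp add: \<phi>_def[abs_def] weight_def)
  qed
  have eq: "prism_term \<xi> i lam I (vtx I lam + g y) = exp (\<xi> \<bullet> vtx I lam) * (\<Prod>k\<in>UNIV. \<phi> k (y $ k))" for y
  proof -
    \<comment> \<open>\<open>q\<close> is the part of \<open>g y\<close> along the facet hyperplane.
      It is orthogonal to \<open>N i\<close>, so the height is \<open>y $ k0\<close> and the foot
      drops the normal part.\<close>
    define q where "q = (\<Sum>k\<in>UNIV - {k0}. y $ k *\<^sub>R U I (\<sigma> k))"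
    have g: "g y = y $ k0 *\<^sub>R e + q"
      unfolding g_def q_def sum.remove[OF finite UNIV_I, of _ k0] by (simp add: R_def A_def)
    have Nq: "N (\<sigma> l) \<bullet> q = (if l = k0 then 0 else - y $ l)" for l
    proof -
      have "N (\<sigma> l) \<bullet> q = (\<Sum>k\<in>UNIV - {k0}. if k = l then - y $ l else 0)"
        unfolding q_def inner_sum_right
        by (rule sum.cong) (auto simp: dual[OF I \<sigma>I \<sigma>I] \<sigma>_inj)
      then show ?thesis by simp
    qed
    have "N i \<bullet> (vtx I lam + g y) = lam i + y $ k0 * norm (N i)"
      unfolding g inner_add_right inner_vtx[OF I i] using Nq[of k0] inner_unit_normal[OF id]
      by (simp add: k0 e_def)
    then have h: "height i lam (vtx I lam + g y) = y $ k0"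
      using N_nonzero[OF id] by (simp add: height_def)
    then have f: "foot i lam (vtx I lam + g y) = vtx I lam + q"
      by (simp add: foot_def g e_def)
    have "(\<Prod>j\<in>I - {i}. of_bool (0 \<le> lam j - N j \<bullet> (vtx I lam + q)) - of_bool (\<xi> \<bullet> U I j > 0))
       = (\<Prod>k\<in>UNIV - {k0}. of_bool (0 \<le> y $ k) - of_bool (\<xi> \<bullet> U I (\<sigma> k) > 0) :: real)"
    proof (rule prod.reindex_bij_betw[OF \<sigma>', symmetric, THEN trans])
      show "(\<Prod>k\<in>UNIV - {k0}. of_bool (0 \<le> lam (\<sigma> k) - N (\<sigma> k) \<bullet> (vtx I lam + q)) - of_bool (\<xi> \<bullet> U I (\<sigma> k) > 0))
        = (\<Prod>k\<in>UNIV - {k0}. of_bool (0 \<le> y $ k) - of_bool (\<xi> \<bullet> U I (\<sigma> k) > 0) :: real)"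
        by (rule prod.cong) (auto simp: inner_add_right inner_vtx[OF I \<sigma>I] Nq)
    qed
    moreover have "exp (\<xi> \<bullet> (vtx I lam + q)) = exp (\<xi> \<bullet> vtx I lam) * (\<Prod>k\<in>UNIV - {k0}. exp ((\<xi> \<bullet> U I (\<sigma> k)) * y $ k))"
      by (simp add: inner_add_right exp_add q_def inner_sum_right exp_sum mult.commute)
    ultimately show ?thesis
      unfolding prism_term_def h f prod.remove[OF finite UNIV_I, of _ k0]
      by (simp add: \<phi>_def prod.distrib indicator_def)
  qed
  have int\<phi>: "integrable lborel (\<phi> k)" for k by (rule integrable.intros[OF \<phi>])
  show "integrable lborel (prism_term \<xi> i lam I)"
    unfolding lborel_integrable_affine[OF lin det0 prism_term_borel, of _ _ _ _ "vtx I lam"] eq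
    by (intro integrable_mult_right lborel_integrable_prod_cart int\<phi>)
  have "integral\<^sup>L lborel (prism_term \<xi> i lam I) = norm (N i) * (exp (\<xi> \<bullet> vtx I lam) * (\<Prod>k\<in>UNIV. \<integral>s. \<phi> k s \<partial>lborel))"
    unfolding lborel_integral_affine[OF lin det0 prism_term_borel, of _ _ _ _ "vtx I lam"] eq det
    by (simp add: lborel_integral_prod_cart int\<phi>)
  also have "(\<Prod>k\<in>UNIV. \<integral>s. \<phi> k s \<partial>lborel) = (\<Prod>k\<in>UNIV - {k0}. 1 / weight \<xi> I (\<sigma> k))"
    unfolding has_bochner_integral_integral_eq[OF \<phi>] prod.remove[OF finite UNIV_I, of _ k0] by simp
  also have "\<dots> = (\<Prod>j\<in>I - {i}. 1 / weight \<xi> I j)"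
    by (rule prod.reindex_bij_betw[OF \<sigma>'])
  finally show "integral\<^sup>L lborel (prism_term \<xi> i lam I) =
      norm (N i) * (exp (\<xi> \<bullet> vtx I lam) * (\<Prod>j\<in>I - {i}. 1 / weight \<xi> I j))" .
qed

lemma prism_exp_integral:
  assumes gen: "generic \<xi>" and lam: "nondeg lam" and i: "i < d"
  shows "(\<integral>x. indicator (prism i lam) x * exp (\<xi> \<bullet> foot i lam x) \<partial>lborel) / norm (N i)
    = (\<Sum>I\<in>{I\<in>V. i \<in> I}. exp (\<xi> \<bullet> vtx I lam) * (\<Prod>j\<in>I - {i}. 1 / weight \<xi> I j))"
proof -
  have "(\<integral>x. indicator (prism i lam) x * exp (\<xi> \<bullet> foot i lam x) \<partial>lborel)
     = (\<integral>x. (\<Sum>I\<in>{I\<in>V. i \<in> I}. prism_term \<xi> i lam I x) \<partial>lborel)"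
    by (simp only: prism_term_sum[OF gen lam i])
  also have "\<dots> = (\<Sum>I\<in>{I\<in>V. i \<in> I}. norm (N i) * (exp (\<xi> \<bullet> vtx I lam) * (\<Prod>j\<in>I - {i}. 1 / weight \<xi> I j)))"
    by (subst Bochner_Integration.integral_sum) (auto simp: prism_term_integral[OF gen])
  also have "\<dots> = norm (N i) * (\<Sum>I\<in>{I\<in>V. i \<in> I}. exp (\<xi> \<bullet> vtx I lam) * (\<Prod>j\<in>I - {i}. 1 / weight \<xi> I j))"
    by (simp add: sum_distrib_left)
  finally show ?thesis using N_nonzero[OF i] by simp
qed

text \<open>Each facet through the vertex misses one factor of the denominator; over the common
  denominator the missing weights add up.\<close>

lemma amplitude_eq_sum:
  assumes gen: "generic \<xi>" and I: "I \<in> V"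
  shows "amplitude \<xi> I = (\<Sum>i\<in>I. \<Prod>j\<in>I - {i}. 1 / weight \<xi> I j)"
proof -
  have fin: "finite I" by (rule finite_I[OF I])
  have "(\<Prod>j\<in>I - {i}. 1 / weight \<xi> I j) = weight \<xi> I i / (\<Prod>j\<in>I. weight \<xi> I j)" if "i \<in> I" for i
  proof -
    have "weight \<xi> I i \<noteq> 0" using gen I that by (auto simp: generic_def weight_def)
    then show ?thesis unfolding prod.remove[OF fin that, of "weight \<xi> I"] by (simp add: prod_dividef)
  qed
  then have "(\<Sum>i\<in>I. \<Prod>j\<in>I - {i}. 1 / weight \<xi> I j) = (\<Sum>i\<in>I. weight \<xi> I i) / (\<Prod>j\<in>I. weight \<xi> I j)"
    by (simp add: sum_divide_distrib)
  also have "(\<Sum>i\<in>I. weight \<xi> I i) = (\<Sum>i<d. weight \<xi> I i)"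
    unfolding sum_weight[OF I] by (simp add: weight_def)
  finally show ?thesis by (simp add: amplitude_def)
qed

lemma prism_exp_integral_sum:
  assumes gen: "generic \<xi>" and lam: "nondeg lam"
  shows "(\<Sum>i<d. (\<integral>x. indicator (prism i lam) x * exp (\<xi> \<bullet> foot i lam x) \<partial>lborel) / norm (N i))
    = (\<Sum>I\<in>V. amplitude \<xi> I * exp (\<xi> \<bullet> vtx I lam))"
proof -
  have "(\<Sum>i<d. (\<integral>x. indicator (prism i lam) x * exp (\<xi> \<bullet> foot i lam x) \<partial>lborel) / norm (N i))
    = (\<Sum>i<d. \<Sum>I\<in>{I\<in>V. i \<in> I}. exp (\<xi> \<bullet> vtx I lam) * (\<Prod>j\<in>I - {i}. 1 / weight \<xi> I j))"
    by (rule sum.cong) (simp_all add: prism_exp_integral[OF gen lam])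
  also have "\<dots> = (\<Sum>I\<in>V. \<Sum>i\<in>{i\<in>{..<d}. i \<in> I}. exp (\<xi> \<bullet> vtx I lam) * (\<Prod>j\<in>I - {i}. 1 / weight \<xi> I j))"
    by (rule sum.swap_restrict) (use finite_V in auto)
  also have "\<dots> = (\<Sum>I\<in>V. amplitude \<xi> I * exp (\<xi> \<bullet> vtx I lam))"
  proof (rule sum.cong)
    fix I assume I: "I \<in> V"
    then have "{i\<in>{..<d}. i \<in> I} = I" using V_subset by auto
    then show "(\<Sum>i\<in>{i\<in>{..<d}. i \<in> I}. exp (\<xi> \<bullet> vtx I lam) * (\<Prod>j\<in>I - {i}. 1 / weight \<xi> I j))
       = amplitude \<xi> I * exp (\<xi> \<bullet> vtx I lam)"
      unfolding amplitude_eq_sum[OF gen I] sum_distrib_right by (simp add: mult.commute)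
  qed simp
  finally show ?thesis .
qed

lemma prism_exp_integral_limit:
  assumes bdd: "bounded (poly_of d N lam)" and i: "i < d"
  shows "((\<lambda>t. \<integral>x. indicator (prism i lam) x * exp (t * (\<xi> \<bullet> foot i lam x)) \<partial>lborel) \<longlongrightarrow> measure lebesgue (prism i lam)) (at 0)"
  unfolding tendsto_at_iff_sequentially o_def
proof (intro allI impI)
  fix X :: "nat \<Rightarrow> real" assume X: "X \<longlonglongrightarrow> 0"
  obtain K where K: "\<And>n. \<bar>X n\<bar> \<le> K"
    using convergent_imp_Bseq[of X] X unfolding convergent_def Bseq_def by auto
  obtain B where B: "\<And>y. y \<in> poly_of d N lam \<Longrightarrow> norm y \<le> B" using bdd by (auto simp: bounded_iff)
  have "bounded (prism i lam)"
    unfolding bounded_iff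
  proof (intro exI ballI)
    fix x assume x: "x \<in> prism i lam"
    have "x = foot i lam x + height i lam x *\<^sub>R (N i /\<^sub>R norm (N i))" by (simp add: foot_def)
    then have "norm x \<le> norm (foot i lam x) + norm (height i lam x *\<^sub>R (N i /\<^sub>R norm (N i)))"
      by (metis norm_triangle_ineq)
    also have "norm (height i lam x *\<^sub>R (N i /\<^sub>R norm (N i))) = \<bar>height i lam x\<bar>"
      using N_nonzero[OF i] by (simp add: abs_mult)
    also have "norm (foot i lam x) + \<bar>height i lam x\<bar> \<le> B + 1"
      using x B by (intro add_mono) (auto simp: prism_def)
    finally show "norm x \<le> B + 1" .
  qed
  then have fin: "emeasure lborel (prism i lam) < \<infinity>" by (rule emeasure_bounded_finite)
  have "(\<lambda>n. \<integral>x. indicator (prism i lam) x * exp (X n * (\<xi> \<bullet> foot i lam x)) \<partial>lborel)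
     \<longlonglongrightarrow> (\<integral>x. indicator (prism i lam) x \<partial>lborel)"
  proof (rule integral_dominated_convergence[where w = "\<lambda>x. indicator (prism i lam) x * exp (K * (norm \<xi> * B))"])
    show "integrable lborel (\<lambda>x. indicator (prism i lam) x * exp (K * (norm \<xi> * B)) :: real)"
      using fin by (intro integrable_mult_left integrable_real_indicator) auto
    show "AE x in lborel. (\<lambda>n. indicator (prism i lam) x * exp (X n * (\<xi> \<bullet> foot i lam x))) \<longlonglongrightarrow> (indicator (prism i lam) x :: real)"
    proof (rule AE_I2)
      fix x
      have "(\<lambda>n. indicator (prism i lam) x * exp (X n * (\<xi> \<bullet> foot i lam x))) \<longlonglongrightarrow> indicator (prism i lam) x * exp (0 * (\<xi> \<bullet> foot i lam x))"
        by (intro tendsto_intros X)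
      then show "(\<lambda>n. indicator (prism i lam) x * exp (X n * (\<xi> \<bullet> foot i lam x))) \<longlonglongrightarrow> (indicator (prism i lam) x :: real)" by simp
    qed
    show "AE x in lborel. norm (indicator (prism i lam) x * exp (X n * (\<xi> \<bullet> foot i lam x))) \<le> indicator (prism i lam) x * exp (K * (norm \<xi> * B))" for n
    proof (rule AE_I2)
      fix x
      show "norm (indicator (prism i lam) x * exp (X n * (\<xi> \<bullet> foot i lam x))) \<le> indicator (prism i lam) x * exp (K * (norm \<xi> * B))"
      proof (cases "x \<in> prism i lam")
        case True
        have "\<bar>\<xi> \<bullet> foot i lam x\<bar> \<le> norm \<xi> * norm (foot i lam x)" by (rule Cauchy_Schwarz_ineq2)
        also have "\<dots> \<le> norm \<xi> * B" using True B by (intro mult_left_mono) (auto simp: prism_def)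
        finally have *: "\<bar>\<xi> \<bullet> foot i lam x\<bar> \<le> norm \<xi> * B" .
        have "\<bar>X n * (\<xi> \<bullet> foot i lam x)\<bar> \<le> K * (norm \<xi> * B)"
          unfolding abs_mult using K[of n] * by (intro mult_mono) (auto intro: order_trans[OF abs_ge_zero])
        then show ?thesis using True by (simp add: abs_le_iff)
      qed simp
    qed
  qed measurable
  moreover have "(\<integral>x. indicator (prism i lam) x \<partial>lborel) = measure lebesgue (prism i lam)"
    by (simp add: measure_completion)
  ultimately show "(\<lambda>n. \<integral>x. indicator (prism i lam) x * exp (X n * (\<xi> \<bullet> foot i lam x)) \<partial>lborel) \<longlonglongrightarrow> measure lebesgue (prism i lam)"
    by simp
qed

text \<open>The coefficient comparison used for lattice points, now with pure exponentials. Since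
  \<open>\<xi>\<close> does not depend on \<open>lam\<close>, the result is one power sum valid for
  all nondegenerate \<open>lam\<close>, on which the operators can act.\<close>

theorem vol_boundary_eq:
  assumes gen: "generic \<xi>" and lam: "nondeg lam" and bdd: "bounded (poly_of d N lam)"
  shows "vol_boundary d N lam = (\<Sum>I\<in>V. amplitude \<xi> I * dpow (CARD('n) - 1) 0 (lin_form d (weight \<xi> I) lam))"
proof -
  let ?n = "CARD('n) - 1"
  have "(\<lambda>t. \<Sum>I\<in>V. amplitude \<xi> I * exp (lin_form d (weight \<xi> I) lam * t)) has_fps_expansion
     (\<Sum>I\<in>V. fps_const (amplitude \<xi> I) * fps_exp (lin_form d (weight \<xi> I) lam))"
    by (intro has_fps_expansion_sum has_fps_expansion_cmult_left has_fps_expansion_exp)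
  moreover have "((\<lambda>t. (\<Sum>I\<in>V. amplitude \<xi> I * exp (lin_form d (weight \<xi> I) lam * t)) / t ^ ?n) \<longlongrightarrow> vol_boundary d N lam) (at 0)"
  proof (rule Lim_transform_eventually)
    show "((\<lambda>t. \<Sum>i<d. (\<integral>x. indicator (prism i lam) x * exp (t * (\<xi> \<bullet> foot i lam x)) \<partial>lborel) / norm (N i))
       \<longlongrightarrow> vol_boundary d N lam) (at 0)"
      unfolding vol_boundary_def
    proof (intro tendsto_sum tendsto_divide tendsto_const)
      fix i assume "i \<in> {..<d}"
      then have i: "i < d" by simp
      show "norm (N i) \<noteq> 0" using N_nonzero[OF i] by simp
      show "((\<lambda>t. \<integral>x. indicator (prism i lam) x * exp (t * (\<xi> \<bullet> foot i lam x)) \<partial>lborel)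
        \<longlongrightarrow> hvol (poly_of d N lam \<inter> {x. x \<bullet> N i = lam i}) (N i)) (at 0)"
        unfolding hvol_facet[OF i] by (rule prism_exp_integral_limit[OF bdd i])
    qed
    have "(\<Sum>i<d. (\<integral>x. indicator (prism i lam) x * exp (t * (\<xi> \<bullet> foot i lam x)) \<partial>lborel) / norm (N i))
       = (\<Sum>I\<in>V. amplitude \<xi> I * exp (lin_form d (weight \<xi> I) lam * t)) / t ^ ?n" if t: "t \<noteq> 0" for t
      using prism_exp_integral_sum[OF generic_scale[OF gen t] lam]
      by (simp add: amplitude_scale t lin_form_weight sum_divide_distrib mult.commute)
    then show "\<forall>\<^sub>F t in at 0. (\<Sum>i<d. (\<integral>x. indicator (prism i lam) x * exp (t * (\<xi> \<bullet> foot i lam x)) \<partial>lborel) / norm (N i))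
       = (\<Sum>I\<in>V. amplitude \<xi> I * exp (lin_form d (weight \<xi> I) lam * t)) / t ^ ?n"
      by (simp add: eventually_at_filter)
  qed
  ultimately have "fps_nth (\<Sum>I\<in>V. fps_const (amplitude \<xi> I) * fps_exp (lin_form d (weight \<xi> I) lam)) ?n = vol_boundary d N lam"
    by (rule fps_nth_eq_limit)
  then show ?thesis by (simp add: fps_sum_nth dpow_def)
qed

end

section \<open>Vertices of Delzant polytopes\<close>

lemma lattice_basis_axis:
  fixes B :: "(real^'n) set"
  assumes "lattice_basis B"
  shows "\<exists>c :: real^'n \<Rightarrow> int. axis k 1 = (\<Sum>b\<in>B. of_int (c b) *\<^sub>R b)"
proof -
  have "int_vec (axis k 1 :: real^'n)" by (simp add: int_vec_def axis_def)
  with assms show ?thesis by (simp add: lattice_basis_def)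
qed

lemma lattice_basis_orthogonal:
  fixes B :: "(real^'n) set"
  assumes "lattice_basis B" "\<And>b. b \<in> B \<Longrightarrow> x \<bullet> b = 0"
  shows "x = 0"
proof -
  have "x $ k = 0" for k
  proof -
    obtain c :: "real^'n \<Rightarrow> int" where c: "axis k 1 = (\<Sum>b\<in>B. of_int (c b) *\<^sub>R b)"
      using lattice_basis_axis[OF assms(1)] by blast
    have "x $ k = x \<bullet> axis k 1" by (simp add: inner_axis)
    also have "\<dots> = 0" unfolding c inner_sum_right using assms(2) by simp
    finally show ?thesis .
  qed
  then show ?thesis by (simp add: vec_eq_iff)
qed

locale delzant_presentation =
  fixes P :: "(real^'n) set" and d :: nat and F :: "nat \<Rightarrow> (real^'n) set"
    and N :: "nat \<Rightarrow> real^'n" and \<mu> :: "nat \<Rightarrow> real"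
  assumes delzant: "delzant P"
    and inj_F: "inj_on F {..<d}"
    and facets: "{G. G facet_of P} = F ` {..<d}"
    and primitive: "\<And>i. i < d \<Longrightarrow> primitive_vec (N i)"
    and \<mu>_pos: "\<And>i. i < d \<Longrightarrow> \<mu> i > 0"
    and F_eq: "\<And>i. i < d \<Longrightarrow> F i = P \<inter> {x. x \<bullet> N i = \<mu> i}"
    and P_eq: "P = (\<Inter>i\<in>{..<d}. {x. x \<bullet> N i \<le> \<mu> i})"
begin

lemma mem_P: "x \<in> P \<longleftrightarrow> (\<forall>i<d. N i \<bullet> x \<le> \<mu> i)"
  unfolding P_eq by (auto simp: inner_commute)

lemma polytope_P: "polytope P"
  using delzant by (simp add: delzant_def integral_polytope_def)

lemma normal_nonzero: "i < d \<Longrightarrow> N i \<noteq> 0"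
  using primitive by (auto simp: primitive_vec_def)

lemma normal_int: "i < d \<Longrightarrow> int_vec (N i)"
  using primitive by (auto simp: primitive_vec_def)

definition tight :: "real^'n \<Rightarrow> nat set" where
  "tight x = {i. i < d \<and> N i \<bullet> x = \<mu> i}"

lemma finite_tight: "finite (tight x)"
  by (simp add: tight_def)

text \<open>Tight constraints are controlled by the hypothesis on \<open>w\<close>, the others by
  continuity.\<close>

lemma eventually_in_P:
  assumes x: "x \<in> P" and w: "\<And>i. i \<in> tight x \<Longrightarrow> N i \<bullet> w \<le> 0"
  shows "eventually (\<lambda>s. x + s *\<^sub>R w \<in> P) (at_right 0)"
proof -
  have "eventually (\<lambda>s. \<forall>i\<in>{..<d}. N i \<bullet> (x + s *\<^sub>R w) \<le> \<mu> i) (at_right 0)"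
  proof (rule eventually_ball_finite, simp, rule ballI)
    fix i assume i: "i \<in> {..<d}"
    show "eventually (\<lambda>s. N i \<bullet> (x + s *\<^sub>R w) \<le> \<mu> i) (at_right 0)"
    proof (cases "i \<in> tight x")
      case True
      from w[OF this] show ?thesis
        using True eventually_at_right_less[of "0::real"]
        by (auto simp: tight_def inner_add_right mult_nonneg_nonpos elim!: eventually_mono)
    next
      case False
      then have "N i \<bullet> (x + 0 *\<^sub>R w) < \<mu> i" using x i by (force simp: tight_def mem_P)
      moreover have "((\<lambda>s. N i \<bullet> (x + s *\<^sub>R w)) \<longlongrightarrow> N i \<bullet> (x + 0 *\<^sub>R w)) (at_right 0)"
        by (intro tendsto_intros)
      ultimately have "eventually (\<lambda>s. N i \<bullet> (x + s *\<^sub>R w) < \<mu> i) (at_right 0)"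
        by (rule order_tendstoD(2)[rotated])
      then show ?thesis by (rule eventually_mono) simp
    qed
  qed
  then show ?thesis unfolding mem_P by (rule eventually_mono) auto
qed

lemma segment_tight:
  assumes "a \<in> P" "b \<in> P" "x \<in> open_segment a b" "i < d" "N i \<bullet> x = \<mu> i"
  shows "N i \<bullet> a = \<mu> i \<and> N i \<bullet> b = \<mu> i"
proof -
  from assms obtain r where r: "0 < r" "r < 1" "x = (1 - r) *\<^sub>R a + r *\<^sub>R b"
    by (auto simp: in_segment)
  have ab: "N i \<bullet> a \<le> \<mu> i" "N i \<bullet> b \<le> \<mu> i" using assms by (auto simp: mem_P)
  have "(1 - r) * (\<mu> i - N i \<bullet> a) + r * (\<mu> i - N i \<bullet> b) = 0"
    using assms(5) unfolding r(3) by (simp add: inner_add_right algebra_simps)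
  moreover have "0 \<le> (1 - r) * (\<mu> i - N i \<bullet> a)" "0 \<le> r * (\<mu> i - N i \<bullet> b)"
    using r ab by simp_all
  ultimately have "(1 - r) * (\<mu> i - N i \<bullet> a) = 0" "r * (\<mu> i - N i \<bullet> b) = 0" by linarith+
  then show ?thesis using r by simp
qed

lemma tight_face: "T \<subseteq> {..<d} \<Longrightarrow> {x \<in> P. \<forall>i\<in>T. N i \<bullet> x = \<mu> i} face_of P"
  unfolding face_of_def
proof (intro conjI ballI impI)
  assume T: "T \<subseteq> {..<d}"
  have "{x \<in> P. \<forall>i\<in>T. N i \<bullet> x = \<mu> i} = P \<inter> (\<Inter>i\<in>T. {x. N i \<bullet> x = \<mu> i})" by auto
  moreover have "convex P" using polytope_P by (rule polytope_imp_convex)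
  ultimately show "convex {x \<in> P. \<forall>i\<in>T. N i \<bullet> x = \<mu> i}"
    by (auto intro!: convex_Int convex_INT convex_hyperplane)
  fix a b x assume "a \<in> P" "b \<in> P" "x \<in> {x \<in> P. \<forall>i\<in>T. N i \<bullet> x = \<mu> i}" "x \<in> open_segment a b"
  then show "a \<in> {x \<in> P. \<forall>i\<in>T. N i \<bullet> x = \<mu> i}" "b \<in> {x \<in> P. \<forall>i\<in>T. N i \<bullet> x = \<mu> i}"
    using T segment_tight[of a b x] by auto
qed auto

text \<open>A nonzero \<open>w\<close> orthogonal to all tight normals would let \<open>v\<close>
  move both ways inside \<open>P\<close>, making it the midpoint of a segment.\<close>

lemma extreme_point_tight_spans:
  assumes v: "v extreme_point_of P" and w: "\<And>i. i \<in> tight v \<Longrightarrow> N i \<bullet> w = 0"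
  shows "w = 0"
proof (rule ccontr)
  assume "w \<noteq> 0"
  have "v \<in> P" using v by (simp add: extreme_point_of_def)
  from eventually_in_P[OF this, of w] eventually_in_P[OF this, of "- w"] w
  have "eventually (\<lambda>s. v + s *\<^sub>R w \<in> P) (at_right 0)" "eventually (\<lambda>s. v + s *\<^sub>R (- w) \<in> P) (at_right 0)"
    by simp_all
  then have "eventually (\<lambda>s. v + s *\<^sub>R w \<in> P \<and> v + s *\<^sub>R (- w) \<in> P \<and> s > 0) (at_right 0)"
    using eventually_at_right_less[of "0::real"] by eventually_elim auto
  then obtain s where s: "v + s *\<^sub>R w \<in> P" "v + s *\<^sub>R (- w) \<in> P" "s > 0"
    using eventually_happens'[of "at_right (0::real)"] by auto
  have "v \<in> open_segment (v + s *\<^sub>R w) (v + s *\<^sub>R (- w))"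
    unfolding in_segment
  proof (intro conjI exI[of _ "1/2"])
    show "v + s *\<^sub>R w \<noteq> v + s *\<^sub>R - w"
    proof
      assume "v + s *\<^sub>R w = v + s *\<^sub>R - w"
      then have "(2 * s) *\<^sub>R w = 0" by (simp add: scaleR_add_left[of s s, simplified] eq_neg_iff_add_eq_0)
      with s \<open>w \<noteq> 0\<close> show False by simp
    qed
    show "v = (1 - 1/2) *\<^sub>R (v + s *\<^sub>R w) + (1/2) *\<^sub>R (v + s *\<^sub>R - w)"
      by (simp add: algebra_simps flip: scaleR_add_left)
  qed auto
  with v s show False by (auto simp: extreme_point_of_def)
qed

lemma extreme_pointI:
  assumes v: "v \<in> P" and w: "\<And>w. (\<And>i. i \<in> tight v \<Longrightarrow> N i \<bullet> w = 0) \<Longrightarrow> w = 0"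
  shows "v extreme_point_of P"
  unfolding extreme_point_of_def
proof (intro conjI ballI notI)
  fix a b assume ab: "a \<in> P" "b \<in> P" "v \<in> open_segment a b"
  have "a - b = 0"
    using segment_tight[OF ab] by (intro w) (auto simp: tight_def inner_diff_right)
  with ab show False by simp
qed (rule v)

text \<open>
  Induction on the number of facets through \<open>v\<close> that are strict at \<open>y\<close>: unless \<open>y\<close> spans an edge, there
  is a transversal direction \<open>w\<close> in the same face, and \<open>y\<close> is a positive multiple of the sum of the two vectors
  at which the line \<open>w + \<real> y\<close> and its negative enter the cone.
\<close>
lemma cone_generated_by_edges:
  fixes v u
  defines "E \<equiv> {e. e edge_of P \<and> v \<in> e}"
  assumes v: "v extreme_point_of P" and finE: "finite E"
    and u: "\<And>e. e \<in> E \<Longrightarrow> u e \<noteq> 0 \<and> (\<exists>t>0. v + t *\<^sub>R u e \<in> e)"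
    and y: "\<And>i. i \<in> tight v \<Longrightarrow> N i \<bullet> y \<le> 0"
  shows "\<exists>c. (\<forall>e\<in>E. 0 \<le> c e) \<and> y = (\<Sum>e\<in>E. c e *\<^sub>R u e)"
  using y
proof (induction "card {i \<in> tight v. N i \<bullet> y \<noteq> 0}" arbitrary: y rule: less_induct)
  case less
  note y = less.prems
  have vP: "v \<in> P" using v by (simp add: extreme_point_of_def)
  define T where "T = {i \<in> tight v. N i \<bullet> y = 0}"
  show ?case
  proof (cases "y = 0")
    case True
    then show ?thesis by (intro exI[of _ "\<lambda>_. 0"]) simp
  next
    case False
    then obtain i0 where i0: "i0 \<in> tight v" "N i0 \<bullet> y \<noteq> 0" using extreme_point_tight_spans[OF v] by blast
    with y have i0_neg: "N i0 \<bullet> y < 0" by force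
    show ?thesis
    proof (cases "\<forall>w. (\<forall>i\<in>T. N i \<bullet> w = 0) \<longrightarrow> (\<exists>c. w = c *\<^sub>R y)")
      case True
      \<comment> \<open>All directions of the face cut out by \<open>T\<close> are multiples of
        \<open>y\<close>, so it is one of the edges at \<open>v\<close>.\<close>
      define e where "e = {x \<in> P. \<forall>i\<in>T. N i \<bullet> x = \<mu> i}"
      have "eventually (\<lambda>s. v + s *\<^sub>R y \<in> P) (at_right 0)"
        using y by (intro eventually_in_P vP)
      then have "eventually (\<lambda>s. v + s *\<^sub>R y \<in> P \<and> s > 0) (at_right 0)"
        using eventually_at_right_less[of "0::real"] by eventually_elim auto
      then obtain s where s: "v + s *\<^sub>R y \<in> P" "s > 0"
        using eventually_happens'[of "at_right (0::real)"] by auto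
      have ve: "v \<in> e" using vP by (auto simp: e_def T_def tight_def)
      have se: "v + s *\<^sub>R y \<in> e" using s by (auto simp: e_def T_def tight_def inner_add_right)
      have line: "\<exists>c. x - v = c *\<^sub>R y" if "x \<in> e" for x
        using that True by (auto simp: e_def T_def tight_def inner_diff_right)
      have "aff_dim e = 1"
      proof (rule antisym)
        have "e \<subseteq> affine hull {v, v + s *\<^sub>R y}"
        proof
          fix x assume "x \<in> e"
          then obtain c where "x - v = c *\<^sub>R y" using line by blast
          then have x: "x = v + c *\<^sub>R y" by (simp add: algebra_simps)
          then have "x = (1 - c / s) *\<^sub>R v + (c / s) *\<^sub>R (v + s *\<^sub>R y)"
            using s by (simp add: algebra_simps)
          then show "x \<in> affine hull {v, v + s *\<^sub>R y}"
            unfolding affine_hull_2 by (metis (mono_tags, lifting) diff_add_cancel mem_Collect_eq)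
        qed
        then have "aff_dim e \<le> aff_dim {v, v + s *\<^sub>R y}"
          by (metis aff_dim_affine_hull aff_dim_subset)
        then show "aff_dim e \<le> 1" using s \<open>y \<noteq> 0\<close> by (simp add: aff_dim_2)
        have "aff_dim {v, v + s *\<^sub>R y} \<le> aff_dim e" by (rule aff_dim_subset) (use ve se in auto)
        then show "1 \<le> aff_dim e" using s \<open>y \<noteq> 0\<close> by (simp add: aff_dim_2)
      qed
      moreover have "e face_of P" unfolding e_def by (rule tight_face) (auto simp: T_def tight_def)
      ultimately have eE: "e \<in> E" using ve by (simp add: E_def edge_of_def)
      from u[OF this] obtain t where t: "u e \<noteq> 0" "t > 0" "v + t *\<^sub>R u e \<in> e" by auto
      from line[OF t(3)] obtain c where c: "t *\<^sub>R u e = c *\<^sub>R y" by auto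
      have "c \<noteq> 0" using c t by auto
      moreover have "N i0 \<bullet> (v + t *\<^sub>R u e) \<le> \<mu> i0" using t i0 by (auto simp: e_def mem_P tight_def)
      then have "c * (N i0 \<bullet> y) \<le> 0" using i0 unfolding c by (simp add: inner_add_right tight_def)
      then have "0 \<le> c" using i0_neg by (simp add: mult_le_0_iff)
      ultimately have "c > 0" by simp
      have "y = (1 / c) *\<^sub>R (c *\<^sub>R y)" using \<open>c > 0\<close> by simp
      also have "\<dots> = (t / c) *\<^sub>R u e" unfolding c[symmetric] by simp
      finally have "y = (\<Sum>e'\<in>E. (if e' = e then t / c else 0) *\<^sub>R u e')"
        using eE finE by (simp add: if_distrib[of "\<lambda>r. r *\<^sub>R _"] cong: if_cong)
      then show ?thesis using t \<open>c > 0\<close> by (intro exI[of _ "\<lambda>e'. if e' = e then t / c else 0"]) auto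
    next
      case no: False
      then obtain w where w: "\<And>i. i \<in> T \<Longrightarrow> N i \<bullet> w = 0" "\<And>c. w \<noteq> c *\<^sub>R y" by blast
      define S where "S = {i \<in> tight v. N i \<bullet> y \<noteq> 0}"
      \<comment> \<open>At \<open>c = r i\<close> the vector \<open>w - c *\<^sub>R y\<close>
        becomes orthogonal to \<open>N i\<close>. With the least such value \<open>m\<close> and the
        greatest \<open>M\<close>, both \<open>w - m *\<^sub>R y\<close> and
        \<open>M *\<^sub>R y - w\<close> stay in the cone, and each is orthogonal to at least one
        more tight normal than \<open>y\<close>.\<close>
      define r where "r i = (N i \<bullet> w) / (N i \<bullet> y)" for i
      have S: "finite S" "S \<noteq> {}" using finite_tight i0 by (auto simp: S_def)
      have neg: "N i \<bullet> y < 0" if "i \<in> S" for i using y that by (force simp: S_def)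
      have wr: "N i \<bullet> w = r i * (N i \<bullet> y)" if "i \<in> tight v" for i
        using w(1)[of i] that by (cases "N i \<bullet> y = 0") (auto simp: r_def T_def)
      define m where "m = Min (r ` S)"
      define M where "M = Max (r ` S)"
      obtain im iM where im: "im \<in> S" "r im = m" and iM: "iM \<in> S" "r iM = M"
      proof -
        have "m \<in> r ` S" "M \<in> r ` S" using S by (auto simp: m_def M_def)
        then show ?thesis using that by auto
      qed
      have bounds: "m \<le> r i" "r i \<le> M" if "i \<in> S" for i
        using that S by (auto simp: m_def M_def)
      have "m \<noteq> M"
      proof
        assume "m = M"
        then have "r i = m" if "i \<in> S" for i using bounds[OF that] by simp
        then have "N i \<bullet> (w - m *\<^sub>R y) = 0" if "i \<in> tight v" for i
          using wr[OF that] that by (cases "N i \<bullet> y = 0") (auto simp: inner_diff_right S_def)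
        then have "w - m *\<^sub>R y = 0" by (rule extreme_point_tight_spans[OF v])
        then show False using w(2)[of m] by simp
      qed
      then have mM: "m < M" using bounds[OF im(1)] im by simp
      define y1 where "y1 = w - m *\<^sub>R y"
      define y2 where "y2 = M *\<^sub>R y - w"
      have y1: "N i \<bullet> y1 = (r i - m) * (N i \<bullet> y)" and y2: "N i \<bullet> y2 = (M - r i) * (N i \<bullet> y)" if "i \<in> tight v" for i
        using wr[OF that] by (simp_all add: y1_def y2_def inner_diff_right algebra_simps)
      have le: "N i \<bullet> y1 \<le> 0 \<and> N i \<bullet> y2 \<le> 0" if "i \<in> tight v" for i
        using y1[OF that] y2[OF that] bounds[of i] neg[of i] that
        by (cases "i \<in> S") (auto simp: S_def mult_nonneg_nonpos)
      have sub: "{i \<in> tight v. N i \<bullet> y1 \<noteq> 0} \<subset> {i \<in> tight v. N i \<bullet> y \<noteq> 0}"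
      proof
        show "{i \<in> tight v. N i \<bullet> y1 \<noteq> 0} \<subseteq> {i \<in> tight v. N i \<bullet> y \<noteq> 0}" using y1 by auto
        have "im \<in> tight v" "N im \<bullet> y \<noteq> 0" using im by (auto simp: S_def)
        moreover from this have "N im \<bullet> y1 = 0" using y1 im by simp
        ultimately show "{i \<in> tight v. N i \<bullet> y1 \<noteq> 0} \<noteq> {i \<in> tight v. N i \<bullet> y \<noteq> 0}" by blast
      qed
      have sub2: "{i \<in> tight v. N i \<bullet> y2 \<noteq> 0} \<subset> {i \<in> tight v. N i \<bullet> y \<noteq> 0}"
      proof
        show "{i \<in> tight v. N i \<bullet> y2 \<noteq> 0} \<subseteq> {i \<in> tight v. N i \<bullet> y \<noteq> 0}" using y2 by auto
        have "iM \<in> tight v" "N iM \<bullet> y \<noteq> 0" using iM by (auto simp: S_def)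
        moreover from this have "N iM \<bullet> y2 = 0" using y2 iM by simp
        ultimately show "{i \<in> tight v. N i \<bullet> y2 \<noteq> 0} \<noteq> {i \<in> tight v. N i \<bullet> y \<noteq> 0}" by blast
      qed
      obtain c1 where c1: "\<forall>e\<in>E. 0 \<le> c1 e" "y1 = (\<Sum>e\<in>E. c1 e *\<^sub>R u e)"
        using less.hyps[OF psubset_card_mono[OF _ sub]] le finite_tight by auto
      obtain c2 where c2: "\<forall>e\<in>E. 0 \<le> c2 e" "y2 = (\<Sum>e\<in>E. c2 e *\<^sub>R u e)"
        using less.hyps[OF psubset_card_mono[OF _ sub2]] le finite_tight by auto
      have "y1 + y2 = (M - m) *\<^sub>R y" by (simp add: y1_def y2_def algebra_simps)
      then have "y = (1 / (M - m)) *\<^sub>R (y1 + y2)" using mM by simp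
      also have "\<dots> = (\<Sum>e\<in>E. ((c1 e + c2 e) / (M - m)) *\<^sub>R u e)"
        unfolding c1(2) c2(2) by (simp add: scaleR_sum_right sum.distrib[symmetric] scaleR_add_left add_divide_distrib scaleR_add_right)
      finally show ?thesis using c1(1) c2(1) mM
        by (intro exI[of _ "\<lambda>e. (c1 e + c2 e) / (M - m)"]) auto
    qed
  qed
qed

lemma strict_interior: "{x. \<forall>i<d. N i \<bullet> x < \<mu> i} \<subseteq> interior P"
proof -
  have "{x. \<forall>i<d. N i \<bullet> x < \<mu> i} = (\<Inter>i\<in>{..<d}. {x. N i \<bullet> x < \<mu> i})" by auto
  then have "open {x. \<forall>i<d. N i \<bullet> x < \<mu> i}" by (auto intro!: open_halfspace_lt)
  then show ?thesis by (intro interior_maximal) (auto simp: mem_P less_imp_le)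
qed

text \<open>Positivity of \<open>\<mu>\<close> makes 0 an interior point.\<close>

lemma aff_dim_P: "aff_dim P = int CARD('n)"
proof -
  have "0 \<in> {x. \<forall>i<d. N i \<bullet> x < \<mu> i}" using \<mu>_pos by simp
  then have "interior P \<noteq> {}" using strict_interior by blast
  then show ?thesis using aff_dim_nonempty_interior[of P] by simp
qed

text \<open>The Delzant condition speaks of edges, the abstract system of facets. A dimension count
  shows that all but one of the n edge vectors at \<open>v\<close> are orthogonal to
  \<open>N i\<close>; primitivity makes the value on the remaining one -1, and assigning this edge
  to \<open>i\<close> matches the facets at \<open>v\<close> with the edges at
  \<open>v\<close>.\<close>

lemma vertex_structure:
  assumes v: "v extreme_point_of P"
  shows "card (tight v) = CARD('n) \<and> (\<exists>W. (\<forall>i\<in>tight v. int_vec (W i)) \<and>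
     (\<forall>i\<in>tight v. \<forall>j\<in>tight v. N i \<bullet> W j = (if i = j then -1 else 0)))"
proof -
  define E where "E = {e. e edge_of P \<and> v \<in> e}"
  from delzant v obtain u :: "(real^'n) set \<Rightarrow> real^'n" where u: "inj_on u E"
    "\<And>e. e \<in> E \<Longrightarrow> u e \<noteq> 0 \<and> (\<exists>t>0. v + t *\<^sub>R u e \<in> e)" "lattice_basis (u ` E)"
    unfolding delzant_def E_def by blast
  have finE: "finite E" and cardE: "card E = CARD('n)"
    using u(1,3) by (auto simp: lattice_basis_def finite_image_iff card_image)
  have vP: "v \<in> P" using v by (simp add: extreme_point_of_def)
  have u_int: "int_vec (u e)" if "e \<in> E" for e using u(3) that by (auto simp: lattice_basis_def)
  have u_le: "N i \<bullet> u e \<le> 0" if i: "i \<in> tight v" and e: "e \<in> E" for i e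
  proof -
    from u(2)[OF e] obtain t where t: "t > 0" "v + t *\<^sub>R u e \<in> e" by auto
    have "e \<subseteq> P" using e by (auto simp: E_def edge_of_def face_of_def)
    with t have "N i \<bullet> (v + t *\<^sub>R u e) \<le> \<mu> i" using i by (auto simp: mem_P tight_def)
    then have "t * (N i \<bullet> u e) \<le> 0" using i by (simp add: inner_add_right tight_def)
    then show ?thesis using t by (simp add: mult_le_0_iff)
  qed
  have orth: "x = 0" if "\<And>e. e \<in> E \<Longrightarrow> x \<bullet> u e = 0" for x
    using lattice_basis_orthogonal[OF u(3)] that by auto
  have ex1: "\<exists>e\<in>E. N i \<bullet> u e = -1 \<and> (\<forall>e'\<in>E. e' \<noteq> e \<longrightarrow> N i \<bullet> u e' = 0)" if i: "i \<in> tight v" for i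
  proof -
    have id: "i < d" using i by (simp add: tight_def)
    define Z where "Z = {e \<in> E. N i \<bullet> u e = 0}"
    have "F i facet_of P" using facets id by auto
    then have aff: "aff_dim (F i) = int CARD('n) - 1" by (simp add: facet_of_def aff_dim_P)
    \<comment> \<open>For \<open>x\<close> in the facet, \<open>x - v\<close> is a nonnegative
      combination of edge vectors. As \<open>N i\<close> is nonpositive on each of them and vanishes
      on \<open>x - v\<close>, only edges in \<open>Z\<close> take part, so \<open>Z\<close> has at
      least n - 1 elements.\<close>
    have "F i \<subseteq> (+) v ` span (u ` Z)"
    proof
      fix x assume "x \<in> F i"
      then have x: "x \<in> P" "N i \<bullet> x = \<mu> i" using F_eq[OF id] by (auto simp: inner_commute)
      have "\<exists>c. (\<forall>e\<in>E. 0 \<le> c e) \<and> x - v = (\<Sum>e\<in>E. c e *\<^sub>R u e)"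
        unfolding E_def
        by (rule cone_generated_by_edges[OF v]) (use finE u(2) x in \<open>auto simp: E_def tight_def mem_P inner_diff_right\<close>)
      then obtain c where c: "\<And>e. e \<in> E \<Longrightarrow> 0 \<le> c e" "x - v = (\<Sum>e\<in>E. c e *\<^sub>R u e)" by auto
      have "(\<Sum>e\<in>E. - (c e * (N i \<bullet> u e))) = - (N i \<bullet> (x - v))"
        unfolding c(2) by (simp add: inner_sum_right sum_negf)
      also have "\<dots> = 0" using x i by (simp add: inner_diff_right tight_def)
      finally have "\<forall>e\<in>E. - (c e * (N i \<bullet> u e)) = 0"
        using c(1) u_le[OF i] finE by (subst (asm) sum_nonneg_eq_0_iff) (auto simp: mult_nonneg_nonpos)
      then have "c e *\<^sub>R u e \<in> span (u ` Z)" if "e \<in> E" for e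
      proof -
        have "c e = 0 \<or> e \<in> Z" using that \<open>\<forall>e\<in>E. - (c e * (N i \<bullet> u e)) = 0\<close> by (auto simp: Z_def)
        then show ?thesis by (auto intro: span_scale span_base span_zero)
      qed
      then have "x - v \<in> span (u ` Z)" unfolding c(2) by (rule span_sum)
      then show "x \<in> (+) v ` span (u ` Z)" by (rule rev_image_eqI) simp
    qed
    then have "aff_dim (F i) \<le> aff_dim ((+) v ` span (u ` Z))" by (rule aff_dim_subset)
    also have "\<dots> = int (dim (span (u ` Z)))"
      by (simp add: aff_dim_translation_eq aff_dim_subspace)
    also have "\<dots> \<le> int (card Z)"
    proof -
      have "finite Z" using finE by (simp add: Z_def)
      then have "dim (u ` Z) \<le> card (u ` Z)" by (intro dim_le_card') simp
      also have "\<dots> \<le> card Z" using \<open>finite Z\<close> by (rule card_image_le)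
      finally show ?thesis by simp
    qed
    finally have "CARD('n) \<le> card Z + 1" unfolding aff by simp
    moreover have "Z \<subseteq> E" by (auto simp: Z_def)
    then have "card (E - Z) = card E - card Z" using finE by (simp add: card_Diff_subset finite_subset)
    ultimately have "card (E - Z) \<le> 1" using cardE by simp
    moreover have "E - Z \<noteq> {}"
    proof
      assume "E - Z = {}"
      then have "N i = 0" by (intro orth) (auto simp: Z_def)
      then show False using normal_nonzero[OF id] by simp
    qed
    ultimately obtain e where e: "E - Z = {e}"
      using finE by (metis card_1_singletonE card_gt_0_iff finite_Diff le_antisym less_eq_Suc_le One_nat_def)
    then have eE: "e \<in> E" and ne: "N i \<bullet> u e \<noteq> 0" and others: "\<And>e'. e' \<in> E \<Longrightarrow> e' \<noteq> e \<Longrightarrow> N i \<bullet> u e' = 0"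
      by (auto simp: Z_def)
    have "N i \<bullet> u e \<in> \<int>" by (rule int_vec_inner[OF normal_int[OF id] u_int[OF eE]])
    then obtain m where m: "N i \<bullet> u e = of_int m" by (rule Ints_cases)
    with u_le[OF i eE] ne have "m < 0" by simp
    \<comment> \<open>On the lattice basis \<open>N i\<close> takes only the values 0 and
      \<open>m\<close>, so it is \<open>- m\<close> times an integral vector, and primitivity forces
      \<open>m\<close> to be -1.\<close>
    define w where "w = (1 / of_int (- m)) *\<^sub>R N i"
    have "w $ k \<in> \<int>" for k
    proof -
      obtain c :: "real^'n \<Rightarrow> int" where c: "axis k 1 = (\<Sum>b\<in>u ` E. of_int (c b) *\<^sub>R b)"
        using lattice_basis_axis[OF u(3)] by blast
      have "N i $ k = N i \<bullet> axis k 1" by (simp add: inner_axis)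
      also have "\<dots> = (\<Sum>e'\<in>E. of_int (c (u e')) * (N i \<bullet> u e'))"
        unfolding c inner_sum_right by (simp add: sum.reindex[OF u(1)])
      also have "\<dots> = (\<Sum>e'\<in>E. if e' = e then of_int (c (u e)) * of_int m else 0)"
        using others m by (intro sum.cong) auto
      also have "\<dots> = of_int (c (u e)) * of_int m" using finE eE by simp
      finally have "w $ k = of_int (- c (u e))" using \<open>m < 0\<close> by (simp add: w_def)
      then show ?thesis by simp
    qed
    then have "int_vec w" by (simp add: int_vec_def)
    moreover have "N i = of_int (- m) *\<^sub>R w" using \<open>m < 0\<close> by (simp add: w_def)
    moreover have "- m \<ge> 1" using \<open>m < 0\<close> by simp
    ultimately have "- m = 1" using primitive[OF id] unfolding primitive_vec_def by blast
    then have "N i \<bullet> u e = -1" using m by simp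
    then show ?thesis using eE others by blast
  qed
  define h where "h i = (SOME e. e \<in> E \<and> N i \<bullet> u e = -1 \<and> (\<forall>e'\<in>E. e' \<noteq> e \<longrightarrow> N i \<bullet> u e' = 0))" for i
  have h: "h i \<in> E" "N i \<bullet> u (h i) = -1" "\<And>e'. e' \<in> E \<Longrightarrow> e' \<noteq> h i \<Longrightarrow> N i \<bullet> u e' = 0" if "i \<in> tight v" for i
  proof -
    from ex1[OF that] have "\<exists>e. e \<in> E \<and> N i \<bullet> u e = -1 \<and> (\<forall>e'\<in>E. e' \<noteq> e \<longrightarrow> N i \<bullet> u e' = 0)" by blast
    from someI_ex[OF this]
    show "h i \<in> E" "N i \<bullet> u (h i) = -1" "\<And>e'. e' \<in> E \<Longrightarrow> e' \<noteq> h i \<Longrightarrow> N i \<bullet> u e' = 0"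
      unfolding h_def by blast+
  qed
  have h_inj: "inj_on h (tight v)"
  proof (rule inj_onI)
    fix i j assume ij: "i \<in> tight v" "j \<in> tight v" "h i = h j"
    \<comment> \<open>Equal edges mean equal values on the whole lattice basis, hence equal normals
      and equal facets.\<close>
    have "(N i - N j) \<bullet> u e = 0" if "e \<in> E" for e
      using h[OF ij(1)] h[OF ij(2)] that ij(3) by (cases "e = h i") (auto simp: inner_diff_left)
    then have "N i - N j = 0" by (rule orth)
    then have N: "N i = N j" by simp
    then have "\<mu> i = \<mu> j" using ij by (simp add: tight_def)
    then have "F i = F j" using F_eq ij N by (simp add: tight_def)
    then show "i = j" using inj_F ij by (auto simp: inj_on_def tight_def)
  qed
  have "h ` tight v = E"
  proof
    show "h ` tight v \<subseteq> E" using h by auto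
    show "E \<subseteq> h ` tight v"
    proof
      fix e assume e: "e \<in> E"
      show "e \<in> h ` tight v"
      proof (rule ccontr)
        assume "e \<notin> h ` tight v"
        then have "N i \<bullet> u e = 0" if "i \<in> tight v" for i using h(3)[OF that e] that by auto
        then have "u e = 0" by (rule extreme_point_tight_spans[OF v])
        with u(2)[OF e] show False by simp
      qed
    qed
  qed
  then have "card (tight v) = CARD('n)" using cardE card_image[OF h_inj] by simp
  moreover have "\<forall>i\<in>tight v. int_vec (u (h i))" using h u_int by blast
  moreover have "\<forall>i\<in>tight v. \<forall>j\<in>tight v. N i \<bullet> u (h j) = (if i = j then -1 else 0)"
    using h h_inj by (auto simp: inj_on_def) metis
  ultimately show ?thesis by (intro conjI exI[of _ "\<lambda>i. u (h i)"]) auto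
qed

section \<open>The combinatorial system of a Delzant polytope\<close>

definition vertex_sets :: "nat set set" where
  "vertex_sets = tight ` {v. v extreme_point_of P}"

definition dual_basis :: "nat set \<Rightarrow> nat \<Rightarrow> real^'n" where
  "dual_basis I = (SOME W. (\<forall>i\<in>I. int_vec (W i)) \<and> (\<forall>i\<in>I. \<forall>j\<in>I. N i \<bullet> W j = (if i = j then -1 else 0)))"

lemma dual_basis:
  assumes "I \<in> vertex_sets"
  shows "\<And>i. i \<in> I \<Longrightarrow> int_vec (dual_basis I i)"
    and "\<And>i j. i \<in> I \<Longrightarrow> j \<in> I \<Longrightarrow> N i \<bullet> dual_basis I j = (if i = j then -1 else 0)"
proof -
  have "\<exists>W. (\<forall>i\<in>I. int_vec (W i)) \<and> (\<forall>i\<in>I. \<forall>j\<in>I. N i \<bullet> W j = (if i = j then -1 else 0))"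
  proof -
    obtain v where "v extreme_point_of P" "I = tight v" using assms by (auto simp: vertex_sets_def)
    with vertex_structure[of v] show ?thesis by blast
  qed
  from someI_ex[OF this]
  have *: "(\<forall>i\<in>I. int_vec (dual_basis I i)) \<and> (\<forall>i\<in>I. \<forall>j\<in>I. N i \<bullet> dual_basis I j = (if i = j then -1 else 0))"
    unfolding dual_basis_def .
  show "\<And>i. i \<in> I \<Longrightarrow> int_vec (dual_basis I i)"
    and "\<And>i j. i \<in> I \<Longrightarrow> j \<in> I \<Longrightarrow> N i \<bullet> dual_basis I j = (if i = j then -1 else 0)"
    using * by blast+
qed

text \<open>The new facet is the first one that is met when moving along the edge leaving \<open>i\<close>.\<close>
lemma vertex_exchange:
  assumes v: "v extreme_point_of P" and i: "i \<in> tight v"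
  shows "\<exists>j. j \<notin> tight v \<and> insert j (tight v - {i}) \<in> vertex_sets"
proof -
  have I: "tight v \<in> vertex_sets" using v by (simp add: vertex_sets_def)
  define u where "u = dual_basis (tight v) i"
  have Nu: "N j \<bullet> u = (if j = i then -1 else 0)" if "j \<in> tight v" for j
    using dual_basis(2)[OF I that i] by (simp add: u_def)
  have vP: "v \<in> P" using v by (simp add: extreme_point_of_def)
  have "u \<noteq> 0" using Nu[OF i] by auto
  define K where "K = {k. k < d \<and> N k \<bullet> u > 0}"
  have "finite K" by (simp add: K_def)
  \<comment> \<open>If no constraint grew along \<open>u\<close>, the whole ray would stay in the
    bounded set \<open>P\<close>; the length \<open>s\<close> chosen below overshoots the bound by
    1.\<close>
  have "K \<noteq> {}"
  proof
    assume "K = {}"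
    have "v + s *\<^sub>R u \<in> P" if "s \<ge> 0" for s
      unfolding mem_P
    proof (intro allI impI)
      fix k assume k: "k < d"
      then have "N k \<bullet> u \<le> 0" using \<open>K = {}\<close> by (auto simp: K_def)
      then have "s * (N k \<bullet> u) \<le> 0" using that by (simp add: mult_le_0_iff)
      moreover have "N k \<bullet> v \<le> \<mu> k" using vP k by (simp add: mem_P)
      ultimately show "N k \<bullet> (v + s *\<^sub>R u) \<le> \<mu> k" by (simp add: inner_add_right)
    qed
    moreover obtain B where B: "\<And>x. x \<in> P \<Longrightarrow> norm x \<le> B"
      using polytope_imp_bounded[OF polytope_P] by (auto simp: bounded_iff)
    ultimately have *: "norm (v + s *\<^sub>R u) \<le> B" if "s \<ge> 0" for s using that by blast
    define s where "s = (B + norm v + 1) / norm u"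
    have "B \<ge> 0" using B[OF vP] norm_ge_zero[of v] by linarith
    then have "s \<ge> 0" by (simp add: s_def)
    have "norm (s *\<^sub>R u) \<le> norm (v + s *\<^sub>R u) + norm v"
      using norm_triangle_ineq4[of "v + s *\<^sub>R u" v] by simp
    also have "\<dots> \<le> B + norm v" using *[OF \<open>s \<ge> 0\<close>] by simp
    finally have "\<bar>s\<bar> * norm u \<le> B + norm v" by simp
    moreover have "\<bar>s\<bar> * norm u = B + norm v + 1"
      unfolding abs_of_nonneg[OF \<open>s \<ge> 0\<close>] using \<open>u \<noteq> 0\<close> by (simp add: s_def)
    ultimately show False by simp
  qed
  \<comment> \<open>The step length at which the k-th hyperplane is reached. The smallest one keeps
    the point in \<open>P\<close> and gains a facet.\<close>
  define q where "q k = (\<mu> k - N k \<bullet> v) / (N k \<bullet> u)" for k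
  define s where "s = Min (q ` K)"
  obtain j where j: "j \<in> K" "q j = s"
  proof -
    have "s \<in> q ` K" using \<open>finite K\<close> \<open>K \<noteq> {}\<close> by (simp add: s_def)
    then show ?thesis using that by auto
  qed
  have s_le: "s \<le> q k" if "k \<in> K" for k using that \<open>finite K\<close> by (simp add: s_def)
  have j_d: "j < d" and j_pos: "N j \<bullet> u > 0" using j by (auto simp: K_def)
  have j_not: "j \<notin> tight v" using Nu[of j] j_pos by (auto split: if_splits)
  then have "N j \<bullet> v < \<mu> j" using vP j_d by (force simp: tight_def mem_P)
  then have s_pos: "s > 0" using j j_pos by (auto simp: q_def)
  define v' where "v' = v + s *\<^sub>R u"
  have v'P: "v' \<in> P"
    unfolding mem_P
  proof (intro allI impI)
    fix k assume k: "k < d"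
    show "N k \<bullet> v' \<le> \<mu> k"
    proof (cases "k \<in> K")
      case True
      then have "s * (N k \<bullet> u) \<le> \<mu> k - N k \<bullet> v"
        using s_le[OF True] by (simp add: q_def K_def pos_le_divide_eq)
      then show ?thesis by (simp add: v'_def inner_add_right)
    next
      case False
      then have "s * (N k \<bullet> u) \<le> 0" using s_pos k by (simp add: K_def mult_le_0_iff)
      moreover have "N k \<bullet> v \<le> \<mu> k" using vP k by (simp add: mem_P)
      ultimately show ?thesis by (simp add: v'_def inner_add_right)
    qed
  qed
  have "s * (N j \<bullet> u) = \<mu> j - N j \<bullet> v" using j(2)[symmetric] j_pos by (simp add: q_def)
  then have "j \<in> tight v'" using j_d by (simp add: tight_def v'_def inner_add_right)
  moreover have "tight v - {i} \<subseteq> tight v'"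
    using Nu by (auto simp: tight_def v'_def inner_add_right)
  ultimately have sub: "insert j (tight v - {i}) \<subseteq> tight v'" by simp
  have ext: "v' extreme_point_of P"
  proof (rule extreme_pointI[OF v'P])
    fix w assume w: "\<And>k. k \<in> tight v' \<Longrightarrow> N k \<bullet> w = 0"
    have "w + (N i \<bullet> w) *\<^sub>R u = 0"
    proof (rule extreme_point_tight_spans[OF v])
      fix k assume k: "k \<in> tight v"
      show "N k \<bullet> (w + (N i \<bullet> w) *\<^sub>R u) = 0"
        using Nu[OF k] w[of k] sub k by (cases "k = i") (auto simp: inner_add_right)
    qed
    then have w_eq: "w = - (N i \<bullet> w) *\<^sub>R u" by (simp add: eq_neg_iff_add_eq_0)
    have "N j \<bullet> w = 0" using w sub by blast
    then have "- (N i \<bullet> w) * (N j \<bullet> u) = 0" by (subst (asm) w_eq) simp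
    then have "N i \<bullet> w = 0" using j_pos by simp
    then show "w = 0" using w_eq by simp
  qed
  \<comment> \<open>A priori \<open>v'\<close> might lie on further facets; that every vertex lies
    on exactly n of them rules this out.\<close>
  have "card (insert j (tight v - {i})) = card (tight v')"
    using vertex_structure[OF v] vertex_structure[OF ext] i j_not finite_tight
    by (simp add: card_insert_if card_Diff_singleton)
  then have "insert j (tight v - {i}) = tight v'"
    using card_subset_eq[OF finite_tight sub] by simp
  then show ?thesis using j_not ext by (auto simp: vertex_sets_def)
qed

lemma facet_has_vertex:
  assumes i: "i < d"
  shows "\<exists>v. v extreme_point_of P \<and> i \<in> tight v"
proof -
  have "F i facet_of P" using facets i by auto
  then have face: "F i face_of P" "F i \<noteq> {}" by (auto simp: facet_of_def)
  have "compact P" "convex P" using polytope_P by (auto simp: polytope_imp_compact polytope_imp_convex)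
  then have "compact (F i)" "convex (F i)"
    using face face_of_imp_compact face_of_imp_convex by blast+
  then obtain v where v: "v extreme_point_of F i"
    using extreme_point_exists_convex face(2) by blast
  then have "v extreme_point_of P" "v \<in> F i"
    using extreme_point_of_face[OF face(1)] by auto
  then show ?thesis using F_eq[OF i] i by (auto simp: tight_def inner_commute)
qed

sublocale delzant_system d N vertex_sets dual_basis
proof unfold_locales
  fix I assume I: "I \<in> vertex_sets"
  then obtain v where v: "v extreme_point_of P" "I = tight v" by (auto simp: vertex_sets_def)
  show "I \<subseteq> {..<d}" by (auto simp: v(2) tight_def)
  show "card I = CARD('n)" using vertex_structure[OF v(1)] v(2) by simp
  show "N i \<bullet> dual_basis I j = (if i = j then -1 else 0)" if "i \<in> I" "j \<in> I" for i j
    by (rule dual_basis(2)[OF I that])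
  show "\<exists>j'. j' \<notin> I \<and> insert j' (I - {j}) \<in> vertex_sets" if "j \<in> I" for j
    using vertex_exchange[OF v(1)] that v(2) by simp
  show "int_vec (dual_basis I j)" if "j \<in> I" for j by (rule dual_basis(1)[OF I that])
next
  show "int_vec (N i)" if "i < d" for i by (rule normal_int[OF that])
  show "\<exists>I\<in>vertex_sets. i \<in> I" if "i < d" for i
    using facet_has_vertex[OF that] by (auto simp: vertex_sets_def)
  have "0 \<in> P" using \<mu>_pos by (simp add: mem_P less_imp_le)
  moreover have "compact P" "convex P" using polytope_P by (auto simp: polytope_imp_compact polytope_imp_convex)
  ultimately obtain v where "v extreme_point_of P" using extreme_point_exists_convex by blast
  then show "vertex_sets \<noteq> {}" by (auto simp: vertex_sets_def)
qed

end

section \<open>The Todd operator on the boundary volume\<close>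

lemma finite_int_vec_bounded:
  assumes "bounded (S :: (real^'m) set)" shows "finite {z \<in> S. int_vec z}"
proof -
  obtain B where B: "\<And>x. x \<in> S \<Longrightarrow> norm x \<le> B" using assms by (auto simp: bounded_iff)
  let ?R = "{r \<in> \<int>. \<bar>r\<bar> \<le> B}"
  have fin: "finite ?R" by (rule finite_abs_int_segment)
  have "{z \<in> S. int_vec z} \<subseteq> {z. \<forall>i. z $ i \<in> ?R}"
    using B component_le_norm_cart order_trans by (fastforce simp: int_vec_def)
  moreover have "{z :: real^'m. \<forall>i. z $ i \<in> ?R} \<subseteq> vec_lambda ` (PiE UNIV (\<lambda>_. ?R))"
  proof
    fix z :: "real^'m" assume "z \<in> {z. \<forall>i. z $ i \<in> ?R}"
    then show "z \<in> vec_lambda ` (PiE UNIV (\<lambda>_. ?R))" by (intro image_eqI[of _ _ "vec_nth z"]) auto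
  qed
  then have "finite {z :: real^'m. \<forall>i. z $ i \<in> ?R}"
    by (rule finite_subset) (intro finite_imageI finite_PiE fin finite)
  ultimately show ?thesis by (rule finite_subset)
qed

context delzant_presentation
begin

lemma nondeg_\<mu>: "nondeg \<mu>"
  unfolding nondeg_def
proof (intro ballI allI impI)
  fix I i assume I: "I \<in> vertex_sets" and i: "i < d" "i \<notin> I"
  then obtain v where v: "v extreme_point_of P" "I = tight v" by (auto simp: vertex_sets_def)
  have "vtx I \<mu> - v = 0"
  proof (rule orthogonal_imp_zero[OF I])
    fix j assume "j \<in> I"
    then show "N j \<bullet> (vtx I \<mu> - v) = 0"
      using v(2) inner_vtx[OF I, of j \<mu>] by (simp add: inner_diff_right tight_def)
  qed
  then have "vtx I \<mu> = v" by simp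
  moreover have "N i \<bullet> v \<le> \<mu> i" using v i by (auto simp: extreme_point_of_def mem_P)
  moreover have "N i \<bullet> v \<noteq> \<mu> i" using v i by (auto simp: tight_def)
  ultimately show "N i \<bullet> vtx I \<mu> < \<mu> i" by simp
qed

lemma vtx_scale: "vtx I (\<lambda>i. c * lam i) = c *\<^sub>R vtx I lam"
  by (simp add: vtx_def scaleR_sum_right)

lemma nondeg_scale:
  assumes "c > 0" "nondeg lam" shows "nondeg (\<lambda>i. c * lam i)"
  using assms by (simp add: nondeg_def vtx_scale)

lemma nondeg_open:
  assumes lam: "nondeg lam"
  obtains \<delta> where "\<delta> > 0" "\<And>lam'. lam' \<in> nbox d lam \<delta> \<Longrightarrow> nondeg lam'"
proof -
  \<comment> \<open>Moving \<open>lam\<close> by at most \<open>\<delta>\<close> in each coordinate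
    moves \<open>N i \<bullet> vtx I lam\<close> by at most \<open>\<delta>\<close> times the sum;
    the summand 1 pays for the change of \<open>lam i\<close> itself.\<close>
  define C where "C I i = 1 + (\<Sum>j\<in>I. \<bar>N i \<bullet> dual_basis I j\<bar>)" for I i
  let ?S = "{(I, i). I \<in> vertex_sets \<and> i < d \<and> i \<notin> I}"
  have "finite ?S"
    by (rule finite_subset[of _ "vertex_sets \<times> {..<d}"]) (use finite_V in auto)
  then have "eventually (\<lambda>\<delta>. \<forall>p\<in>?S. case p of (I, i) \<Rightarrow> \<delta> * C I i < lam i - N i \<bullet> vtx I lam) (at_right 0)"
  proof (rule eventually_ball_finite, intro ballI)
    fix p assume "p \<in> ?S"
    then obtain I i where p: "p = (I, i)" "I \<in> vertex_sets" "i < d" "i \<notin> I" by auto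
    have "((\<lambda>\<delta>. \<delta> * C I i) \<longlongrightarrow> 0 * C I i) (at_right 0)" by (intro tendsto_intros)
    moreover have "0 * C I i < lam i - N i \<bullet> vtx I lam" using lam p by (simp add: nondeg_def)
    ultimately show "eventually (\<lambda>\<delta>. case p of (I, i) \<Rightarrow> \<delta> * C I i < lam i - N i \<bullet> vtx I lam) (at_right 0)"
      unfolding p prod.case by (rule order_tendstoD(2))
  qed
  then have "eventually (\<lambda>\<delta>. (\<forall>p\<in>?S. case p of (I, i) \<Rightarrow> \<delta> * C I i < lam i - N i \<bullet> vtx I lam) \<and> \<delta> > 0) (at_right 0)"
    using eventually_at_right_less[of "0::real"] by eventually_elim auto
  then obtain \<delta> where \<delta>: "\<delta> > 0" "\<And>I i. I \<in> vertex_sets \<Longrightarrow> i < d \<Longrightarrow> i \<notin> I \<Longrightarrow> \<delta> * C I i < lam i - N i \<bullet> vtx I lam"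
    using eventually_happens'[OF trivial_limit_at_right_real] by blast
  show ?thesis
  proof (rule that[OF \<delta>(1)])
    fix lam' assume lam': "lam' \<in> nbox d lam \<delta>"
    show "nondeg lam'"
      unfolding nondeg_def
    proof (intro ballI allI impI)
      fix I i assume I: "I \<in> vertex_sets" and i: "i < d" "i \<notin> I"
      have le: "\<bar>lam' j - lam j\<bar> \<le> \<delta>" if "j < d" for j using lam' that by (force simp: nbox_def)
      have "N i \<bullet> vtx I lam' - N i \<bullet> vtx I lam = (\<Sum>j\<in>I. - ((lam' j - lam j) * (N i \<bullet> dual_basis I j)))"
        by (simp add: vtx_def inner_sum_right sum_subtractf[symmetric] sum_negf[symmetric] algebra_simps)
      also have "\<dots> \<le> (\<Sum>j\<in>I. \<delta> * \<bar>N i \<bullet> dual_basis I j\<bar>)"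
      proof (rule sum_mono)
        fix j assume "j \<in> I"
        then have "j < d" using V_subset[OF I] by auto
        have "- ((lam' j - lam j) * (N i \<bullet> dual_basis I j)) \<le> \<bar>lam' j - lam j\<bar> * \<bar>N i \<bullet> dual_basis I j\<bar>"
          by (metis abs_ge_minus_self abs_mult)
        also have "\<dots> \<le> \<delta> * \<bar>N i \<bullet> dual_basis I j\<bar>"
          using le[OF \<open>j < d\<close>] by (rule mult_right_mono) simp
        finally show "- ((lam' j - lam j) * (N i \<bullet> dual_basis I j)) \<le> \<delta> * \<bar>N i \<bullet> dual_basis I j\<bar>" .
      qed
      also have "\<dots> = \<delta> * C I i - \<delta>" by (simp add: C_def sum_distrib_left algebra_simps)
      finally show "N i \<bullet> vtx I lam' < lam' i"
        using \<delta>(2)[OF I i] le[OF i(1)] by (simp add: abs_le_iff)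
    qed
  qed
qed

text \<open>All \<open>\<mu> i\<close> with \<open>i < d\<close> are positive, so every
  \<open>poly_of d N lam\<close> fits into a dilate of \<open>P\<close>. The 1 in \<open>L\<close>
  keeps the factor positive even when \<open>lam\<close> vanishes.\<close>

lemma bounded_poly_of: "bounded (poly_of d N lam)"
proof -
  define L where "L = 1 + (\<Sum>i<d. \<bar>lam i\<bar> / \<mu> i)"
  have nonneg: "0 \<le> \<bar>lam i\<bar> / \<mu> i" if "i \<in> {..<d}" for i using \<mu>_pos that by (simp add: less_imp_le)
  then have L: "L > 0" unfolding L_def by (intro add_pos_nonneg sum_nonneg) auto
  have "lam i \<le> L * \<mu> i" if i: "i < d" for i
  proof -
    have "\<bar>lam i\<bar> / \<mu> i \<le> (\<Sum>i<d. \<bar>lam i\<bar> / \<mu> i)"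
      by (rule member_le_sum) (use i nonneg in auto)
    then have "\<bar>lam i\<bar> / \<mu> i \<le> L" by (simp add: L_def)
    then have "\<bar>lam i\<bar> \<le> L * \<mu> i" using \<mu>_pos[OF i] by (simp add: pos_divide_le_eq)
    then show ?thesis by simp
  qed
  have "poly_of d N lam \<subseteq> (\<lambda>x. L *\<^sub>R x) ` P"
  proof
    fix x assume x: "x \<in> poly_of d N lam"
    have "(1 / L) *\<^sub>R x \<in> P"
      unfolding mem_P
    proof (intro allI impI)
      fix i assume i: "i < d"
      have "N i \<bullet> x \<le> L * \<mu> i" using x i \<open>\<And>i. i < d \<Longrightarrow> lam i \<le> L * \<mu> i\<close>[OF i]
        by (force simp: poly_of_def inner_commute)
      then show "N i \<bullet> (1 / L) *\<^sub>R x \<le> \<mu> i" using L by (simp add: pos_divide_le_eq mult.commute)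
    qed
    moreover have "x = L *\<^sub>R (1 / L) *\<^sub>R x" using L by simp
    ultimately show "x \<in> (\<lambda>x. L *\<^sub>R x) ` P" by (rule rev_image_eqI)
  qed
  moreover have "bounded ((\<lambda>x. L *\<^sub>R x) ` P)"
    by (intro bounded_scaling polytope_imp_bounded polytope_P)
  ultimately show ?thesis by (rule bounded_subset[rotated])
qed

lemma \<mu>_int:
  assumes i: "i < d" shows "\<mu> i \<in> \<int>"
proof -
  obtain v where v: "v extreme_point_of P" "i \<in> tight v" using facet_has_vertex[OF i] by blast
  then have "int_vec v" using delzant by (simp add: delzant_def integral_polytope_def)
  then have "N i \<bullet> v \<in> \<int>" by (rule int_vec_inner[OF normal_int[OF i]])
  then show ?thesis using v by (simp add: tight_def)
qed

lemma frontier_P: "x \<in> frontier P \<longleftrightarrow> x \<in> P \<and> (\<exists>i<d. N i \<bullet> x = \<mu> i)"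
proof -
  have int: "x \<in> interior P \<longleftrightarrow> (\<forall>i<d. N i \<bullet> x < \<mu> i)"
  proof
    assume x: "x \<in> interior P"
    show "\<forall>i<d. N i \<bullet> x < \<mu> i"
    proof (intro allI impI)
      fix i assume i: "i < d"
      have "interior P \<subseteq> interior {x. N i \<bullet> x \<le> \<mu> i}"
        using i by (intro interior_mono) (auto simp: mem_P)
      also have "\<dots> = {x. N i \<bullet> x < \<mu> i}" by (rule interior_halfspace_le[OF normal_nonzero[OF i]])
      finally show "N i \<bullet> x < \<mu> i" using x by auto
    qed
  qed (use strict_interior in auto)
  have "closed P" using polytope_P by (rule polytope_imp_closed)
  then have "x \<in> frontier P \<longleftrightarrow> x \<in> P \<and> x \<notin> interior P" by (simp add: frontier_def)
  then show ?thesis unfolding int using mem_P by (metis less_le not_less)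
qed

theorem todd_op_boundary:
  assumes k: "(k::nat) > 0"
  shows "\<forall>\<^sub>F M in sequentially. todd_op_trunc d M (vol_boundary d N) (\<lambda>i. real k * \<mu> i)
           = real (card {z. int_vec z \<and> z \<in> (\<lambda>x. real k *\<^sub>R x) ` frontier P})"
proof -
  define lam where "lam = (\<lambda>i. real k * \<mu> i)"
  obtain \<xi> where gen: "generic \<xi>" using exists_generic by blast
  have lam: "nondeg lam" unfolding lam_def using k nondeg_\<mu> by (intro nondeg_scale) auto
  have lam_int: "lam i \<in> \<int>" if "i < d" for i using \<mu>_int[OF that] by (simp add: lam_def)
  obtain \<delta> where \<delta>: "\<delta> > 0" "\<And>lam'. lam' \<in> nbox d lam \<delta> \<Longrightarrow> nondeg lam'"
    using nondeg_open[OF lam] by blast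
  \<comment> \<open>Below 1, so that no lattice point lies strictly between a facet hyperplane and
    its shift; below \<open>\<delta>\<close>, so that the shrunk polytope stays
    nondegenerate.\<close>
  define \<epsilon> where "\<epsilon> = min \<delta> 1 / 2"
  have \<epsilon>: "0 < \<epsilon>" "\<epsilon> < 1" "\<epsilon> < \<delta>" using \<delta>(1) by (auto simp: \<epsilon>_def min_def)
  have lam_\<epsilon>: "nondeg (\<lambda>i. lam i - \<epsilon>)" using \<epsilon> by (intro \<delta>(2)) (simp add: nbox_def)
  define B where "B = {z. int_vec z \<and> z \<in> poly_of d N lam \<and> z \<notin> poly_of d N (\<lambda>i. lam i - \<epsilon>)}"
  have "finite B"
    by (rule finite_subset[OF _ finite_int_vec_bounded[OF bounded_poly_of[of lam]]]) (auto simp: B_def)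
  note count = boundary_lattice_points[OF gen lam_int lam \<epsilon>(1,2) lam_\<epsilon> B_def this]
  have B_eq: "B = {z. int_vec z \<and> z \<in> (\<lambda>x. real k *\<^sub>R x) ` frontier P}"
    unfolding B_def
  proof (intro Collect_cong conj_cong refl)
    fix z :: "real^'n" assume z: "int_vec z"
    have "z \<in> (\<lambda>x. real k *\<^sub>R x) ` frontier P \<longleftrightarrow> (1 / real k) *\<^sub>R z \<in> frontier P"
    proof
      assume "(1 / real k) *\<^sub>R z \<in> frontier P"
      then show "z \<in> (\<lambda>x. real k *\<^sub>R x) ` frontier P" by (rule rev_image_eqI) (use k in simp)
    qed (use k in auto)
    also have "\<dots> \<longleftrightarrow> (\<forall>i<d. N i \<bullet> z \<le> lam i) \<and> (\<exists>i<d. N i \<bullet> z = lam i)"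
      unfolding frontier_P mem_P using k by (simp add: lam_def field_simps)
    also have "\<dots> \<longleftrightarrow> (\<forall>i<d. N i \<bullet> z \<le> lam i) \<and> (\<exists>i<d. N i \<bullet> z > lam i - \<epsilon>)"
    proof (intro conj_cong refl iffI)
      assume le: "\<forall>i<d. N i \<bullet> z \<le> lam i" and "\<exists>i<d. N i \<bullet> z > lam i - \<epsilon>"
      then obtain i where i: "i < d" "N i \<bullet> z > lam i - \<epsilon>" by blast
      have "lam i - N i \<bullet> z \<in> \<int>"
        using lam_int[OF i(1)] int_vec_inner[OF normal_int[OF i(1)] z] by (rule Ints_diff)
      then obtain a where a: "lam i - N i \<bullet> z = of_int a" by (rule Ints_cases)
      have "0 \<le> real_of_int a" "real_of_int a < 1" unfolding a[symmetric] using le i \<epsilon> by auto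
      then have "a = 0" by linarith
      then show "\<exists>i<d. N i \<bullet> z = lam i" using a i by auto
    qed (use \<epsilon> in force)
    finally show "z \<in> poly_of d N lam \<and> z \<notin> poly_of d N (\<lambda>i. lam i - \<epsilon>) \<longleftrightarrow> z \<in> (\<lambda>x. real k *\<^sub>R x) ` frontier P"
      by (auto simp: poly_of_def inner_commute not_le)
  qed
  \<comment> \<open>The exponent n - 1 comes from \<open>vol_boundary_eq\<close>, and on the box of
    radius \<open>\<delta>\<close> every right-hand side is nondegenerate.\<close>
  interpret power_sum_rep d "CARD('n) - 1" vertex_sets "weight \<xi>" lam \<delta>
    by unfold_locales (rule finite_V)
  have rep: "rep (amplitude \<xi>) 0 (vol_boundary d N)"
    unfolding rep_def using vol_boundary_eq[OF gen \<delta>(2) bounded_poly_of] by blast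
  have "lam \<in> nbox d lam \<delta>" using \<delta>(1) by (simp add: nbox_def)
  from todd_op_trunc_eq_fps_nth[OF rep this]
  have "todd_op_trunc d M (vol_boundary d N) lam = real (card B)" if "CARD('n) - 1 \<le> M" for M
    by (rule trans[OF _ count[symmetric]]) (rule that)
  then show ?thesis
    unfolding B_eq[symmetric] lam_def[symmetric] by (auto simp: eventually_sequentially)
qed

end

theorem theorem1p1:
  fixes P :: "(real^'n) set"
    and d :: nat
    and F :: "nat \<Rightarrow> (real^'n) set"
    and N :: "nat \<Rightarrow> real^'n"
    and \<mu> :: "nat \<Rightarrow> real"
    and k :: nat
  assumes "delzant P"
    and "inj_on F {..<d}"
    and "{G. G facet_of P} = F ` {..<d}"
    and "\<And>i. i < d \<Longrightarrow> primitive_vec (N i)"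
    and "\<And>i. i < d \<Longrightarrow> \<mu> i > 0"
    and "\<And>i. i < d \<Longrightarrow> F i = P \<inter> {x. x \<bullet> N i = \<mu> i}"
    and "P = (\<Inter>i\<in>{..<d}. {x. x \<bullet> N i \<le> \<mu> i})"
    and "k > 0"
  shows "\<forall>\<^sub>F M in sequentially.
           todd_op_trunc d M (vol_boundary d N) (\<lambda>i. real k * \<mu> i)
           = real (card {z. int_vec z \<and> z \<in> (\<lambda>x. real k *\<^sub>R x) ` frontier P})"
proof -
  interpret delzant_presentation P d F N \<mu>
    by (rule delzant_presentation.intro) (fact assms)+
  show ?thesis by (rule todd_op_boundary[OF assms(8)])
qed

end
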